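(* Let $X$ be a Banach space, $n\ge 1$ an integer, and let $\mathscr{D}$ be a dyadic system on $\mathbb{R}^n$ with associated Rademacher maximal operator $\mathscr{M}$. The following conditions are equivalent: (i) $\mathscr{M}: L^p(w;X)\to L^p(w)$ for all $p\in(1,\infty)$ and all $w\in A_p$; that is, for every $p\in(1,\infty)$ and $w\in A_p$ there is a constant $C$ with $\int_{\mathbb{R}^n}\mathscr{M}f(x)^p w(x)\,dx\le C\int_{\mathbb{R}^n}\|f(x)\|^p w(x)\,dx$ for all $f\in L^p(w;X)$; (ii) $\mathscr{M}: L^p(X)\to L^p$ for some $p\in(1,\infty)$; that is, for some $p\in(1,\infty)$ there is a constant $C$ with $\int_{\mathbb{R}^n}\mathscr{M}f(x)^p\,dx\le C\int_{\mathbb{R}^n}\|f(x)\|^p\,dx$ for all $f\in L^p(X)$; (iii) $\mathscr{M}: L^1(X)\to L^{1,\infty}$; that is, there is a constant $C$ with $|\{x\in\mathbb{R}^n:\mathscr{M}f(x)>\lambda\}|\le \frac{C}{\lambda}\|f\|_{L^1(X)}$ for all $f\in L^1(X)$ and $\lambda>0$; (iv) $\mathscr{M}: H^1(X)\to L^{1,\infty}$; that is, there is a constant $C$ with $|\{x\in\mathbb{R}^n:\mathscr{M}f(x)>\lambda\}|\le \frac{C}{\lambda}\|f\|_{H^1(X)}$ for all $f\in H^1(X)$ and $\lambda>0$.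
   Context: Dyadic system: $\mathscr{D}=\bigcup_{k\in\mathbb{Z}}\mathscr{D}_k$, where each $\mathscr{D}_k$ is a partition of $\mathbb{R}^n$ into (half-open, axis-parallel) cubes of sidelength $2^{-k}$ and every $Q\in\mathscr{D}_k$ is a union of $2^n$ cubes of $\mathscr{D}_{k+1}$. The standard example is $\mathscr{D}_k=\{2^{-k}([0,1)^n+m):m\in\mathbb{Z}^n\}$. "Dyadic cube" means an element of $\mathscr{D}$; $|\cdot|$ is Lebesgue measure. R-bound: let $(\varepsilon_k)$ be independent random variables taking values $+1$ and $-1$, each with probability $1/2$, and let $\mathbb{E}$ denote expectation. For $S\subset X$, the R-bound $\mathscr{R}(S)\in[0,\infty]$ is the smallest $C$ such that $\big(\mathbb{E}\|\sum_k\varepsilon_k\lambda_k\xi_k\|^2\big)^{1/2}\le C\big(\sum_k|\lambda_k|^2\big)^{1/2}$ for all finite families of vectors $\xi_k\in S$ and scalars $\lambda_k$ ($\mathscr{R}(S)=\infty$ if no such $C$ exists). Rademacher maximal function: for $f\in L^1_{\mathrm{loc}}(X)$ (locally Bochner integrable $f:\mathbb{R}^n\to X$), $\langle f\rangle_Q=\frac{1}{|Q|}\int_Q f(y)\,dy$ and $\mathscr{M}f(x)=\mathscr{R}(\langle f\rangle_Q: Q\in\mathscr{D},\,Q\ni x)\in[0,\infty]$, $x\in\mathbb{R}^n$. $L^p(X)$ is the Lebesgue–Bochner space of $X$-valued $p$-integrable functions on $\mathbb{R}^n$, and $L^p(w;X)$ is the same with respect to the measure $w(x)\,dx$. $H^1(X)$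 is the space of $f\in L^1(X)$ such that the dyadic maximal function $Mf(x)=\sup_{Q\ni x}\|\langle f\rangle_Q\|$ (supremum over $Q\in\mathscr{D}$) is integrable, with norm $\|f\|_{H^1(X)}=\|Mf\|_{L^1}$. Weights: for $1<p<\infty$ with Hölder conjugate $p'$, the dyadic Muckenhoupt class $A_p$ consists of non-negative locally integrable functions $w$ on $\mathbb{R}^n$ for which there is a constant $C$ with $\big(\frac{1}{|Q|}\int_Q w\,dx\big)\big(\frac{1}{|Q|}\int_Q w^{1-p'}\,dx\big)^{p-1}\le C$ for every $Q\in\mathscr{D}$; as usual both factors are understood to be finite, so $w>0$ almost everywhere. *)

theory Defs
  imports "HOL-Probability.Probability"
begin

section \<open>Bochner integration in arbitrary Banach spaces\<close>

text \<open>
  The library restricts the Bochner integral to second countable (that is, separable) range types.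
  The definitions below follow \<^const>\<open>has_bochner_integral\<close>, with Borel measurability
  replaced by strong measurability, and make sense in every normed space. For complete measures
  and separable spaces they agree with the library (see below).
\<close>

definition strongly_measurable :: "'a measure \<Rightarrow> ('a \<Rightarrow> 'b::topological_space) \<Rightarrow> bool" where
  "strongly_measurable M f \<longleftrightarrow>
     (\<exists>s. (\<forall>i::nat. simple_function M (s i)) \<and> (AE x in M. (\<lambda>i. s i x) \<longlonglongrightarrow> f x))"

definition has_strong_integral :: "'a measure \<Rightarrow> ('a \<Rightarrow> 'b::real_normed_vector) \<Rightarrow> 'b \<Rightarrow> bool" where
  "has_strong_integral M f I \<longleftrightarrow> strongly_measurable M f \<and>
     (\<exists>s. (\<forall>i::nat. Bochner_Integration.simple_bochner_integrable M (s i)) \<and>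
          (\<lambda>i. \<integral>\<^sup>+x. ennreal (norm (f x - s i x)) \<partial>M) \<longlonglongrightarrow> 0 \<and>
          (\<lambda>i. Bochner_Integration.simple_bochner_integral M (s i)) \<longlonglongrightarrow> I)"

definition strong_integral :: "'a measure \<Rightarrow> ('a \<Rightarrow> 'b::real_normed_vector) \<Rightarrow> 'b" where
  "strong_integral M f =
     (if \<exists>I. has_strong_integral M f I then THE I. has_strong_integral M f I else 0)"

lemma strongly_measurable_completion_iff:
  fixes f :: "'a \<Rightarrow> 'b::{metric_space,second_countable_topology}"
  shows "strongly_measurable (completion M) f \<longleftrightarrow> f \<in> borel_measurable (completion M)"
proof
  assume "strongly_measurable (completion M) f"
  then obtain s where s: "\<And>i::nat. simple_function (completion M) (s i)"
    and AE: "AE x in completion M. (\<lambda>i. s i x) \<longlonglongrightarrow> f x"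
    unfolding strongly_measurable_def by blast
  obtain N where N: "N \<in> null_sets (completion M)"
    "{x \<in> space (completion M). \<not> (\<lambda>i. s i x) \<longlonglongrightarrow> f x} \<subseteq> N"
    using AE unfolding eventually_ae_filter by blast
  define c :: 'b where "c = undefined"
  define g where "g = (\<lambda>x. if x \<in> N then c else f x)"
  have Nm [measurable]: "N \<in> sets (completion M)"
    using N(1) by auto
  have s_meas: "s i \<in> borel_measurable (completion M)" for i
    using s borel_measurable_simple_function by blast
  have "(\<lambda>x. if x \<in> N then c else s i x) \<in> borel_measurable (completion M)" for i
    using Nm s_meas[of i] by measurable
  then have g: "g \<in> borel_measurable (completion M)"
    by (rule borel_measurable_LIMSEQ_metric) (use N(2) in \<open>auto simp: g_def\<close>)
  show "f \<in> borel_measurable (completion M)"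
  proof (rule measurableI)
    fix A :: "'b set" assume A: "A \<in> sets borel"
    have eq: "f -` A \<inter> space (completion M) =
        ((g -` A \<inter> space (completion M)) - N) \<union> (f -` A \<inter> space (completion M) \<inter> N)"
      by (auto simp: g_def)
    have 1: "(g -` A \<inter> space (completion M)) - N \<in> sets (completion M)"
      using measurable_sets[OF g A] Nm by blast
    have 2: "f -` A \<inter> space (completion M) \<inter> N \<in> sets (completion M)"
      by (rule completion.complete[OF _ N(1)]) blast
    show "f -` A \<inter> space (completion M) \<in> sets (completion M)"
      by (subst eq) (rule sets.Un[OF 1 2])
  qed simp
next
  assume "f \<in> borel_measurable (completion M)"
  from borel_measurable_implies_sequence_metric[OF this]
  obtain s where "\<forall>i. simple_function (completion M) (s i)"
    "\<forall>x\<in>space (completion M). (\<lambda>i. s i x) \<longlonglongrightarrow> f x"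
    by blast
  then show "strongly_measurable (completion M) f"
    unfolding strongly_measurable_def by (intro exI[of _ s] conjI AE_I2) auto
qed

lemma has_strong_integral_completion_iff:
  fixes f :: "'a \<Rightarrow> 'b::{real_normed_vector,second_countable_topology}"
  shows "has_strong_integral (completion M) f I \<longleftrightarrow> has_bochner_integral (completion M) f I"
  unfolding has_strong_integral_def has_bochner_integral.simps strongly_measurable_completion_iff
  by (intro iffI; elim conjE exE; intro conjI exI; simp)

lemma strong_integral_completion_eq:
  fixes f :: "'a \<Rightarrow> 'b::{real_normed_vector,second_countable_topology}"
  shows "strong_integral (completion M) f = integral\<^sup>L (completion M) f"
  by (simp only: strong_integral_def lebesgue_integral_def has_strong_integral_completion_iff)

text \<open>For \<open>p = 1\<close> this is the space of Bochner integrable functions.\<close>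

definition Lp :: "'a measure \<Rightarrow> real \<Rightarrow> ('a \<Rightarrow> 'b::real_normed_vector) set" where
  "Lp M p = {f. strongly_measurable M f \<and> (\<integral>\<^sup>+x. ennreal (norm (f x) powr p) \<partial>M) < \<infinity>}"

text \<open>Intended for \<open>p > 0\<close>.\<close>

definition ennreal_powr :: "ennreal \<Rightarrow> real \<Rightarrow> ennreal" where
  "ennreal_powr a p = (if a = \<infinity> then \<infinity> else ennreal (enn2real a powr p))"


section \<open>R-bounds\<close>

text \<open>
  A Banach space may be real or complex. The real structure is that of the type class; the scalar
  field is a type \<open>'k\<close> of class \<open>real_normed_field\<close> and \<open>real_inner\<close> (which comprises
  \<^typ>\<open>real\<close> and \<^typ>\<open>complex\<close>), acting by \<open>smul\<close>.
\<close>

definition banach_scaling ::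
  "('k::{real_normed_field,real_inner} \<Rightarrow> 'x::real_normed_vector \<Rightarrow> 'x) \<Rightarrow> bool" where
  "banach_scaling smul \<longleftrightarrow> vector_space smul \<and>
     (\<forall>a x. norm (smul a x) = norm a * norm x) \<and>
     (\<forall>r x. smul (of_real r) x = r *\<^sub>R x)"

lemma banach_scaling_scaleR: "banach_scaling (scaleR :: real \<Rightarrow> 'x::real_normed_vector \<Rightarrow> 'x)"
  unfolding banach_scaling_def by (auto simp: real_vector.vector_space_axioms)

lemma banach_scaling_complex: "banach_scaling ((*) :: complex \<Rightarrow> complex \<Rightarrow> complex)"
  unfolding banach_scaling_def vector_space_def
  by (auto simp: norm_mult scaleR_conv_of_real algebra_simps)

text \<open>The joint law of independent random signs with indices \<open>0, \<dots>, N - 1\<close>.\<close>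

definition random_signs :: "nat \<Rightarrow> (nat \<Rightarrow> real) pmf" where
  "random_signs N = Pi_pmf {..<N} 0 (\<lambda>_. pmf_of_set {-1, 1})"

definition R_bound ::
  "('k::real_normed_field \<Rightarrow> 'x::real_normed_vector \<Rightarrow> 'x) \<Rightarrow> 'x set \<Rightarrow> ennreal" where
  "R_bound smul S = (INF C\<in>{C::real. 0 \<le> C \<and>
     (\<forall>N. \<forall>\<xi>. \<forall>a. (\<forall>k<N. \<xi> k \<in> S) \<longrightarrow>
        sqrt (measure_pmf.expectation (random_signs N)
                (\<lambda>\<epsilon>. (norm (\<Sum>k<N. \<epsilon> k *\<^sub>R smul (a k) (\<xi> k)))\<^sup>2))
          \<le> C * sqrt (\<Sum>k<N. (norm (a k))\<^sup>2))}. ennreal C)"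


section \<open>Dyadic systems, averages and maximal functions\<close>

definition half_open_cube :: "real^'n \<Rightarrow> real \<Rightarrow> (real^'n) set" where
  "half_open_cube a s = {x. \<forall>i. a $ i \<le> x $ i \<and> x $ i < a $ i + s}"

definition dyadic_system :: "(int \<Rightarrow> (real^'n) set set) \<Rightarrow> bool" where
  "dyadic_system D \<longleftrightarrow>
     (\<forall>k. partition_on UNIV (D k) \<and>
          (\<forall>Q\<in>D k. \<exists>a. Q = half_open_cube a (2 powi (-k))) \<and>
          (\<forall>Q\<in>D k. \<exists>P\<subseteq>D (k + 1). card P = 2 ^ CARD('n) \<and> Q = \<Union>P))"

definition dyadic_cubes :: "(int \<Rightarrow> (real^'n) set set) \<Rightarrow> (real^'n) set set" where
  "dyadic_cubes D = (\<Union>k. D k)"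

definition average :: "(real^'n \<Rightarrow> 'x::real_normed_vector) \<Rightarrow> (real^'n) set \<Rightarrow> 'x" where
  "average f Q = (1 / measure lebesgue Q) *\<^sub>R strong_integral lebesgue (\<lambda>y. indicator Q y *\<^sub>R f y)"

definition rademacher_maximal ::
  "('k::real_normed_field \<Rightarrow> 'x::real_normed_vector \<Rightarrow> 'x) \<Rightarrow> (int \<Rightarrow> (real^'n) set set)
     \<Rightarrow> (real^'n \<Rightarrow> 'x) \<Rightarrow> real^'n \<Rightarrow> ennreal" where
  "rademacher_maximal smul D f x = R_bound smul {average f Q | Q. Q \<in> dyadic_cubes D \<and> x \<in> Q}"

definition dyadic_maximal ::
  "(int \<Rightarrow> (real^'n) set set) \<Rightarrow> (real^'n \<Rightarrow> 'x::real_normed_vector) \<Rightarrow> real^'n \<Rightarrow> ennreal" where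
  "dyadic_maximal D f x = (SUP Q\<in>{Q \<in> dyadic_cubes D. x \<in> Q}. ennreal (norm (average f Q)))"

definition L1_norm :: "(real^'n \<Rightarrow> 'x::real_normed_vector) \<Rightarrow> ennreal" where
  "L1_norm f = (\<integral>\<^sup>+x. ennreal (norm (f x)) \<partial>lebesgue)"

definition H1_norm ::
  "(int \<Rightarrow> (real^'n) set set) \<Rightarrow> (real^'n \<Rightarrow> 'x::real_normed_vector) \<Rightarrow> ennreal" where
  "H1_norm D f = (\<integral>\<^sup>+x. dyadic_maximal D f x \<partial>lebesgue)"

definition H1 :: "(int \<Rightarrow> (real^'n) set set) \<Rightarrow> (real^'n \<Rightarrow> 'x::real_normed_vector) set" where
  "H1 D = {f \<in> Lp lebesgue 1. H1_norm D f < \<infinity>}"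


section \<open>Dyadic Muckenhoupt weights\<close>

text \<open>
  With \<open>p' = p / (p - 1)\<close>. Since \<open>0 powr a = 0\<close> in the library, the convention that
  \<open>w\<close> raised to \<open>1 - p'\<close> is infinite where \<open>w\<close> vanishes is rendered by positivity almost
  everywhere, and finiteness of both averages by integrability.
\<close>

definition dyadic_A_p :: "(int \<Rightarrow> (real^'n) set set) \<Rightarrow> real \<Rightarrow> (real^'n \<Rightarrow> real) set" where
  "dyadic_A_p D p = {w. (\<forall>x. 0 \<le> w x) \<and>
     (\<forall>K. compact K \<longrightarrow> set_integrable lebesgue K w) \<and>
     (AE x in lebesgue. 0 < w x) \<and>
     (\<forall>Q\<in>dyadic_cubes D. set_integrable lebesgue Q w \<and>
        set_integrable lebesgue Q (\<lambda>x. w x powr (1 - p / (p - 1)))) \<and>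
     (\<exists>C::real. \<forall>Q\<in>dyadic_cubes D.
        (1 / measure lebesgue Q * (LINT x:Q|lebesgue. w x)) *
        (1 / measure lebesgue Q * (LINT x:Q|lebesgue. w x powr (1 - p / (p - 1)))) powr (p - 1)
          \<le> C)}"

definition weighted_measure :: "(real^'n \<Rightarrow> real) \<Rightarrow> (real^'n) measure" where
  "weighted_measure w = density lebesgue (\<lambda>x. ennreal (w x))"


section \<open>Boundedness of the Rademacher maximal operator\<close>

definition rademacher_strong_type ::
  "('k::real_normed_field \<Rightarrow> 'x::real_normed_vector \<Rightarrow> 'x) \<Rightarrow> (int \<Rightarrow> (real^'n) set set)
     \<Rightarrow> (real^'n) measure \<Rightarrow> real \<Rightarrow> bool" where
  "rademacher_strong_type smul D M p \<longleftrightarrow>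
     (\<exists>C::real. 0 \<le> C \<and> (\<forall>f\<in>Lp M p.
        (\<integral>\<^sup>+x. ennreal_powr (rademacher_maximal smul D f x) p \<partial>M)
          \<le> ennreal C * (\<integral>\<^sup>+x. ennreal (norm (f x) powr p) \<partial>M)))"

definition rademacher_weak_type ::
  "('k::real_normed_field \<Rightarrow> 'x::real_normed_vector \<Rightarrow> 'x) \<Rightarrow> (int \<Rightarrow> (real^'n) set set)
     \<Rightarrow> (real^'n \<Rightarrow> 'x) set \<Rightarrow> ((real^'n \<Rightarrow> 'x) \<Rightarrow> ennreal) \<Rightarrow> bool" where
  "rademacher_weak_type smul D F nrm \<longleftrightarrow>
     (\<exists>C::real. 0 \<le> C \<and> (\<forall>f\<in>F. \<forall>t::real. 0 < t \<longrightarrow>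
        emeasure lebesgue {x. rademacher_maximal smul D f x > ennreal t}
          \<le> ennreal (C / t) * nrm f))"

end

theory Submission
  imports Defs
begin

text \<open>
  Everything is reduced to one local estimate: on a dyadic cube \<open>Q\<close>, the R-bound of the averages over
  the subcubes of \<open>Q\<close> containing \<open>x\<close> exceeds a fixed multiple of the mean of \<open>\<parallel>f\<parallel>\<close> over \<open>Q\<close> for at
  most half of the points \<open>x\<close> of \<open>Q\<close>. It follows from (iv): stopping at the first cubes where the mean of
  \<open>\<parallel>f\<parallel>\<close> is large replaces \<open>f\<close>, off a small set, by a bounded function with the same averages, and a
  bounded function minus its mean over \<open>Q\<close> has \<open>H\<^sup>1\<close> norm at most a multiple of \<open>|Q|\<close>. Since R-bounds are
  subadditive under unions and the averages over the strict ancestors of a maximal cube of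
  \<open>{\<M>f > \<lambda>}\<close> have R-bound at most \<open>\<lambda>\<close>, the local estimate yields a good-lambda inequality between
  \<open>\<M>f\<close> and the dyadic maximal function of \<open>\<parallel>f\<parallel>\<close> for every \<open>A\<^sub>p\<close> weight, hence (i). The weak estimate
  (iii) follows from any unweighted strong estimate by the same stopping argument. Averages are
  always truncated to finitely many levels, which makes differentiation theorems unnecessary.
\<close>

section \<open>The Bochner integral without separability\<close>

text \<open>Two obstacles shape the proof. \<open>X\<close> need not be separable, so vector-valued
  functions enter nonnegative integrals only through their norms, and maximal functions are
  measurable because their truncations are constant on the cubes of one level, of which there are
  countably many. Moreover, the good-lambda inequality can be absorbed only if its left-hand side is
  known to be finite. Truncation to levels k, ..., N provides this, since the R-bound of finitely
  many vectors is at most the sum of their norms; the resulting constants do not depend on k and N.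
  Half of a cube is a good threshold because for an A_p weight a set of at most half the volume
  carries at most a fraction 1 - \<delta> of the weight. That this fraction may be close to 1 is
  repaired by comparing the heights l and a l with a so close to 1 that a^(-p) = 1 - \<delta> / 2.
  The scalars form an inner product space, so random sums of multiples of one vector have an exactly
  known second moment; hence subtracting a mean changes an R-bound by at most the norm of that
  mean.\<close>

abbreviation simple_integrable :: "'a measure \<Rightarrow> ('a \<Rightarrow> 'b::real_vector) \<Rightarrow> bool" where
  "simple_integrable \<equiv> Bochner_Integration.simple_bochner_integrable"

abbreviation simple_integral_of :: "'a measure \<Rightarrow> ('a \<Rightarrow> 'b::real_vector) \<Rightarrow> 'b" where
  "simple_integral_of \<equiv> Bochner_Integration.simple_bochner_integral"

text \<open>One continuity argument serves scaling, sums, differences and norms alike: joint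
  continuity carries both pointwise limits through \<open>p\<close>.\<close>

lemma strongly_measurable_compose2:
  fixes p :: "'b::t2_space \<Rightarrow> 'c::t2_space \<Rightarrow> 'd::topological_space"
  assumes "strongly_measurable M f" "strongly_measurable M g"
    and p: "continuous_on UNIV (\<lambda>z. p (fst z) (snd z))"
  shows "strongly_measurable M (\<lambda>x. p (f x) (g x))"
proof -
  obtain s t where st: "\<And>i::nat. simple_function M (s i)" "\<And>i::nat. simple_function M (t i)"
    and AE: "AE x in M. (\<lambda>i. s i x) \<longlonglongrightarrow> f x" "AE x in M. (\<lambda>i. t i x) \<longlonglongrightarrow> g x"
    using assms(1,2) unfolding strongly_measurable_def by blast
  have "simple_function M (\<lambda>x. p (s i x) (t i x))" for i
    using st by (rule simple_function_compose2)
  moreover have "AE x in M. (\<lambda>i. p (s i x) (t i x)) \<longlonglongrightarrow> p (f x) (g x)"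
    using AE
  proof eventually_elim
    case (elim x)
    have "isCont (\<lambda>z. p (fst z) (snd z)) (f x, g x)"
      using p by (simp add: continuous_on_eq_continuous_at)
    from isCont_tendsto_compose[OF this tendsto_Pair[OF elim]] show ?case
      by simp
  qed
  ultimately show ?thesis
    unfolding strongly_measurable_def by (intro exI[of _ "\<lambda>i x. p (s i x) (t i x)"]) auto
qed

lemma strongly_measurable_simple: "simple_function M f \<Longrightarrow> strongly_measurable M f"
  unfolding strongly_measurable_def by (intro exI[of _ "\<lambda>_. f"]) auto

lemma strongly_measurable_const: "strongly_measurable M (\<lambda>_. c)"
  by (simp add: strongly_measurable_simple)

lemma strongly_measurable_indicator: "A \<in> sets M \<Longrightarrow> strongly_measurable M (indicator A :: _ \<Rightarrow> real)"
  by (simp add: strongly_measurable_simple simple_function_indicator)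

lemma strongly_measurable_indicator_scaleR:
  fixes f :: "'a \<Rightarrow> 'b::real_normed_vector"
  assumes "A \<in> sets M" "strongly_measurable M f"
  shows "strongly_measurable M (\<lambda>x. indicator A x *\<^sub>R f x)"
  using assms
  by (intro strongly_measurable_compose2[where p="\<lambda>a b. a *\<^sub>R b"] strongly_measurable_indicator)
     (auto intro!: continuous_intros)

lemma strongly_measurable_diff:
  fixes f :: "'a \<Rightarrow> 'b::real_normed_vector"
  assumes "strongly_measurable M f" "strongly_measurable M g"
  shows "strongly_measurable M (\<lambda>x. f x - g x)"
  using assms
  by (intro strongly_measurable_compose2[where p="\<lambda>a b. a - b"]) (auto intro!: continuous_intros)

lemma strongly_measurable_add:
  fixes f :: "'a \<Rightarrow> 'b::real_normed_vector"
  assumes "strongly_measurable M f" "strongly_measurable M g"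
  shows "strongly_measurable M (\<lambda>x. f x + g x)"
  using assms
  by (intro strongly_measurable_compose2[where p="\<lambda>a b. a + b"]) (auto intro!: continuous_intros)

lemma strongly_measurable_scaleR:
  fixes f :: "'a \<Rightarrow> 'b::real_normed_vector"
  assumes "strongly_measurable M f"
  shows "strongly_measurable M (\<lambda>x. c *\<^sub>R f x)"
  using assms
  by (intro strongly_measurable_compose2[where p="\<lambda>a b. a *\<^sub>R b"] strongly_measurable_const)
     (auto intro!: continuous_intros)

lemma strongly_measurable_norm:
  fixes f :: "'a \<Rightarrow> 'b::real_normed_vector"
  assumes "strongly_measurable M f"
  shows "strongly_measurable M (\<lambda>x. norm (f x))"
  using assms
  by (intro strongly_measurable_compose2[where p="\<lambda>a b. norm a" and g=f])
     (auto intro!: continuous_intros)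

text \<open>Norms are real-valued, and over a completion strong and Borel measurability agree for
  separable ranges. This is how vector-valued functions reach the nonnegative integral.\<close>

lemma borel_measurable_norm_strong:
  fixes f :: "'a \<Rightarrow> 'b::real_normed_vector"
  assumes "strongly_measurable (completion M) f"
  shows "(\<lambda>x. norm (f x)) \<in> borel_measurable (completion M)"
  using strongly_measurable_norm[OF assms] by (simp add: strongly_measurable_completion_iff)

lemma simple_bochner_integrable_strong:
  "simple_integrable M s \<Longrightarrow> strongly_measurable M s"
  by (auto intro: strongly_measurable_simple elim: Bochner_Integration.simple_bochner_integrable.cases)

lemma ennreal_norm_triangle:
  "ennreal (norm (a + b)) \<le> ennreal (norm a) + ennreal (norm (b::'b::real_normed_vector))"
  by (simp add: norm_triangle_ineq flip: ennreal_plus)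

lemma nn_integral_norm_add_le:
  fixes f g :: "'a \<Rightarrow> 'b::real_normed_vector"
  assumes "strongly_measurable (completion M) f" "strongly_measurable (completion M) g"
  shows "(\<integral>\<^sup>+x. norm (f x + g x) \<partial>completion M)
    \<le> (\<integral>\<^sup>+x. norm (f x) \<partial>completion M) + (\<integral>\<^sup>+x. norm (g x) \<partial>completion M)"
proof -
  have [measurable]: "(\<lambda>x. norm (f x)) \<in> borel_measurable (completion M)"
    "(\<lambda>x. norm (g x)) \<in> borel_measurable (completion M)"
    using assms by (auto intro: borel_measurable_norm_strong)
  have "(\<integral>\<^sup>+x. norm (f x + g x) \<partial>completion M)
    \<le> (\<integral>\<^sup>+x. ennreal (norm (f x)) + ennreal (norm (g x)) \<partial>completion M)"
    by (intro nn_integral_mono ennreal_norm_triangle)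
  also have "\<dots> = (\<integral>\<^sup>+x. norm (f x) \<partial>completion M) + (\<integral>\<^sup>+x. norm (g x) \<partial>completion M)"
    by (rule nn_integral_add) measurable
  finally show ?thesis .
qed

lemma norm_simple_bochner_integral_le:
  assumes "simple_integrable M s"
  shows "ennreal (norm (simple_integral_of M s)) \<le> (\<integral>\<^sup>+x. norm (s x) \<partial>M)"
proof -
  have "norm (simple_integral_of M s)
      \<le> simple_integral_of M (\<lambda>x. norm (s x))"
    using assms by (rule simple_bochner_integral_norm_bound)
  then show ?thesis
    using simple_bochner_integrable_compose2[of "\<lambda>x y. norm x" M s s] assms
    by (subst simple_bochner_integral_eq_nn_integral[symmetric]) auto
qed

text \<open>The bound holds for the simple approximants and survives the limit because their L^1
  distance to \<open>f\<close> tends to 0. Uniqueness of the integral is derived from it as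
  well.\<close>

lemma has_strong_integral_norm_le:
  fixes f :: "'a \<Rightarrow> 'b::real_normed_vector"
  assumes "has_strong_integral (completion M) f I"
  shows "ennreal (norm I) \<le> (\<integral>\<^sup>+x. norm (f x) \<partial>completion M)"
proof -
  let ?M = "completion M"
  obtain s where s: "\<And>i::nat. simple_integrable ?M (s i)"
    and lim: "(\<lambda>i. \<integral>\<^sup>+x. ennreal (norm (f x - s i x)) \<partial>?M) \<longlonglongrightarrow> 0"
    and I: "(\<lambda>i. simple_integral_of ?M (s i)) \<longlonglongrightarrow> I"
    and f: "strongly_measurable ?M f"
    using assms unfolding has_strong_integral_def by blast
  have "ennreal (norm (simple_integral_of ?M (s i)))
    \<le> (\<integral>\<^sup>+x. norm (f x) \<partial>?M) + (\<integral>\<^sup>+x. norm (f x - s i x) \<partial>?M)" for i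
  proof -
    have "ennreal (norm (simple_integral_of ?M (s i))) \<le> (\<integral>\<^sup>+x. norm (s i x) \<partial>?M)"
      by (rule norm_simple_bochner_integral_le[OF s])
    also have "\<dots> = (\<integral>\<^sup>+x. norm (f x + (s i x - f x)) \<partial>?M)"
      by simp
    also have "\<dots> \<le> (\<integral>\<^sup>+x. norm (f x) \<partial>?M) + (\<integral>\<^sup>+x. norm (s i x - f x) \<partial>?M)"
      by (intro nn_integral_norm_add_le f strongly_measurable_diff simple_bochner_integrable_strong s)
    finally show ?thesis by (simp add: norm_minus_commute)
  qed
  moreover have "(\<lambda>i. ennreal (norm (simple_integral_of ?M (s i)))) \<longlonglongrightarrow> ennreal (norm I)"
    by (intro tendsto_ennrealI tendsto_norm I)
  moreover have "(\<lambda>i. (\<integral>\<^sup>+x. norm (f x) \<partial>?M) + (\<integral>\<^sup>+x. norm (f x - s i x) \<partial>?M)) \<longlonglongrightarrow>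
      (\<integral>\<^sup>+x. norm (f x) \<partial>?M) + 0"
    by (intro tendsto_add tendsto_const lim)
  ultimately show ?thesis
    by (intro LIMSEQ_le[of "\<lambda>i. ennreal (norm (simple_integral_of ?M (s i)))"]) auto
qed

lemma tendsto_0_le_ennreal:
  fixes u v :: "nat \<Rightarrow> ennreal"
  assumes "\<And>i. u i \<le> v i" "v \<longlonglongrightarrow> 0"
  shows "u \<longlonglongrightarrow> 0"
  by (rule tendsto_sandwich[OF _ _ tendsto_const assms(2)]) (use assms(1) in auto)

lemma has_strong_integral_add:
  fixes f g :: "'a \<Rightarrow> 'b::real_normed_vector"
  assumes "has_strong_integral (completion M) f I" "has_strong_integral (completion M) g J"
  shows "has_strong_integral (completion M) (\<lambda>x. f x + g x) (I + J)"
proof -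
  let ?M = "completion M"
  obtain s where s: "\<And>i::nat. simple_integrable ?M (s i)"
    and sl: "(\<lambda>i. \<integral>\<^sup>+x. ennreal (norm (f x - s i x)) \<partial>?M) \<longlonglongrightarrow> 0"
    and I: "(\<lambda>i. simple_integral_of ?M (s i)) \<longlonglongrightarrow> I"
    and f: "strongly_measurable ?M f"
    using assms(1) unfolding has_strong_integral_def by blast
  obtain t where t: "\<And>i::nat. simple_integrable ?M (t i)"
    and tl: "(\<lambda>i. \<integral>\<^sup>+x. ennreal (norm (g x - t i x)) \<partial>?M) \<longlonglongrightarrow> 0"
    and J: "(\<lambda>i. simple_integral_of ?M (t i)) \<longlonglongrightarrow> J"
    and g: "strongly_measurable ?M g"
    using assms(2) unfolding has_strong_integral_def by blast
  have "(\<integral>\<^sup>+x. norm ((f x + g x) - (s i x + t i x)) \<partial>?M)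
      \<le> (\<integral>\<^sup>+x. norm (f x - s i x) \<partial>?M) + (\<integral>\<^sup>+x. norm (g x - t i x) \<partial>?M)" for i
    using nn_integral_norm_add_le[of M "\<lambda>x. f x - s i x" "\<lambda>x. g x - t i x"] f g s t
    by (simp add: strongly_measurable_diff simple_bochner_integrable_strong algebra_simps)
  moreover have "(\<lambda>i. (\<integral>\<^sup>+x. norm (f x - s i x) \<partial>?M) + (\<integral>\<^sup>+x. norm (g x - t i x) \<partial>?M)) \<longlonglongrightarrow> 0"
    using tendsto_add[OF sl tl] by simp
  ultimately have "(\<lambda>i. \<integral>\<^sup>+x. norm ((f x + g x) - (s i x + t i x)) \<partial>?M) \<longlonglongrightarrow> 0"
    by (rule tendsto_0_le_ennreal)
  moreover have "(\<lambda>i. simple_integral_of ?M (\<lambda>x. s i x + t i x)) \<longlonglongrightarrow> I + J"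
    using tendsto_add[OF I J] by (simp add: simple_bochner_integral_add s t)
  moreover have "simple_integrable ?M (\<lambda>x. s i x + t i x)" for i
    by (rule simple_bochner_integrable_compose2[where p="(+)", OF _ s t]) simp
  ultimately show ?thesis
    unfolding has_strong_integral_def
    by (intro conjI exI[of _ "\<lambda>i x. s i x + t i x"] strongly_measurable_add f g) auto
qed

lemma has_strong_integral_scaleR:
  fixes f :: "'a \<Rightarrow> 'b::real_normed_vector"
  assumes "has_strong_integral (completion M) f I"
  shows "has_strong_integral (completion M) (\<lambda>x. c *\<^sub>R f x) (c *\<^sub>R I)"
proof -
  let ?M = "completion M"
  obtain s where s: "\<And>i::nat. simple_integrable ?M (s i)"
    and sl: "(\<lambda>i. \<integral>\<^sup>+x. ennreal (norm (f x - s i x)) \<partial>?M) \<longlonglongrightarrow> 0"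
    and I: "(\<lambda>i. simple_integral_of ?M (s i)) \<longlonglongrightarrow> I"
    and f: "strongly_measurable ?M f"
    using assms(1) unfolding has_strong_integral_def by blast
  have "(\<integral>\<^sup>+x. norm (c *\<^sub>R f x - c *\<^sub>R s i x) \<partial>?M) = ennreal \<bar>c\<bar> * (\<integral>\<^sup>+x. norm (f x - s i x) \<partial>?M)" for i
  proof -
    have [measurable]: "(\<lambda>x. norm (f x - s i x)) \<in> borel_measurable ?M"
      by (intro borel_measurable_norm_strong strongly_measurable_diff f simple_bochner_integrable_strong s)
    have "norm (c *\<^sub>R f x - c *\<^sub>R s i x) = \<bar>c\<bar> * norm (f x - s i x)" for x
      by (metis norm_scaleR scaleR_diff_right)
    then show ?thesis
      by (simp add: ennreal_mult nn_integral_cmult)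
  qed
  moreover have "(\<lambda>i. ennreal \<bar>c\<bar> * (\<integral>\<^sup>+x. norm (f x - s i x) \<partial>?M)) \<longlonglongrightarrow> 0"
    using ennreal_tendsto_cmult[OF _ sl, of "ennreal \<bar>c\<bar>"] by simp
  ultimately have "(\<lambda>i. \<integral>\<^sup>+x. norm (c *\<^sub>R f x - c *\<^sub>R s i x) \<partial>?M) \<longlonglongrightarrow> 0"
    by simp
  moreover have "(\<lambda>i. simple_integral_of ?M (\<lambda>x. c *\<^sub>R s i x)) \<longlonglongrightarrow> c *\<^sub>R I"
    using tendsto_scaleR[OF tendsto_const I]
    by (simp add: simple_bochner_integral_linear[OF linear_scaleR s])
  moreover have "simple_integrable ?M (\<lambda>x. c *\<^sub>R s i x)" for i
    by (rule simple_bochner_integrable_compose2[where p="\<lambda>a b. c *\<^sub>R a", OF _ s s]) simp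
  ultimately show ?thesis
    unfolding has_strong_integral_def
    by (intro conjI exI[of _ "\<lambda>i x. c *\<^sub>R s i x"] strongly_measurable_scaleR f) auto
qed

lemma has_strong_integral_unique:
  fixes f :: "'a \<Rightarrow> 'b::real_normed_vector"
  assumes "has_strong_integral (completion M) f I" "has_strong_integral (completion M) f J"
  shows "I = J"
proof -
  \<comment> \<open>This integrand vanishes identically, so the norm bound forces I = J.\<close>
  have "has_strong_integral (completion M) (\<lambda>x. f x + (-1) *\<^sub>R f x) (I + (-1) *\<^sub>R J)"
    by (intro has_strong_integral_add has_strong_integral_scaleR assms)
  from has_strong_integral_norm_le[OF this] show ?thesis
    by simp
qed

lemma has_strong_integral_eq:
  "has_strong_integral (completion M) f I \<Longrightarrow> strong_integral (completion M) f = I"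
  unfolding strong_integral_def using has_strong_integral_unique[of M f] by auto

lemma has_strong_integral_indicator:
  fixes c :: "'b::real_normed_vector"
  assumes A: "A \<in> sets (completion M)" and fin: "emeasure (completion M) A < \<infinity>"
  shows "has_strong_integral (completion M) (\<lambda>x. indicator A x *\<^sub>R c) (measure (completion M) A *\<^sub>R c)"
proof -
  let ?M = "completion M"
  have sb: "simple_integrable ?M (indicator A :: _ \<Rightarrow> real)"
  proof
    have "{y \<in> space ?M. (indicator A y::real) \<noteq> 0} = A"
      using sets.sets_into_space[OF A] by (auto split: split_indicator)
    then show "emeasure ?M {y \<in> space ?M. (indicator A y::real) \<noteq> 0} \<noteq> \<infinity>"
      using fin by auto
  qed (rule simple_function_indicator A)+
  have "simple_integral_of ?M (indicator A) = measure ?M A"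
  proof -
    have "has_bochner_integral ?M (indicator A) (measure ?M A)"
      using A fin by (rule has_bochner_integral_real_indicator)
    then show ?thesis
      using has_bochner_integral_simple_bochner_integrable[OF sb] has_bochner_integral_eq by blast
  qed
  moreover have "linear (\<lambda>r. r *\<^sub>R c)"
    by (rule linearI) (auto simp: algebra_simps)
  from simple_bochner_integral_linear[OF this sb]
  have "simple_integral_of ?M (\<lambda>x. indicator A x *\<^sub>R c)
    = simple_integral_of ?M (indicator A) *\<^sub>R c"
    by simp
  moreover have "simple_integrable ?M (\<lambda>x. indicator A x *\<^sub>R c)"
    by (rule simple_bochner_integrable_compose2[where p="\<lambda>a b. a *\<^sub>R c", OF _ sb sb]) simp
  ultimately show ?thesis
    unfolding has_strong_integral_def
    by (intro conjI exI[of _ "\<lambda>_ x. indicator A x *\<^sub>R c"])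
       (auto intro: strongly_measurable_simple elim: Bochner_Integration.simple_bochner_integrable.cases)
qed

text \<open>Truncating the approximating simple functions at twice the norm of the limit makes dominated
  convergence available.\<close>

lemma strongly_measurable_simple_approx:
  fixes f :: "'a \<Rightarrow> 'b::real_normed_vector"
  assumes f: "strongly_measurable (completion M) f"
    and fin: "(\<integral>\<^sup>+x. norm (f x) \<partial>completion M) < \<infinity>"
  obtains s where "\<And>i::nat. simple_integrable (completion M) (s i)"
    "(\<lambda>i. \<integral>\<^sup>+x. ennreal (norm (f x - s i x)) \<partial>completion M) \<longlonglongrightarrow> 0"
proof -
  let ?M = "completion M"
  obtain s where s: "\<And>i::nat. simple_function ?M (s i)"
    and AE: "AE x in ?M. (\<lambda>i. s i x) \<longlonglongrightarrow> f x"
    using f unfolding strongly_measurable_def by blast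
  define t where "t = (\<lambda>i x. if norm (s i x) \<le> 2 * norm (f x) then s i x else 0)"
  have [measurable]: "(\<lambda>x. norm (f x)) \<in> borel_measurable ?M"
    using f by (rule borel_measurable_norm_strong)
  have [measurable]: "(\<lambda>x. norm (s i x)) \<in> borel_measurable ?M" for i
    using s by (intro borel_measurable_norm_strong strongly_measurable_simple)
  have st: "simple_function ?M (t i)" for i
  proof -
    have "{x \<in> space ?M. norm (s i x) \<le> 2 * norm (f x)} \<in> sets ?M" by measurable
    then show ?thesis
      unfolding t_def by (intro simple_function_If s simple_function_const) simp
  qed
  have tb: "norm (t i x) \<le> 2 * norm (f x)" for i x
    by (auto simp: t_def)
  have tI: "simple_integrable ?M (t i)" for i
  proof (rule simple_bochner_integrable.intros[OF st])
    have [measurable]: "(\<lambda>x. norm (t i x)) \<in> borel_measurable ?M"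
      using st by (intro borel_measurable_norm_strong strongly_measurable_simple)
    \<comment> \<open>The finitely many nonzero values have norms bounded below by some m > 0. Since
      \<open>t i\<close> is dominated by twice the norm of f, Markov's inequality then makes its
      support a set of finite measure.\<close>
    obtain m where m: "0 < m" "\<And>x. x \<in> space ?M \<Longrightarrow> t i x \<noteq> 0 \<Longrightarrow> m \<le> norm (t i x)"
    proof -
      have fi: "finite ((\<lambda>x. norm (t i x)) ` space ?M - {0})"
        using simple_functionD(1)[OF simple_function_compose1[OF st, of norm i]] by simp
      show ?thesis
      proof (cases "(\<lambda>x. norm (t i x)) ` space ?M - {0} = {}")
        case True
        then show ?thesis by (intro that[of 1]) auto
      next
        case False
        show ?thesis
          by (rule that[of "Min ((\<lambda>x. norm (t i x)) ` space ?M - {0})"])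
             (use fi False in \<open>auto simp: Min_gr_iff intro!: Min_le\<close>)
      qed
    qed
    have "ennreal m * emeasure ?M {y \<in> space ?M. t i y \<noteq> 0}
        = (\<integral>\<^sup>+x. ennreal m * indicator {y \<in> space ?M. t i y \<noteq> 0} x \<partial>?M)"
    proof (rule nn_integral_cmult_indicator[symmetric])
      have "{y \<in> space ?M. t i y \<noteq> 0} = t i -` (- {0}) \<inter> space ?M" by auto
      then show "{y \<in> space ?M. t i y \<noteq> 0} \<in> sets ?M"
        using simple_functionD(2)[OF st] by metis
    qed
    also have "\<dots> \<le> (\<integral>\<^sup>+x. 2 * norm (f x) \<partial>?M)"
    proof (rule nn_integral_mono)
      fix x assume "x \<in> space ?M"
      then show "ennreal m * indicator {y \<in> space ?M. t i y \<noteq> 0} x \<le> ennreal (2 * norm (f x))"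
        using order_trans[OF m(2) tb, of x] by (cases "t i x = 0") (auto intro!: ennreal_leI)
    qed
    also have "\<dots> = 2 * (\<integral>\<^sup>+x. norm (f x) \<partial>?M)"
      by (subst nn_integral_cmult[symmetric]) (auto simp: ennreal_mult)
    also have "\<dots> < \<infinity>"
      using fin by (simp add: ennreal_mult_less_top)
    finally show "emeasure ?M {y \<in> space ?M. t i y \<noteq> 0} \<noteq> \<infinity>"
      using m(1) by (auto simp: ennreal_mult_eq_top_iff)
  qed
  have "(\<lambda>i. \<integral>\<^sup>+x. ennreal (norm (f x - t i x)) \<partial>?M) \<longlonglongrightarrow> (\<integral>\<^sup>+x. 0 \<partial>?M)"
  proof (rule nn_integral_dominated_convergence[where w="\<lambda>x. 3 * ennreal (norm (f x))"])
    show "(\<lambda>x. ennreal (norm (f x - t i x))) \<in> borel_measurable ?M" for i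
    proof -
      have "(\<lambda>x. norm (f x - t i x)) \<in> borel_measurable ?M"
        by (intro borel_measurable_norm_strong strongly_measurable_diff f strongly_measurable_simple st)
      then show ?thesis by simp
    qed
    show "AE x in ?M. ennreal (norm (f x - t i x)) \<le> 3 * ennreal (norm (f x))" for i
    proof (rule AE_I2)
      fix x
      have "norm (f x - t i x) \<le> 3 * norm (f x)"
        using tb[of i x] norm_triangle_ineq4[of "f x" "t i x"] by linarith
      then have "ennreal (norm (f x - t i x)) \<le> ennreal (3 * norm (f x))" by (rule ennreal_leI)
      then show "ennreal (norm (f x - t i x)) \<le> 3 * ennreal (norm (f x))"
        by (simp add: ennreal_mult)
    qed
    show "(\<integral>\<^sup>+x. 3 * ennreal (norm (f x)) \<partial>?M) < \<infinity>"
      using fin by (subst nn_integral_cmult) (auto simp: ennreal_mult_less_top)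
    show "AE x in ?M. (\<lambda>i. ennreal (norm (f x - t i x))) \<longlonglongrightarrow> 0"
      using AE
    proof eventually_elim
      case (elim x)
      \<comment> \<open>Where f vanishes the truncation is 0; elsewhere the norms of
        \<open>s i x\<close> converge to a number strictly below twice itself, so the truncation is
        eventually inactive.\<close>
      have "(\<lambda>i. t i x) \<longlonglongrightarrow> f x"
      proof (cases "f x = 0")
        case True
        then have "t i x = 0" for i by (simp add: t_def)
        then show ?thesis using True by simp
      next
        case False
        have "\<forall>\<^sub>F i in sequentially. norm (s i x) < 2 * norm (f x)"
          using False by (intro order_tendstoD(2)[OF tendsto_norm[OF elim]]) auto
        then have "\<forall>\<^sub>F i in sequentially. t i x = s i x"
          by eventually_elim (auto simp: t_def)
        then show ?thesis
          using elim by (simp add: tendsto_cong)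
      qed
      then have "(\<lambda>i. norm (f x - t i x)) \<longlonglongrightarrow> norm (f x - f x)"
        by (intro tendsto_intros)
      then show ?case
        using tendsto_ennrealI by fastforce
    qed
  qed auto
  then show ?thesis
    using that[of t] tI by simp
qed

text \<open>Completeness of the range enters here: the integrals of the L^1 approximants form a
  Cauchy sequence.\<close>

lemma has_strong_integral_ex:
  fixes f :: "'a \<Rightarrow> 'b::banach"
  assumes f: "strongly_measurable (completion M) f"
    and fin: "(\<integral>\<^sup>+x. norm (f x) \<partial>completion M) < \<infinity>"
  shows "has_strong_integral (completion M) f (strong_integral (completion M) f)"
proof -
  let ?M = "completion M"
  obtain s where s: "\<And>i::nat. simple_integrable ?M (s i)"
    and lim: "(\<lambda>i. \<integral>\<^sup>+x. ennreal (norm (f x - s i x)) \<partial>?M) \<longlonglongrightarrow> 0"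
    using strongly_measurable_simple_approx[OF assms] by blast
  let ?S = "\<lambda>i. simple_integral_of ?M (s i)"
  have diff: "ennreal (dist (?S i) (?S j))
      \<le> (\<integral>\<^sup>+x. norm (f x - s i x) \<partial>?M) + (\<integral>\<^sup>+x. norm (f x - s j x) \<partial>?M)" for i j
  proof -
    have "simple_integrable ?M (\<lambda>x. s i x - s j x)"
      by (rule simple_bochner_integrable_compose2[where p="(-)", OF _ s s]) simp
    then have "ennreal (norm (?S i - ?S j)) \<le> (\<integral>\<^sup>+x. norm (s i x - s j x) \<partial>?M)"
      using norm_simple_bochner_integral_le[of ?M "\<lambda>x. s i x - s j x"]
      by (simp add: simple_bochner_integral_diff s)
    also have "\<dots> = (\<integral>\<^sup>+x. norm ((s i x - f x) + (f x - s j x)) \<partial>?M)"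
      by simp
    also have "\<dots> \<le> (\<integral>\<^sup>+x. norm (s i x - f x) \<partial>?M) + (\<integral>\<^sup>+x. norm (f x - s j x) \<partial>?M)"
      by (intro nn_integral_norm_add_le strongly_measurable_diff f simple_bochner_integrable_strong s)
    finally show ?thesis
      by (simp add: dist_norm norm_minus_commute)
  qed
  have "Cauchy ?S"
  proof (rule metric_CauchyI)
    fix e :: real assume e: "0 < e"
    then have "\<forall>\<^sub>F i in sequentially. (\<integral>\<^sup>+x. ennreal (norm (f x - s i x)) \<partial>?M) < ennreal (e / 2)"
      by (intro order_tendstoD(2)[OF lim]) auto
    then obtain K where K: "\<And>i. i \<ge> K \<Longrightarrow> (\<integral>\<^sup>+x. ennreal (norm (f x - s i x)) \<partial>?M) < ennreal (e / 2)"
      unfolding eventually_sequentially by blast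
    have "dist (?S i) (?S j) < e" if "i \<ge> K" "j \<ge> K" for i j
    proof -
      have "ennreal (dist (?S i) (?S j)) < ennreal (e / 2) + ennreal (e / 2)"
        using diff[of i j] add_strict_mono[OF K[OF that(1)] K[OF that(2)]] by (rule le_less_trans)
      also have "\<dots> = ennreal e"
        using e by (simp flip: ennreal_plus)
      finally show ?thesis
        by (simp add: ennreal_less_iff)
    qed
    then show "\<exists>K. \<forall>i\<ge>K. \<forall>j\<ge>K. dist (?S i) (?S j) < e" by blast
  qed
  then obtain I where "?S \<longlonglongrightarrow> I"
    using Cauchy_convergent_iff convergent_def by blast
  then have "has_strong_integral ?M f I"
    unfolding has_strong_integral_def using f s lim by blast
  then show ?thesis
    using has_strong_integral_eq by blast
qed

section \<open>R-bounds\<close>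

lemma set_random_signs: "set_pmf (random_signs N) \<subseteq> PiE_dflt {..<N} 0 (\<lambda>_. {-1, 1})"
  unfolding random_signs_def by (subst set_Pi_pmf) (auto simp: PiE_dflt_def)

lemma finite_set_random_signs: "finite (set_pmf (random_signs N))"
  by (rule finite_subset[OF set_random_signs]) (auto intro: finite_PiE_dflt)

text \<open>Conditioning on the last sign, which is independent of the earlier ones. This recursion
  allows orthogonality to be proved by induction on N.\<close>

lemma expectation_random_signs_Suc:
  fixes F :: "(nat \<Rightarrow> real) \<Rightarrow> real"
  shows "measure_pmf.expectation (random_signs (Suc N)) F =
    (measure_pmf.expectation (random_signs N) (\<lambda>\<epsilon>. F (\<epsilon>(N := -1))) +
     measure_pmf.expectation (random_signs N) (\<lambda>\<epsilon>. F (\<epsilon>(N := 1)))) / 2"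
proof -
  have "random_signs (Suc N) =
      bind_pmf (pmf_of_set {-1, 1}) (\<lambda>y. map_pmf (\<lambda>\<epsilon>. \<epsilon>(N := y)) (random_signs N))"
    unfolding random_signs_def lessThan_Suc
    by (subst Pi_pmf_insert') (auto simp: map_pmf_def)
  also have "measure_pmf.expectation \<dots> F = (\<Sum>y\<in>{-1, 1}. pmf (pmf_of_set {-1, 1::real}) y *\<^sub>R
      measure_pmf.expectation (map_pmf (\<lambda>\<epsilon>. \<epsilon>(N := y)) (random_signs N)) F)"
    by (rule pmf_expectation_bind) (auto simp: finite_set_random_signs)
  finally show ?thesis
    by (simp add: field_simps fun_upd_def)
qed

text \<open>Orthogonality of the signs, for coefficients in an inner product space. It is applied to
  scalars only and fixes the R-bound contribution of a single vector.\<close>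

lemma expectation_random_signs_norm2:
  fixes a :: "nat \<Rightarrow> 'k::real_inner"
  shows "measure_pmf.expectation (random_signs N) (\<lambda>\<epsilon>. (norm (\<Sum>k<N. \<epsilon> k *\<^sub>R a k))\<^sup>2)
    = (\<Sum>k<N. (norm (a k))\<^sup>2)"
proof (induction N)
  case 0
  then show ?case by simp
next
  case (Suc N)
  let ?S = "\<lambda>\<epsilon>. \<Sum>k<N. \<epsilon> k *\<^sub>R a k"
  have int: "integrable (measure_pmf (random_signs N)) F" for F :: "_ \<Rightarrow> real"
    by (rule integrable_measure_pmf_finite[OF finite_set_random_signs])
  have eq: "(\<Sum>k<Suc N. (\<epsilon>(N := y)) k *\<^sub>R a k) = ?S \<epsilon> + y *\<^sub>R a N" for \<epsilon> :: "nat \<Rightarrow> real" and y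
    by simp
  \<comment> \<open>The parallelogram law: averaging over the last sign cancels the cross
    terms.\<close>
  have par: "(norm (v + (- 1) *\<^sub>R w))\<^sup>2 + (norm (v + 1 *\<^sub>R w))\<^sup>2 = 2 * (norm v)\<^sup>2 + 2 * (norm w)\<^sup>2" for v w :: 'k
    by (simp add: power2_norm_eq_inner inner_simps inner_commute)
  have "measure_pmf.expectation (random_signs (Suc N)) (\<lambda>\<epsilon>. (norm (\<Sum>k<Suc N. \<epsilon> k *\<^sub>R a k))\<^sup>2)
      = measure_pmf.expectation (random_signs N)
          (\<lambda>\<epsilon>. (norm (?S \<epsilon> + (- 1) *\<^sub>R a N))\<^sup>2 + (norm (?S \<epsilon> + 1 *\<^sub>R a N))\<^sup>2) / 2"
    unfolding expectation_random_signs_Suc eq by (subst Bochner_Integration.integral_add[OF int int]) simp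
  also have "\<dots> = measure_pmf.expectation (random_signs N) (\<lambda>\<epsilon>. 2 * (norm (?S \<epsilon>))\<^sup>2 + 2 * (norm (a N))\<^sup>2) / 2"
    unfolding par ..
  also have "\<dots> = measure_pmf.expectation (random_signs N) (\<lambda>\<epsilon>. (norm (?S \<epsilon>))\<^sup>2) + (norm (a N))\<^sup>2"
    by (subst Bochner_Integration.integral_add[OF int int]) simp
  finally show ?case
    using Suc by simp
qed

text \<open>Minkowski's inequality. With finite support the second moment is a finite sum, and the
  weights \<open>sqrt (pmf p \<omega>)\<close> turn its root into an \<open>L2_set\<close>.\<close>

lemma expectation_L2_triangle:
  fixes X Y :: "'a \<Rightarrow> 'b::real_normed_vector"
  assumes "finite (set_pmf p)"
  shows "sqrt (measure_pmf.expectation p (\<lambda>\<omega>. (norm (X \<omega> + Y \<omega>))\<^sup>2))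
    \<le> sqrt (measure_pmf.expectation p (\<lambda>\<omega>. (norm (X \<omega>))\<^sup>2)) + sqrt (measure_pmf.expectation p (\<lambda>\<omega>. (norm (Y \<omega>))\<^sup>2))"
proof -
  have eq: "sqrt (measure_pmf.expectation p (\<lambda>\<omega>. (norm (Z \<omega>))\<^sup>2))
      = L2_set (\<lambda>\<omega>. sqrt (pmf p \<omega>) * norm (Z \<omega>)) (set_pmf p)" for Z :: "'a \<Rightarrow> 'b"
    using assms unfolding L2_set_def
    by (subst integral_measure_pmf[of "set_pmf p"]) (auto simp: power_mult_distrib)
  have "L2_set (\<lambda>\<omega>. sqrt (pmf p \<omega>) * norm (X \<omega> + Y \<omega>)) (set_pmf p)
    \<le> L2_set (\<lambda>\<omega>. sqrt (pmf p \<omega>) * norm (X \<omega>) + sqrt (pmf p \<omega>) * norm (Y \<omega>)) (set_pmf p)"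
    by (intro L2_set_mono) (auto simp flip: distrib_left intro!: mult_left_mono norm_triangle_ineq)
  also have "\<dots> \<le> L2_set (\<lambda>\<omega>. sqrt (pmf p \<omega>) * norm (X \<omega>)) (set_pmf p) + L2_set (\<lambda>\<omega>. sqrt (pmf p \<omega>) * norm (Y \<omega>)) (set_pmf p)"
    by (rule L2_set_triangle_ineq)
  finally show ?thesis
    unfolding eq .
qed

text \<open>The left-hand side of the inequality that defines \<open>R_bound\<close>.\<close>

definition rad_L2 ::
  "('k::real_normed_field \<Rightarrow> 'x::real_normed_vector \<Rightarrow> 'x) \<Rightarrow> nat \<Rightarrow> (nat \<Rightarrow> 'k) \<Rightarrow> (nat \<Rightarrow> 'x) \<Rightarrow> real" where
  "rad_L2 smul N a \<xi> = sqrt (measure_pmf.expectation (random_signs N)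
                (\<lambda>\<epsilon>. (norm (\<Sum>k<N. \<epsilon> k *\<^sub>R smul (a k) (\<xi> k)))\<^sup>2))"

text \<open>The infimum is attained, because the defining inequality is a closed condition on the
  constant. Hence a finite R-bound may itself be used as a constant in the inequality.\<close>

lemma R_bound_le_iff:
  fixes smul :: "'k::real_normed_field \<Rightarrow> 'x::real_normed_vector \<Rightarrow> 'x"
  assumes c: "0 \<le> c"
  shows "R_bound smul S \<le> ennreal c \<longleftrightarrow>
    (\<forall>N \<xi> a. (\<forall>k<N. \<xi> k \<in> S) \<longrightarrow> rad_L2 smul N a \<xi> \<le> c * sqrt (\<Sum>k<N. (norm (a k))\<^sup>2))"
    (is "_ \<longleftrightarrow> ?valid c")
proof
  have R: "R_bound smul S = (INF C\<in>{C. 0 \<le> C \<and> ?valid C}. ennreal C)"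
    by (simp add: R_bound_def rad_L2_def)
  {
    assume "?valid c"
    then show "R_bound smul S \<le> ennreal c"
      unfolding R using c by (intro INF_lower) auto
  }
  assume le: "R_bound smul S \<le> ennreal c"
  show "?valid c"
  proof (intro allI impI)
    fix N :: nat and \<xi> :: "nat \<Rightarrow> 'x" and a :: "nat \<Rightarrow> 'k"
    assume \<xi>: "\<forall>k<N. \<xi> k \<in> S"
    let ?s = "sqrt (\<Sum>k<N. (norm (a k))\<^sup>2)"
    have s: "0 \<le> ?s" by (simp add: sum_nonneg)
    have *: "rad_L2 smul N a \<xi> \<le> (c + e) * ?s" if "e > 0" for e
    proof -
      have "R_bound smul S < ennreal (c + e)"
        using le that c by (intro le_less_trans[OF le]) (simp add: ennreal_less_iff)
      then obtain C where C: "0 \<le> C" "?valid C" "ennreal C < ennreal (c + e)"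
        unfolding R INF_less_iff by auto
      then have "C \<le> c + e"
        by (metis ennreal_less_iff less_imp_le)
      have "rad_L2 smul N a \<xi> \<le> C * ?s" using C(2) \<xi> by blast
      also have "\<dots> \<le> (c + e) * ?s" using \<open>C \<le> c + e\<close> s by (rule mult_right_mono)
      finally show ?thesis .
    qed
    have "((\<lambda>e. (c + e) * ?s) \<longlongrightarrow> (c + 0) * ?s) (at_right 0)"
      by (intro tendsto_intros)
    then show "rad_L2 smul N a \<xi> \<le> c * ?s"
      using * by (intro tendsto_lowerbound[of "\<lambda>e. (c + e) * ?s" _ "at_right 0"])
         (auto simp: eventually_at_right_field intro: exI[of _ 1])
  qed
qed

lemma R_bound_mono:
  assumes "S \<subseteq> T"
  shows "R_bound smul S \<le> R_bound smul T"
proof (cases "R_bound smul T")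
  case (real c)
  then show ?thesis
    using assms R_bound_le_iff[of c smul T] R_bound_le_iff[of c smul S]
    by (metis order_refl subsetD)
qed simp

text \<open>The definition tests finite families only, and such a family in an increasing union
  already lies in one of its members.\<close>

lemma R_bound_Union_le:
  assumes S: "incseq S" and le: "\<And>i. R_bound smul (S i) \<le> c"
  shows "R_bound smul (\<Union>i. S i) \<le> c"
proof (cases c)
  case (real r)
  have "rad_L2 smul N a \<xi> \<le> r * sqrt (\<Sum>k<N. (norm (a k))\<^sup>2)" if \<xi>: "\<forall>k<N. \<xi> k \<in> (\<Union>i. S i)" for N \<xi> a
  proof -
    have "\<forall>k. \<exists>i. k < N \<longrightarrow> \<xi> k \<in> S i" using \<xi> by auto
    then obtain i where i: "\<And>k. k < N \<Longrightarrow> \<xi> k \<in> S (i k)" by metis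
    have "\<xi> k \<in> S (Max (i ` {..<N}))" if "k < N" for k
      using incseqD[OF S, of "i k" "Max (i ` {..<N})"] i[OF that] that by auto
    then show ?thesis
      using le[of "Max (i ` {..<N})"] R_bound_le_iff[of r smul] real by blast
  qed
  then show ?thesis
    using real R_bound_le_iff[of r smul] by blast
qed simp

lemma R_bound_Union_incseq:
  assumes "incseq S"
  shows "R_bound smul (\<Union>i. S i) = (SUP i. R_bound smul (S i))"
  by (intro antisym R_bound_Union_le assms SUP_least R_bound_mono SUP_upper) auto

section \<open>Translations, unions and finite sets\<close>

locale scaling =
  fixes smul :: "'k::{real_normed_field,real_inner} \<Rightarrow> 'x::real_normed_vector \<Rightarrow> 'x"
  assumes scaling: "banach_scaling smul"
begin

lemma smul_add_left: "smul (a + b) x = smul a x + smul b x"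
  using scaling unfolding banach_scaling_def by (simp add: vector_space_def)

lemma smul_add_right: "smul a (x + y) = smul a x + smul a y"
  using scaling unfolding banach_scaling_def by (simp add: vector_space_def)

lemma smul_zero_left: "smul 0 x = 0"
  using scaling unfolding banach_scaling_def by (metis of_real_0 scaleR_zero_left)

lemma norm_smul: "norm (smul a x) = norm a * norm x"
  using scaling unfolding banach_scaling_def by blast

lemma smul_scaleR: "smul (r *\<^sub>R a) x = r *\<^sub>R smul a x"
proof -
  have "smul (of_real r * a) x = smul (of_real r) (smul a x)"
    using scaling unfolding banach_scaling_def by (simp add: vector_space_def)
  then show ?thesis
    using scaling unfolding banach_scaling_def by (simp add: scaleR_conv_of_real)
qed

lemma sum_smul: "(\<Sum>k\<in>A. smul (a k) x) = smul (\<Sum>k\<in>A. a k) x"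
  by (induction A rule: infinite_finite_induct) (auto simp: smul_zero_left smul_add_left)

text \<open>With one repeated vector the random sum is a random scalar times that vector, so
  orthogonality applies although X carries no inner product.\<close>

lemma rad_L2_const: "rad_L2 smul N a (\<lambda>_. x) = norm x * sqrt (\<Sum>k<N. (norm (a k))\<^sup>2)"
proof -
  have "(\<Sum>k<N. \<epsilon> k *\<^sub>R smul (a k) x) = smul (\<Sum>k<N. \<epsilon> k *\<^sub>R a k) x" for \<epsilon> :: "nat \<Rightarrow> real"
    by (simp add: sum_smul[symmetric] smul_scaleR)
  then have "rad_L2 smul N a (\<lambda>_. x)
      = sqrt (measure_pmf.expectation (random_signs N) (\<lambda>\<epsilon>. (norm (\<Sum>k<N. \<epsilon> k *\<^sub>R a k))\<^sup>2 * (norm x)\<^sup>2))"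
    by (simp add: rad_L2_def norm_smul power_mult_distrib)
  also have "\<dots> = sqrt ((\<Sum>k<N. (norm (a k))\<^sup>2) * (norm x)\<^sup>2)"
    by (simp add: expectation_random_signs_norm2)
  finally show ?thesis
    by (simp add: real_sqrt_mult)
qed

text \<open>Coefficients and vectors may both differ between the three families:
  \<open>R_bound_translate\<close> splits the vectors and keeps the coefficients, whereas
  \<open>R_bound_Un\<close> splits the coefficients.\<close>

lemma rad_L2_add:
  assumes "\<And>k. k < N \<Longrightarrow> smul (a k) (\<xi> k) = smul (b k) (\<eta> k) + smul (c k) (\<zeta> k)"
  shows "rad_L2 smul N a \<xi> \<le> rad_L2 smul N b \<eta> + rad_L2 smul N c \<zeta>"
proof -
  have "(\<Sum>k<N. \<epsilon> k *\<^sub>R smul (a k) (\<xi> k)) = (\<Sum>k<N. \<epsilon> k *\<^sub>R smul (b k) (\<eta> k)) + (\<Sum>k<N. \<epsilon> k *\<^sub>R smul (c k) (\<zeta> k))"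
    for \<epsilon> :: "nat \<Rightarrow> real"
    by (simp add: assms scaleR_add_right sum.distrib)
  then show ?thesis
    unfolding rad_L2_def using expectation_L2_triangle[OF finite_set_random_signs] by auto
qed

lemma R_bound_empty: "R_bound smul {} = 0"
proof -
  have "rad_L2 smul N a \<xi> = 0" if "\<forall>k<N. \<xi> k \<in> {}" for N a \<xi>
    using that by (cases N) (auto simp: rad_L2_def)
  then have "R_bound smul {} \<le> ennreal 0"
    by (subst R_bound_le_iff) auto
  then show ?thesis by simp
qed

text \<open>Used to return to a function after its mean over a cube has been subtracted. By
  \<open>rad_L2_const\<close> the constant part costs exactly norm c.\<close>

lemma R_bound_translate:
  assumes "S \<subseteq> (\<lambda>x. x + c) ` T"
  shows "R_bound smul S \<le> R_bound smul T + ennreal (norm c)"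
proof (cases "R_bound smul T")
  case (real r)
  have "rad_L2 smul N a \<xi> \<le> (r + norm c) * sqrt (\<Sum>k<N. (norm (a k))\<^sup>2)" if \<xi>: "\<forall>k<N. \<xi> k \<in> S" for N \<xi> a
  proof -
    have "rad_L2 smul N a \<xi> \<le> rad_L2 smul N a (\<lambda>k. \<xi> k - c) + rad_L2 smul N a (\<lambda>_. c)"
      by (rule rad_L2_add) (simp flip: smul_add_right)
    moreover have "\<forall>k<N. \<xi> k - c \<in> T"
      using \<xi> assms by fastforce
    then have "rad_L2 smul N a (\<lambda>k. \<xi> k - c) \<le> r * sqrt (\<Sum>k<N. (norm (a k))\<^sup>2)"
      using real R_bound_le_iff[of r smul T] by auto
    ultimately show ?thesis
      by (simp add: rad_L2_const algebra_simps)
  qed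
  then have "R_bound smul S \<le> ennreal (r + norm c)"
    using real by (subst R_bound_le_iff) auto
  then show ?thesis
    using real by simp
qed simp

lemma R_bound_singleton: "R_bound smul {x} \<le> ennreal (norm x)"
proof -
  have "smul a 0 = 0" for a
    using norm_smul[of a 0] by simp
  then have "rad_L2 smul N a \<xi> = 0" if "\<forall>k<N. \<xi> k \<in> {0}" for N a \<xi>
    using that by (simp add: rad_L2_def)
  then have "R_bound smul {0} \<le> ennreal 0"
    by (subst R_bound_le_iff) auto
  then show ?thesis
    using R_bound_translate[of "{x}" x "{0}"] by simp
qed

lemma R_bound_Un: "R_bound smul (S \<union> T) \<le> R_bound smul S + R_bound smul T"
proof (cases "S = {} \<or> T = {}")
  case True
  then show ?thesis by (auto simp: R_bound_empty)
next
  case False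
  then obtain s t where st: "s \<in> S" "t \<in> T" by blast
  show ?thesis
  proof (cases "R_bound smul S"; cases "R_bound smul T")
    fix r q
    assume r: "0 \<le> r" "R_bound smul S = ennreal r" and q: "0 \<le> q" "R_bound smul T = ennreal q"
    have "rad_L2 smul N a \<xi> \<le> (r + q) * sqrt (\<Sum>k<N. (norm (a k))\<^sup>2)" if \<xi>: "\<forall>k<N. \<xi> k \<in> S \<union> T" for N \<xi> a
    proof -
      \<comment> \<open>Each term goes to one of the two families. In the other it gets coefficient
        0 and the placeholder s or t, so that all vectors stay in S or in T; this is why both sets
        must be nonempty here.\<close>
      define b where "b = (\<lambda>k. if \<xi> k \<in> S then a k else 0)"
      define c where "c = (\<lambda>k. if \<xi> k \<in> S then 0 else a k)"
      define \<eta> where "\<eta> = (\<lambda>k. if \<xi> k \<in> S then \<xi> k else s)"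
      define \<zeta> where "\<zeta> = (\<lambda>k. if \<xi> k \<in> S then t else \<xi> k)"
      have mem: "\<forall>k<N. \<eta> k \<in> S" "\<forall>k<N. \<zeta> k \<in> T"
        using \<xi> st by (auto simp: \<eta>_def \<zeta>_def)
      have bd: "sqrt (\<Sum>k<N. (norm (b k))\<^sup>2) \<le> sqrt (\<Sum>k<N. (norm (a k))\<^sup>2)"
        "sqrt (\<Sum>k<N. (norm (c k))\<^sup>2) \<le> sqrt (\<Sum>k<N. (norm (a k))\<^sup>2)"
        by (intro real_sqrt_le_mono sum_mono; simp add: b_def c_def)+
      have "rad_L2 smul N a \<xi> \<le> rad_L2 smul N b \<eta> + rad_L2 smul N c \<zeta>"
        by (rule rad_L2_add) (simp add: b_def c_def \<eta>_def \<zeta>_def smul_zero_left)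
      also have "rad_L2 smul N b \<eta> \<le> r * sqrt (\<Sum>k<N. (norm (b k))\<^sup>2)"
        using mem(1) r R_bound_le_iff[of r smul S] by auto
      also have "rad_L2 smul N c \<zeta> \<le> q * sqrt (\<Sum>k<N. (norm (c k))\<^sup>2)"
        using mem(2) q R_bound_le_iff[of q smul T] by auto
      finally show ?thesis
        using mult_left_mono[OF bd(1) r(1)] mult_left_mono[OF bd(2) q(1)] by (simp add: distrib_right)
    qed
    then have "R_bound smul (S \<union> T) \<le> ennreal (r + q)"
      using r q by (subst R_bound_le_iff) auto
    then show ?thesis
      using r q by simp
  qed auto
qed

text \<open>A crude bound, but it makes truncated maximal functions finite in the mean before any
  sharp estimate, and it settles the case in which all averages vanish.\<close>

lemma R_bound_finite:
  assumes "finite I"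
  shows "R_bound smul (x ` I) \<le> (\<Sum>i\<in>I. ennreal (norm (x i)))"
  using assms
proof (induction I)
  case empty
  then show ?case by (simp add: R_bound_empty)
next
  case (insert i I)
  have "R_bound smul (x ` insert i I) \<le> R_bound smul {x i} + R_bound smul (x ` I)"
    using R_bound_Un[of "{x i}" "x ` I"] by simp
  also have "\<dots> \<le> ennreal (norm (x i)) + (\<Sum>i\<in>I. ennreal (norm (x i)))"
    by (intro add_mono R_bound_singleton insert.IH)
  also have "\<dots> = (\<Sum>i\<in>insert i I. ennreal (norm (x i)))"
    using insert.hyps by (rule sum.insert[symmetric])
  finally show ?case .
qed

end

section \<open>Dyadic cubes and averages\<close>

lemma half_open_cube_borel [measurable]: "half_open_cube a s \<in> sets borel"
  unfolding half_open_cube_def by measurable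

text \<open>The cube is squeezed between an open and a closed box of equal volume.\<close>

lemma emeasure_half_open_cube:
  fixes a :: "real^'n"
  assumes s: "0 < s"
  shows "emeasure lborel (half_open_cube a s) = ennreal (s ^ CARD('n))"
proof -
  define b where "b = a + (\<chi> i. s)"
  have "box a b \<subseteq> half_open_cube a s" "half_open_cube a s \<subseteq> cbox a b"
    by (auto simp: half_open_cube_def b_def mem_box_cart less_imp_le)
  then have le: "emeasure lborel (box a b) \<le> emeasure lborel (half_open_cube a s)"
    "emeasure lborel (half_open_cube a s) \<le> emeasure lborel (cbox a b)"
    by (auto intro!: emeasure_mono)
  have ab: "(b - a) \<bullet> i = s" if "i \<in> Basis" for i
    using that by (auto simp: b_def Basis_vec_def inner_axis)
  then have "a \<bullet> i \<le> b \<bullet> i" if "i \<in> Basis" for i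
    using that s by (smt (verit) inner_diff_left)
  then show ?thesis
    using le ab by (simp add: emeasure_lborel_box emeasure_lborel_cbox)
qed

locale dyadic =
  fixes D :: "int \<Rightarrow> (real^'n) set set"
  assumes dyadic: "dyadic_system D"
begin

lemma partition: "partition_on UNIV (D k)"
  using dyadic by (simp add: dyadic_system_def)

definition cube :: "int \<Rightarrow> real^'n \<Rightarrow> (real^'n) set" where
  "cube k x = (THE Q. Q \<in> D k \<and> x \<in> Q)"

lemma ex1_cube: "\<exists>!Q. Q \<in> D k \<and> x \<in> Q"
proof (rule ex_ex1I)
  show "\<exists>Q. Q \<in> D k \<and> x \<in> Q"
    using partition_onD1[OF partition[of k]] by blast
  show "Q = R" if "Q \<in> D k \<and> x \<in> Q" "R \<in> D k \<and> x \<in> R" for Q R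
    using partition_onD2[OF partition[of k]] that unfolding disjoint_def by blast
qed

lemma cube_in_D [simp, intro]: "cube k x \<in> D k" and mem_cube [simp, intro]: "x \<in> cube k x"
  using theI'[OF ex1_cube[of k x]] unfolding cube_def by auto

lemma cube_eqI: "Q \<in> D k \<Longrightarrow> x \<in> Q \<Longrightarrow> cube k x = Q"
  using ex1_cube[of k x] cube_in_D[of k x] mem_cube[of x k] by blast

lemma cube_eq: "y \<in> cube k x \<Longrightarrow> cube k y = cube k x"
  by (rule cube_eqI) auto

lemma D_eq_range: "D k = range (cube k)"
proof -
  have "Q \<in> range (cube k)" if "Q \<in> D k" for Q
  proof -
    have "Q \<noteq> {}"
      using partition_onD3[OF partition[of k]] that by metis
    then show ?thesis using cube_eqI[OF that] by blast
  qed
  then show ?thesis by auto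
qed

definition vol :: "int \<Rightarrow> real" where
  "vol k = (2 powi (-k)) ^ CARD('n)"

lemma vol_pos [simp]: "0 < vol k"
  by (simp add: vol_def)

lemma vol_nonneg [simp]: "0 \<le> vol k" and vol_nonzero [simp]: "vol k \<noteq> 0"
  by (simp_all add: vol_def)

lemma vol_Suc: "vol k = 2 ^ CARD('n) * vol (k + 1)"
proof -
  have "(2::real) powi (-k) = 2 * 2 powi (-(k + 1))"
    by (simp add: power_int_diff power_int_minus field_simps power_int_add)
  then show ?thesis
    by (simp add: vol_def power_mult_distrib)
qed

lemma D_half_open: "Q \<in> D k \<Longrightarrow> \<exists>a. Q = half_open_cube a (2 powi (-k))"
  and D_subdivide: "Q \<in> D k \<Longrightarrow> \<exists>P\<subseteq>D (k + 1). card P = 2 ^ CARD('n) \<and> Q = \<Union>P"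
  using dyadic by (simp_all add: dyadic_system_def)

lemma cube_borel [measurable, simp]: "cube k x \<in> sets borel"
  using D_half_open[OF cube_in_D[of k x]] half_open_cube_borel by auto

lemma cube_lebesgue [measurable, simp]: "cube k x \<in> sets lebesgue"
  using cube_borel[of k x] by (intro sets_completionI_sets) auto

lemma emeasure_cube: "emeasure lebesgue (cube k x) = ennreal (vol k)"
proof -
  obtain a where a: "cube k x = half_open_cube a (2 powi (-k))"
    using D_half_open[OF cube_in_D] by blast
  show ?thesis
    unfolding a vol_def by (simp add: emeasure_half_open_cube)
qed

lemma measure_cube: "measure lebesgue (cube k x) = vol k"
  by (simp add: measure_def emeasure_cube)

definition children :: "int \<Rightarrow> real^'n \<Rightarrow> (real^'n) set set" where
  "children k x = cube (k + 1) ` cube k x"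

lemma children:
  shows finite_children: "finite (children k x)"
    and Union_children: "\<Union>(children k x) = cube k x"
proof -
  obtain P where P: "P \<subseteq> D (k + 1)" "card P = 2 ^ CARD('n)" "cube k x = \<Union>P"
    using D_subdivide[OF cube_in_D[of k x]] by blast
  have "P = children k x"
  proof
    show "P \<subseteq> children k x"
    proof
      fix Q assume Q: "Q \<in> P"
      then obtain y where "y \<in> Q"
        using P(1) D_eq_range mem_cube by blast
      then have "cube (k + 1) y = Q" "y \<in> cube k x"
        using Q P cube_eqI by auto
      then show "Q \<in> children k x"
        unfolding children_def by blast
    qed
    show "children k x \<subseteq> P"
      using P cube_eqI by (auto simp: children_def)
  qed
  \<comment> \<open>The cardinality of \<open>P\<close> is a nonzero number, which rules out an
    infinite \<open>P\<close>.\<close>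
  then show "finite (children k x)" "\<Union>(children k x) = cube k x"
    using P card.infinite[of P] by auto
qed

lemma disjoint_children: "disjoint (children k x)"
proof (rule disjointI)
  fix Q R assume *: "Q \<in> children k x" "R \<in> children k x" "Q \<noteq> R"
  then have "Q \<in> D (k + 1)" "R \<in> D (k + 1)"
    by (auto simp: children_def)
  then show "Q \<inter> R = {}"
    using partition_onD2[OF partition[of "k + 1"]] *(3) by (simp add: disjointD)
qed

lemma cube_mono:
  assumes "k \<le> m"
  shows "cube m x \<subseteq> cube k x"
  using assms
proof (induction m rule: int_ge_induct)
  case base
  then show ?case by simp
next
  case (step m)
  have "cube (m + 1) x \<subseteq> cube m x"
    using Union_children[of m x] mem_cube[of x m] unfolding children_def by blast
  then show ?case using step by blast
qed

lemma cube_eq_le: "y \<in> cube m x \<Longrightarrow> k \<le> m \<Longrightarrow> cube k y = cube k x"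
  using cube_mono cube_eq by blast

text \<open>Every cube has interior points and hence meets a fixed countable dense set.\<close>

lemma countable_D: "countable (D k)"
proof -
  obtain T :: "(real^'n) set" where T: "countable T" "\<And>X. open X \<Longrightarrow> X \<noteq> {} \<Longrightarrow> \<exists>d\<in>T. d \<in> X"
    using countable_dense_setE by blast
  have "D k \<subseteq> cube k ` T"
  proof
    fix Q assume Q: "Q \<in> D k"
    then obtain a where a: "Q = half_open_cube a (2 powi (-k))"
      using D_half_open by blast
    let ?b = "a + (\<chi> i. 2 powi (-k))"
    have "a + (\<chi> i. 2 powi (-k) / 2) \<in> box a ?b"
      by (auto simp: mem_box_cart)
    then obtain d where "d \<in> T" "d \<in> box a ?b"
      using T(2)[OF open_box, of a ?b] by auto
    moreover have "box a ?b \<subseteq> Q"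
      by (auto simp: a half_open_cube_def mem_box_cart less_imp_le)
    ultimately show "Q \<in> cube k ` T"
      using cube_eqI[OF Q] by blast
  qed
  then show ?thesis
    using T(1) by (meson countable_image countable_subset)
qed

text \<open>Stands for measurability with respect to the k-th sigma-algebra of the dyadic
  filtration. Constancy on its atoms makes sense for any range type, so that predicates are covered
  as well.\<close>

definition level_const :: "int \<Rightarrow> (real^'n \<Rightarrow> 'b) \<Rightarrow> bool" where
  "level_const k g \<longleftrightarrow> (\<forall>x y. y \<in> cube k x \<longrightarrow> g y = g x)"

lemma level_constD: "level_const k g \<Longrightarrow> y \<in> cube k x \<Longrightarrow> g y = g x"
  unfolding level_const_def by blast

lemma level_const_mono: "level_const k g \<Longrightarrow> k \<le> m \<Longrightarrow> level_const m g"
  unfolding level_const_def by (meson cube_mono subsetD)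

text \<open>Any such preimage, whatever the set \<open>A\<close>, is a union of cubes from a
  countable family.\<close>

lemma level_const_vimage_sets:
  assumes "level_const k g"
  shows "{x. g x \<in> A} \<in> sets lebesgue"
proof -
  let ?J = "{Q \<in> D k. Q \<subseteq> {x. g x \<in> A}}"
  have eq: "{x. g x \<in> A} = \<Union>?J"
  proof (intro equalityI subsetI)
    fix x assume "x \<in> {x. g x \<in> A}"
    then have "cube k x \<subseteq> {x. g x \<in> A}"
      using level_constD[OF assms] by (metis mem_Collect_eq subsetI)
    then have "cube k x \<in> ?J" by simp
    then show "x \<in> \<Union>?J" using mem_cube by blast
  qed blast
  have cnt: "countable ?J"
    by (rule countable_subset[OF _ countable_D[of k]]) auto
  have sub: "?J \<subseteq> sets lebesgue"
    using D_eq_range[of k] by auto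
  show ?thesis
    by (subst eq) (rule sets.countable_Union[OF cnt sub])
qed

lemma level_const_measurable:
  assumes "level_const k g" "range g \<subseteq> space N"
  shows "g \<in> measurable lebesgue N"
proof (rule measurableI)
  show "g -` A \<inter> space lebesgue \<in> sets lebesgue" for A
    using level_const_vimage_sets[OF assms(1), of A] by (simp add: vimage_def)
qed (use assms in auto)

lemma level_const_pred_sets: "level_const k P \<Longrightarrow> {x. P x} \<in> sets lebesgue"
  using level_const_vimage_sets[of k P "{True}"] by simp

lemma ex_level_pred_sets: "(\<And>j. level_const j (P j)) \<Longrightarrow> {x. \<exists>j\<ge>k. P j x} \<in> sets lebesgue"
proof -
  assume *: "\<And>j. level_const j (P j)"
  have "{x. \<exists>j\<ge>k. P j x} = (\<Union>j\<in>{k..}. {x. P j x})" by auto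
  then show ?thesis
    using level_const_pred_sets[OF *] by auto
qed

text \<open>The set where some condition \<open>P\<close> holds at a level at least \<open>k\<close> is the disjoint union of the
  maximal such cubes, so measures on it can be compared cube by cube.\<close>

lemma stopping_emeasure_le:
  assumes P: "\<And>j. level_const j (P j)"
    and sets: "sets \<mu> = sets lebesgue" "sets \<nu> = sets lebesgue" "A \<in> sets lebesgue" "B \<in> sets lebesgue"
    and le: "\<And>j x. k \<le> j \<Longrightarrow> P j x \<Longrightarrow> (\<And>i. k \<le> i \<Longrightarrow> i < j \<Longrightarrow> \<not> P i x) \<Longrightarrow>
      emeasure \<mu> (A \<inter> cube j x) \<le> c * emeasure \<nu> (B \<inter> cube j x)"
  shows "emeasure \<mu> (A \<inter> {x. \<exists>j\<ge>k. P j x}) \<le> c * emeasure \<nu> (B \<inter> {x. \<exists>j\<ge>k. P j x})"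
proof -
  \<comment> \<open>\<open>?min j x\<close> says that \<open>cube j x\<close> is a maximal cube. By
    \<open>min_cube\<close> it holds at all points of that cube, so two maximal cubes that meet have
    the same level and coincide.\<close>
  let ?min = "\<lambda>j x. k \<le> j \<and> P j x \<and> (\<forall>i. k \<le> i \<and> i < j \<longrightarrow> \<not> P i x)"
  define J where "J = {cube j x | j x. ?min j x}"
  have min_cube: "?min j z" if "?min j x" "z \<in> cube j x" for j x z
    using that level_constD[OF P] cube_mono by (meson less_imp_le subsetD)
  have J: "J \<subseteq> sets lebesgue"
    by (auto simp: J_def)
  have "countable (\<Union>(range D))"
    using countable_D by auto
  then have cJ: "countable J"
    by (rule countable_subset[rotated]) (auto simp: J_def)
  have dJ: "disjoint_family_on (\<lambda>Q. C \<inter> Q) J" for C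
    unfolding disjoint_family_on_def
  proof (intro ballI impI)
    fix Q R assume QR: "Q \<in> J" "R \<in> J" "Q \<noteq> R"
    obtain j x where Q: "Q = cube j x" "?min j x" using QR by (auto simp: J_def)
    obtain i y where R: "R = cube i y" "?min i y" using QR by (auto simp: J_def)
    have False if z: "z \<in> Q" "z \<in> R" for z
    proof -
      have "?min j z" "?min i z"
        using min_cube Q R z by blast+
      then have "i = j" by (meson linorder_neqE)
      then show False using Q R z QR cube_eq by blast
    qed
    then show "(C \<inter> Q) \<inter> (C \<inter> R) = {}" by blast
  qed
  have U: "{x. \<exists>j\<ge>k. P j x} = \<Union>J"
  proof (intro equalityI subsetI)
    fix x assume "x \<in> {x. \<exists>j\<ge>k. P j x}"
    then obtain j where j: "k \<le> j" "P j x" by auto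
    \<comment> \<open>The levels start at k, so the first level at which the condition holds exists;
      it is found as a natural offset from k.\<close>
    define n where "n = (LEAST n::nat. P (k + int n) x)"
    have "P (k + int (nat (j - k))) x" using j by simp
    then have n: "P (k + int n) x" "\<And>m. m < n \<Longrightarrow> \<not> P (k + int m) x"
      unfolding n_def by (rule LeastI, metis not_less_Least)
    have "?min (k + int n) x"
    proof (intro conjI allI impI)
      fix i assume i: "k \<le> i \<and> i < k + int n"
      then show "\<not> P i x" using n(2)[of "nat (i - k)"] by (simp add: nat_less_iff)
    qed (use n in auto)
    then have "cube (k + int n) x \<in> J"
      unfolding J_def by (intro CollectI exI conjI) (rule refl, auto)
    then show "x \<in> \<Union>J" using mem_cube by (rule UnionI)
  next
    fix x assume "x \<in> \<Union>J"
    then obtain j y where "?min j y" "x \<in> cube j y" by (auto simp: J_def)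
    then have "?min j x" by (rule min_cube)
    then show "x \<in> {x. \<exists>j\<ge>k. P j x}" by auto
  qed
  have sum: "emeasure M (C \<inter> {x. \<exists>j\<ge>k. P j x}) = (\<integral>\<^sup>+Q. emeasure M (C \<inter> Q) \<partial>count_space J)"
    if "sets M = sets lebesgue" "C \<in> sets lebesgue" for M C
  proof -
    have "C \<inter> {x. \<exists>j\<ge>k. P j x} = (\<Union>Q\<in>J. C \<inter> Q)" unfolding U by auto
    moreover have "C \<inter> Q \<in> sets M" if "Q \<in> J" for Q
      using \<open>sets M = sets lebesgue\<close> \<open>C \<in> sets lebesgue\<close> J that by auto
    ultimately show ?thesis
      using emeasure_UN_countable[OF _ cJ dJ, of C M] by simp
  qed
  have "emeasure \<mu> (A \<inter> {x. \<exists>j\<ge>k. P j x}) \<le> (\<integral>\<^sup>+Q. c * emeasure \<nu> (B \<inter> Q) \<partial>count_space J)"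
    unfolding sum[OF sets(1,3)] by (intro nn_integral_mono) (auto simp: J_def intro!: le)
  also have "\<dots> = c * emeasure \<nu> (B \<inter> {x. \<exists>j\<ge>k. P j x})"
    unfolding sum[OF sets(2,4)] by (rule nn_integral_cmult) simp
  finally show ?thesis .
qed

lemma stopping_nn_integral_le:
  assumes P: "\<And>j. level_const j (P j)"
    and [measurable]: "u \<in> borel_measurable lebesgue" "v \<in> borel_measurable lebesgue"
    and le: "\<And>j x. k \<le> j \<Longrightarrow> P j x \<Longrightarrow> (\<And>i. k \<le> i \<Longrightarrow> i < j \<Longrightarrow> \<not> P i x) \<Longrightarrow>
      (\<integral>\<^sup>+y\<in>cube j x. u y \<partial>lebesgue) \<le> c * (\<integral>\<^sup>+y\<in>cube j x. v y \<partial>lebesgue)"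
  shows "(\<integral>\<^sup>+y\<in>{x. \<exists>j\<ge>k. P j x}. u y \<partial>lebesgue) \<le> c * (\<integral>\<^sup>+y\<in>{x. \<exists>j\<ge>k. P j x}. v y \<partial>lebesgue)"
proof -
  have U: "{x. \<exists>j\<ge>k. P j x} \<in> sets lebesgue"
    by (rule ex_level_pred_sets[OF P])
  have "emeasure (density lebesgue u) (UNIV \<inter> {x. \<exists>j\<ge>k. P j x})
      \<le> c * emeasure (density lebesgue v) (UNIV \<inter> {x. \<exists>j\<ge>k. P j x})"
    by (rule stopping_emeasure_le[OF P]) (use le in \<open>auto simp: emeasure_density\<close>)
  then show ?thesis
    using U by (simp add: emeasure_density)
qed

section \<open>Local integrability and averages over cubes\<close>

definition loc_int :: "(real^'n \<Rightarrow> 'b::real_normed_vector) \<Rightarrow> bool" where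
  "loc_int f \<longleftrightarrow> strongly_measurable lebesgue f \<and>
     (\<forall>k x. (\<integral>\<^sup>+y\<in>cube k x. ennreal (norm (f y)) \<partial>lebesgue) < \<infinity>)"

lemma loc_int_has_integral:
  fixes f :: "real^'n \<Rightarrow> 'b::banach"
  assumes f: "loc_int f"
  shows "has_strong_integral lebesgue (\<lambda>y. indicator (cube k x) y *\<^sub>R f y) (vol k *\<^sub>R average f (cube k x))"
proof -
  have "has_strong_integral lebesgue (\<lambda>y. indicator (cube k x) y *\<^sub>R f y)
      (strong_integral lebesgue (\<lambda>y. indicator (cube k x) y *\<^sub>R f y))"
  proof (rule has_strong_integral_ex)
    show "strongly_measurable lebesgue (\<lambda>y. indicator (cube k x) y *\<^sub>R f y)"
      using f by (intro strongly_measurable_indicator_scaleR) (auto simp: loc_int_def)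
    have "(\<integral>\<^sup>+y. ennreal (norm (indicator (cube k x) y *\<^sub>R f y)) \<partial>lebesgue)
        = (\<integral>\<^sup>+y\<in>cube k x. ennreal (norm (f y)) \<partial>lebesgue)"
      by (intro nn_integral_cong) (auto split: split_indicator)
    then show "(\<integral>\<^sup>+y. ennreal (norm (indicator (cube k x) y *\<^sub>R f y)) \<partial>lebesgue) < \<infinity>"
      using f unfolding loc_int_def by metis
  qed
  moreover have "vol k \<noteq> 0" using vol_pos[of k] by simp
  ultimately show ?thesis
    by (simp add: average_def measure_cube)
qed

lemma average_eqI:
  assumes "has_strong_integral lebesgue (\<lambda>y. indicator (cube k x) y *\<^sub>R f y) (vol k *\<^sub>R c)"
  shows "average f (cube k x) = c"
  using has_strong_integral_eq[OF assms] vol_pos[of k] by (simp add: average_def measure_cube)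

lemma average_const:
  assumes "\<And>y. y \<in> cube k x \<Longrightarrow> f y = c"
  shows "average f (cube k x) = c"
proof (rule average_eqI)
  have "(\<lambda>y. indicator (cube k x) y *\<^sub>R f y) = (\<lambda>y. indicator (cube k x) y *\<^sub>R c)"
    using assms by (auto split: split_indicator)
  then show "has_strong_integral lebesgue (\<lambda>y. indicator (cube k x) y *\<^sub>R f y) (vol k *\<^sub>R c)"
    using has_strong_integral_indicator[of "cube k x" lborel c] by (simp add: emeasure_cube measure_cube)
qed

lemma average_cong:
  assumes "\<And>y. y \<in> cube k x \<Longrightarrow> f y = g y"
  shows "average f (cube k x) = average g (cube k x)"
proof -
  have "(\<lambda>y. indicator (cube k x) y *\<^sub>R f y) = (\<lambda>y. indicator (cube k x) y *\<^sub>R g y)"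
    using assms by (auto split: split_indicator)
  then show ?thesis by (simp add: average_def)
qed

lemma average_diff:
  fixes f g :: "real^'n \<Rightarrow> 'b::banach"
  assumes "loc_int f" "loc_int g"
  shows "average (\<lambda>y. f y - g y) (cube k x) = average f (cube k x) - average g (cube k x)"
proof (rule average_eqI)
  show "has_strong_integral lebesgue (\<lambda>y. indicator (cube k x) y *\<^sub>R (f y - g y))
     (vol k *\<^sub>R (average f (cube k x) - average g (cube k x)))"
    using has_strong_integral_add[OF loc_int_has_integral[OF assms(1), of k x]
        has_strong_integral_scaleR[OF loc_int_has_integral[OF assms(2), of k x], of "-1"]]
    by (simp add: algebra_simps)
qed

text \<open>The martingale property of the averages: the 2^n children have equal volume, and the
  integral is additive over them.\<close>

lemma average_children:
  fixes f :: "real^'n \<Rightarrow> 'b::banach"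
  assumes f: "loc_int f"
  shows "average f (cube k x) = (1 / 2 ^ CARD('n)) *\<^sub>R (\<Sum>Q\<in>children k x. average f Q)"
proof (rule average_eqI)
  have *: "has_strong_integral lebesgue (\<lambda>y. indicator (\<Union>P) y *\<^sub>R f y) (vol (k + 1) *\<^sub>R (\<Sum>Q\<in>P. average f Q))"
    if "finite P" "P \<subseteq> children k x" for P
    using that
  proof (induction P)
    case empty
    show ?case
      using has_strong_integral_indicator[of "{}" lborel 0] by simp
  next
    case (insert Q P)
    obtain z where z: "Q = cube (k + 1) z" using insert.prems by (auto simp: children_def)
    have "Q \<inter> \<Union>P = {}"
    proof -
      have "Q \<inter> R = {}" if "R \<in> P" for R
        using insert.prems insert.hyps that by (intro disjointD[OF disjoint_children[of k x]]) auto
      then show ?thesis by auto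
    qed
    then have "(\<lambda>y. indicator (\<Union>(insert Q P)) y *\<^sub>R f y)
        = (\<lambda>y. indicator Q y *\<^sub>R f y + indicator (\<Union>P) y *\<^sub>R f y)"
      by (intro ext) (auto simp: indicator_def disjoint_iff)
    then show ?case
      using has_strong_integral_add[OF loc_int_has_integral[OF f, of "k + 1" z] insert.IH] insert
      by (simp add: z scaleR_add_right)
  qed
  show "has_strong_integral lebesgue (\<lambda>y. indicator (cube k x) y *\<^sub>R f y)
     (vol k *\<^sub>R (1 / 2 ^ CARD('n)) *\<^sub>R (\<Sum>Q\<in>children k x. average f Q))"
    using *[OF finite_children order_refl] by (simp add: Union_children vol_Suc[of k])
qed

definition norm_avg :: "(real^'n \<Rightarrow> 'b::real_normed_vector) \<Rightarrow> int \<Rightarrow> real^'n \<Rightarrow> real" where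
  "norm_avg f k x = average (\<lambda>y. norm (f y)) (cube k x)"

lemma loc_int_norm: "loc_int f \<Longrightarrow> loc_int (\<lambda>y. norm (f y))"
  unfolding loc_int_def by (simp add: strongly_measurable_norm)

lemma loc_int_measurable [measurable_dest]: "loc_int f \<Longrightarrow> (\<lambda>y. norm (f y)) \<in> borel_measurable lebesgue"
  unfolding loc_int_def by (simp add: borel_measurable_norm_strong)

lemma norm_avg_bounds:
  assumes f: "loc_int f"
  shows norm_avg_eq: "ennreal (vol k * norm_avg f k x) = (\<integral>\<^sup>+y\<in>cube k x. ennreal (norm (f y)) \<partial>lebesgue)"
    and norm_avg_nonneg: "0 \<le> norm_avg f k x"
proof -
  have [measurable]: "(\<lambda>y. norm (f y)) \<in> borel_measurable lebesgue"
    using f by (rule loc_int_measurable)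
  have eq: "vol k * norm_avg f k x = (\<integral>y. indicator (cube k x) y *\<^sub>R norm (f y) \<partial>lebesgue)"
    using vol_pos[of k] by (simp add: norm_avg_def average_def measure_cube strong_integral_completion_eq)
  have int: "integrable lebesgue (\<lambda>y. indicator (cube k x) y *\<^sub>R norm (f y))"
  proof (rule integrableI_nonneg)
    have "(\<integral>\<^sup>+y. ennreal (indicator (cube k x) y *\<^sub>R norm (f y)) \<partial>lebesgue)
        = (\<integral>\<^sup>+y\<in>cube k x. ennreal (norm (f y)) \<partial>lebesgue)"
      by (intro nn_integral_cong) (auto split: split_indicator)
    then show "(\<integral>\<^sup>+y. ennreal (indicator (cube k x) y *\<^sub>R norm (f y)) \<partial>lebesgue) < \<infinity>"
      using f unfolding loc_int_def by metis
  qed (auto simp: measurable_restrict_space1)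
  have "ennreal (vol k * norm_avg f k x) = (\<integral>\<^sup>+y. ennreal (indicator (cube k x) y *\<^sub>R norm (f y)) \<partial>lebesgue)"
    unfolding eq by (rule nn_integral_eq_integral[symmetric, OF int]) auto
  also have "\<dots> = (\<integral>\<^sup>+y\<in>cube k x. ennreal (norm (f y)) \<partial>lebesgue)"
    by (intro nn_integral_cong) (auto split: split_indicator)
  finally show "ennreal (vol k * norm_avg f k x) = (\<integral>\<^sup>+y\<in>cube k x. ennreal (norm (f y)) \<partial>lebesgue)" .
  have "0 \<le> vol k * norm_avg f k x"
    unfolding eq by (intro integral_nonneg_AE) auto
  then show "0 \<le> norm_avg f k x"
    using vol_pos[of k] by (simp add: zero_le_mult_iff)
qed

lemma norm_average_le:
  fixes f :: "real^'n \<Rightarrow> 'b::banach"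
  assumes f: "loc_int f"
  shows "norm (average f (cube k x)) \<le> norm_avg f k x"
proof -
  have "ennreal (norm (vol k *\<^sub>R average f (cube k x)))
      \<le> (\<integral>\<^sup>+y. ennreal (norm (indicator (cube k x) y *\<^sub>R f y)) \<partial>lebesgue)"
    by (rule has_strong_integral_norm_le[OF loc_int_has_integral[OF f]])
  also have "\<dots> = ennreal (vol k * norm_avg f k x)"
    unfolding norm_avg_eq[OF f] by (intro nn_integral_cong) (auto split: split_indicator)
  finally have "vol k * norm (average f (cube k x)) \<le> vol k * norm_avg f k x"
    using norm_avg_nonneg[OF f, of k x] by (subst (asm) ennreal_le_iff) auto
  then show ?thesis
    using vol_pos[of k] by simp
qed

lemma norm_avg_cube: "y \<in> cube m x \<Longrightarrow> k \<le> m \<Longrightarrow> norm_avg f k y = norm_avg f k x"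
  by (simp add: norm_avg_def cube_eq_le)

text \<open>Passing to a child loses at most the ratio of the volumes. This is the origin of the
  factor 2^n in the Calderon-Zygmund bound.\<close>

lemma norm_avg_Suc_le:
  assumes f: "loc_int f"
  shows "norm_avg f (k + 1) x \<le> 2 ^ CARD('n) * norm_avg f k x"
proof -
  have "ennreal (vol (k + 1) * norm_avg f (k + 1) x) \<le> ennreal (vol k * norm_avg f k x)"
    unfolding norm_avg_eq[OF f] using cube_mono[of k "k + 1" x]
    by (intro nn_integral_mono) (auto split: split_indicator)
  then have "vol (k + 1) * norm_avg f (k + 1) x \<le> vol (k + 1) * (2 ^ CARD('n) * norm_avg f k x)"
    using norm_avg_nonneg[OF f] by (subst (asm) ennreal_le_iff) (auto simp: vol_Suc[of k])
  then show ?thesis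
    using vol_pos[of "k + 1"] by simp
qed

text \<open>Such a function may take infinitely many values. Revealing it on the first i cubes of an
  enumeration of \<open>D N\<close>, with value 0 elsewhere, gives approximating simple
  functions.\<close>

lemma level_const_strongly_measurable:
  fixes g :: "real^'n \<Rightarrow> 'b::real_normed_vector"
  assumes g: "level_const N g"
  shows "strongly_measurable lebesgue g"
proof -
  define q where "q = from_nat_into (D N)"
  define s where "s = (\<lambda>i y. if \<exists>j<i. y \<in> q j then g y else 0)"
  have ne: "D N \<noteq> {}" using cube_in_D by blast
  have q: "q j \<in> D N" for j
    unfolding q_def by (rule from_nat_into[OF ne])
  have mem_q: "y \<in> q j \<longleftrightarrow> x \<in> q j" if "y \<in> cube N x" for x y j
    using that q[of j] cube_eqI cube_eq by (metis mem_cube)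
  have "simple_function lebesgue (s i)" for i
    unfolding simple_function_def
  proof (intro conjI ballI)
    have "level_const N (s i)"
      unfolding level_const_def
    proof (intro allI impI)
      fix x y assume y: "y \<in> cube N x"
      show "s i y = s i x"
        unfolding s_def level_constD[OF g y] mem_q[OF y] ..
    qed
    then show "s i -` {x} \<inter> space lebesgue \<in> sets lebesgue" for x
      using level_const_vimage_sets[of N "s i" "{x}"] by (simp add: vimage_def)
    have "finite (g ` q j)" for j
    proof -
      obtain z where "q j = cube N z" using q[of j] D_eq_range by auto
      then have "g ` q j \<subseteq> {g z}" by (auto intro: level_constD[OF g])
      then show ?thesis by (rule finite_subset) simp
    qed
    then have "finite (insert 0 (\<Union>j<i. g ` q j))" by simp
    then show "finite (s i ` space lebesgue)"
      by (rule finite_subset[rotated]) (auto simp: s_def)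
  qed
  moreover have "(\<lambda>i. s i x) \<longlonglongrightarrow> g x" for x
  proof -
    obtain j where j: "q j = cube N x"
      using from_nat_into_surj[OF countable_D cube_in_D] unfolding q_def by metis
    have "\<forall>\<^sub>F i in sequentially. s i x = g x"
      using eventually_gt_at_top[of j] by eventually_elim (use j in \<open>auto simp: s_def intro!: exI[of _ j]\<close>)
    then show ?thesis by (rule tendsto_eventually)
  qed
  ultimately show ?thesis
    unfolding strongly_measurable_def by (intro exI[of _ s]) auto
qed

text \<open>A cube has finitely many descendants at level N; the induction descends from N to
  coarser levels.\<close>

lemma level_const_finite_image:
  assumes g: "level_const N g"
  shows "finite (g ` cube k x)"
proof (cases "k \<le> N")
  case True
  then show ?thesis
  proof (induction k arbitrary: x rule: int_le_induct)
    case base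
    have "g ` cube N x \<subseteq> {g x}" by (auto intro: level_constD[OF g])
    then show ?case by (rule finite_subset) simp
  next
    case (step k)
    have "g ` cube (k - 1) x = (\<Union>Q\<in>children (k - 1) x. g ` Q)"
      using Union_children[of "k - 1" x] by blast
    moreover have "finite (g ` Q)" if "Q \<in> children (k - 1) x" for Q
      using that step.IH by (auto simp: children_def)
    ultimately show ?case
      using finite_children by simp
  qed
next
  case False
  then have "g ` cube k x \<subseteq> {g x}"
    using cube_mono[of N k x] by (auto intro!: level_constD[OF g])
  then show ?thesis by (rule finite_subset) simp
qed

lemma level_const_loc_int:
  fixes g :: "real^'n \<Rightarrow> 'b::real_normed_vector"
  assumes g: "level_const N g"
  shows "loc_int g"
  unfolding loc_int_def
proof (intro conjI allI level_const_strongly_measurable[OF g])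
  fix k x
  define B where "B = Max ((\<lambda>y. norm (g y)) ` cube k x)"
  have fin: "finite ((\<lambda>y. norm (g y)) ` cube k x)"
    using finite_imageI[OF level_const_finite_image[OF g, of k x], of norm] by (simp add: image_image)
  have "norm (g y) \<le> B" if "y \<in> cube k x" for y
    unfolding B_def using fin that by (intro Max_ge) auto
  then have "(\<integral>\<^sup>+y\<in>cube k x. ennreal (norm (g y)) \<partial>lebesgue) \<le> (\<integral>\<^sup>+y\<in>cube k x. ennreal B \<partial>lebesgue)"
    by (intro nn_integral_mono) (auto split: split_indicator intro!: ennreal_leI)
  also have "\<dots> = ennreal B * ennreal (vol k)"
    by (simp add: nn_integral_cmult_indicator emeasure_cube)
  also have "\<dots> < \<infinity>" by (simp add: ennreal_mult_less_top)
  finally show "(\<integral>\<^sup>+y\<in>cube k x. ennreal (norm (g y)) \<partial>lebesgue) < \<infinity>" .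
qed

section \<open>Optional stopping and the Calderon-Zygmund decomposition\<close>

text \<open>Stopping times of the dyadic filtration, bounded by N: the last clause makes the set
  where \<open>\<tau>\<close> takes the value j a union of cubes of level j.\<close>

definition stopping :: "int \<Rightarrow> (real^'n \<Rightarrow> int) \<Rightarrow> bool" where
  "stopping N \<tau> \<longleftrightarrow> (\<forall>x. \<tau> x \<le> N) \<and> (\<forall>x y. y \<in> cube (\<tau> x) x \<longrightarrow> \<tau> y = \<tau> x)"

text \<open>For a stopping time this is the conditional expectation of f on the stopped
  sigma-algebra; for a constant \<open>\<tau>\<close> it is the usual projection to one
  level.\<close>

definition stopped :: "(real^'n \<Rightarrow> 'b::real_normed_vector) \<Rightarrow> (real^'n \<Rightarrow> int) \<Rightarrow> real^'n \<Rightarrow> 'b" where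
  "stopped f \<tau> y = average f (cube (\<tau> y) y)"

lemma stopping_const: "stopping N (\<lambda>_. N)"
  by (simp add: stopping_def)

lemma level_const_stopped:
  assumes "stopping N \<tau>"
  shows "level_const N (stopped f \<tau>)"
  using assms unfolding level_const_def stopped_def stopping_def
  by (metis cube_eq_le cube_mono subsetD)

text \<open>Optional stopping. On a cube that stops, the stopped function is constant with the right
  value. Other cubes follow from their children by the martingale property, in a descending
  induction from level N.\<close>

lemma average_stopped:
  fixes f :: "real^'n \<Rightarrow> 'b::banach"
  assumes f: "loc_int f" and \<tau>: "stopping N \<tau>"
  shows "j \<le> \<tau> x \<Longrightarrow> average (stopped f \<tau>) (cube j x) = average f (cube j x)"
proof -
  have g: "loc_int (stopped f \<tau>)"
    by (rule level_const_loc_int[OF level_const_stopped[OF \<tau>]])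
  have stop: "average (stopped f \<tau>) (cube (\<tau> x) x) = average f (cube (\<tau> x) x)" for x
  proof (rule average_const)
    fix y assume y: "y \<in> cube (\<tau> x) x"
    then have "\<tau> y = \<tau> x" using \<tau> unfolding stopping_def by blast
    then show "stopped f \<tau> y = average f (cube (\<tau> x) x)"
      using cube_eq[OF y] by (simp add: stopped_def)
  qed
  have "\<forall>x. j \<le> \<tau> x \<longrightarrow> average (stopped f \<tau>) (cube j x) = average f (cube j x)" if "j \<le> N" for j
    using that
  proof (induction j rule: int_le_induct)
    case base
    show ?case
      using stop \<tau> unfolding stopping_def by (metis order_antisym)
  next
    case (step j)
    show ?case
    proof (intro allI impI)
      fix x assume le: "j - 1 \<le> \<tau> x"
      show "average (stopped f \<tau>) (cube (j - 1) x) = average f (cube (j - 1) x)"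
      proof (cases "\<tau> x = j - 1")
        case True
        then show ?thesis using stop by metis
      next
        case False
        have "average (stopped f \<tau>) Q = average f Q" if Q: "Q \<in> children (j - 1) x" for Q
        proof -
          obtain y where y: "Q = cube j y" "y \<in> cube (j - 1) x" using Q by (auto simp: children_def)
          \<comment> \<open>If y stopped at level j - 1 or earlier, its stopping cube would contain
            x as well, and x would stop at the same level; but x stops strictly after level j -
            1.\<close>
          have "j \<le> \<tau> y"
          proof (rule ccontr)
            assume "\<not> j \<le> \<tau> y"
            then have "x \<in> cube (\<tau> y) y"
              using cube_mono[of "\<tau> y" "j - 1" y] cube_eq[OF y(2)] mem_cube[of x "j - 1"] by auto
            then have "\<tau> x = \<tau> y" using \<tau> unfolding stopping_def by blast
            then show False using False le \<open>\<not> j \<le> \<tau> y\<close> by simp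
          qed
          then show ?thesis using step.IH y by simp
        qed
        then show ?thesis
          by (simp add: average_children[OF f] average_children[OF g])
      qed
    qed
  qed
  then show "j \<le> \<tau> x \<Longrightarrow> average (stopped f \<tau>) (cube j x) = average f (cube j x)"
    using \<tau> unfolding stopping_def by (meson order_trans)
qed

text \<open>The good function is f stopped at the first level where the mean of its norm exceeds l,
  and at N if there is none. The parent of a stopping cube has mean at most l, or the stopping level
  is k; either way the bound 2^n l follows. No bad part needs an estimate, because off
  \<open>B\<close> all averages up to level N agree.\<close>

lemma calderon_zygmund:
  fixes f :: "real^'n \<Rightarrow> 'b::banach"
  assumes f: "loc_int f" and kN: "k \<le> N" and l: "0 < l" and le: "\<And>x. norm_avg f k x \<le> l"
  obtains g B where "level_const N g" "\<And>y. norm (g y) \<le> 2 ^ CARD('n) * l"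
    "(\<integral>\<^sup>+y. norm (g y) \<partial>lebesgue) \<le> (\<integral>\<^sup>+y. norm (f y) \<partial>lebesgue)"
    "B \<in> sets lebesgue"
    "emeasure lebesgue B \<le> ennreal (1 / l) * (\<integral>\<^sup>+y. norm (f y) \<partial>lebesgue)"
    "\<And>x j. x \<notin> B \<Longrightarrow> k \<le> j \<Longrightarrow> j \<le> N \<Longrightarrow> average g (cube j x) = average f (cube j x)"
    "\<And>x. (\<And>y. y \<in> cube k x \<Longrightarrow> f y = 0) \<Longrightarrow> g x = 0"
proof -
  \<comment> \<open>Inserting N makes the minimum meaningful and supplies the default level.\<close>
  define \<tau> where "\<tau> = (\<lambda>x. Min (insert N {j \<in> {k..N}. l < norm_avg f j x}))"
  have fin: "finite (insert N {j \<in> {k..N}. l < norm_avg f j x})" for x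
    by (rule finite.insertI, rule finite_subset[of _ "{k..N}"]) auto
  have \<tau>_le: "\<tau> x \<le> N" for x unfolding \<tau>_def using fin by (intro Min_le) auto
  have \<tau>_mem: "\<tau> x \<in> insert N {j \<in> {k..N}. l < norm_avg f j x}" for x
    unfolding \<tau>_def using fin by (intro Min_in) auto
  have \<tau>_ge: "k \<le> \<tau> x" for x using \<tau>_mem[of x] kN by auto
  have \<tau>_less: "norm_avg f j x \<le> l" if "k \<le> j" "j < \<tau> x" for j x
  proof (rule ccontr)
    assume "\<not> norm_avg f j x \<le> l"
    then have "\<tau> x \<le> j"
      unfolding \<tau>_def using that \<tau>_le[of x] fin by (intro Min_le) auto
    then show False using that by simp
  qed
  have \<tau>: "stopping N \<tau>"
    unfolding stopping_def
  proof (intro conjI allI impI \<tau>_le)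
    fix x y assume y: "y \<in> cube (\<tau> x) x"
    have eq: "norm_avg f j y = norm_avg f j x" if "j \<le> \<tau> x" for j
      using norm_avg_cube[OF y that] .
    have "\<tau> x \<in> insert N {j \<in> {k..N}. l < norm_avg f j y}"
      using \<tau>_mem[of x] eq[OF order_refl] by auto
    then have "\<tau> y \<le> \<tau> x"
      unfolding \<tau>_def[THEN fun_cong, of y] using fin by (intro Min_le) auto
    moreover have "\<tau> x \<le> \<tau> y"
    proof (rule ccontr)
      assume "\<not> \<tau> x \<le> \<tau> y"
      then have "\<tau> y < \<tau> x" by simp
      then have "norm_avg f (\<tau> y) y \<le> l" "\<tau> y \<noteq> N"
        using \<tau>_less[OF \<tau>_ge[of y]] eq[of "\<tau> y"] \<tau>_le[of x] by auto
      then show False using \<tau>_mem[of y] by auto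
    qed
    ultimately show "\<tau> y = \<tau> x" by simp
  qed
  define g where "g = stopped f \<tau>"
  define B where "B = {x. \<exists>j\<ge>k. j \<le> N \<and> l < norm_avg f j x}"
  have PB: "level_const j (\<lambda>x. j \<le> N \<and> l < norm_avg f j x)" for j
    using norm_avg_cube[of _ j _ j f] by (auto simp: level_const_def)
  \<comment> \<open>The condition that always holds selects exactly the cubes of level k, so an
    estimate on each of them sums to one on the whole space.\<close>
  have PT: "level_const j (\<lambda>x. True)" for j by (simp add: level_const_def)
  have T: "{x::real^'n. \<exists>j\<ge>k. True} = UNIV" by auto
  have gl: "level_const N g"
    unfolding g_def by (rule level_const_stopped[OF \<tau>])
  note fm [measurable] = loc_int_measurable[OF f]
  note gm [measurable] = loc_int_measurable[OF level_const_loc_int[OF gl]]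
  have ng: "norm (g y) \<le> norm_avg f (\<tau> y) y" for y
    unfolding g_def stopped_def by (rule norm_average_le[OF f])
  show ?thesis
  proof (rule that[OF gl])
    show "norm (g y) \<le> 2 ^ CARD('n) * l" for y
    proof (cases "\<tau> y = k")
      case True
      have "norm (g y) \<le> 1 * l" using ng[of y] le[of y] True by simp
      also have "\<dots> \<le> 2 ^ CARD('n) * l" using l by (intro mult_right_mono) auto
      finally show ?thesis .
    next
      case False
      then have "norm_avg f (\<tau> y - 1) y \<le> l"
        using \<tau>_ge[of y] by (intro \<tau>_less) auto
      then have "2 ^ CARD('n) * norm_avg f (\<tau> y - 1) y \<le> 2 ^ CARD('n) * l" by simp
      moreover have "norm_avg f (\<tau> y) y \<le> 2 ^ CARD('n) * norm_avg f (\<tau> y - 1) y"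
        using norm_avg_Suc_le[OF f, of "\<tau> y - 1" y] by simp
      ultimately show ?thesis
        using ng[of y] by (meson order_trans)
    qed
    show "(\<integral>\<^sup>+y. norm (g y) \<partial>lebesgue) \<le> (\<integral>\<^sup>+y. norm (f y) \<partial>lebesgue)"
    proof -
      have "(\<integral>\<^sup>+y\<in>cube k x. norm (g y) \<partial>lebesgue) \<le> (\<integral>\<^sup>+y\<in>cube k x. norm (f y) \<partial>lebesgue)" for x
      proof -
        \<comment> \<open>Optional stopping for the scalar function norm f: its stopped version
          dominates the norm of g and has the same integral over cubes of level k.\<close>
        let ?h = "stopped (\<lambda>y. norm (f y)) \<tau>"
        have hl: "loc_int ?h" by (rule level_const_loc_int[OF level_const_stopped[OF \<tau>]])
        have h: "norm (?h y) = norm_avg f (\<tau> y) y" for y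
          using norm_avg_nonneg[OF f] by (simp add: stopped_def norm_avg_def)
        have h': "(\<lambda>y. norm (?h y)) = ?h"
          using norm_avg_nonneg[OF f] by (auto simp: stopped_def norm_avg_def)
        have "(\<integral>\<^sup>+y\<in>cube k x. norm (g y) \<partial>lebesgue) \<le> (\<integral>\<^sup>+y\<in>cube k x. norm (?h y) \<partial>lebesgue)"
          using ng by (intro nn_integral_mono mult_right_mono ennreal_leI) (simp_all only: h zero_le)
        also have "\<dots> = ennreal (vol k * average ?h (cube k x))"
          unfolding norm_avg_eq[OF hl, symmetric] norm_avg_def h' ..
        also have "\<dots> = ennreal (vol k * norm_avg f k x)"
          using average_stopped[OF loc_int_norm[OF f] \<tau>, of k x] \<tau>_ge by (simp add: norm_avg_def)
        also have "\<dots> = (\<integral>\<^sup>+y\<in>cube k x. norm (f y) \<partial>lebesgue)"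
          by (rule norm_avg_eq[OF f])
        finally show ?thesis .
      qed
      then have *: "(\<integral>\<^sup>+y\<in>{x::real^'n. \<exists>j\<ge>k. True}. norm (g y) \<partial>lebesgue)
          \<le> 1 * (\<integral>\<^sup>+y\<in>{x::real^'n. \<exists>j\<ge>k. True}. norm (f y) \<partial>lebesgue)"
      proof (intro stopping_nn_integral_le[OF PT])
        fix j x
        assume "k \<le> j" and "\<And>i. k \<le> i \<Longrightarrow> i < j \<Longrightarrow> \<not> True"
        then have "j = k" by (metis linorder_not_less order_antisym order_refl)
        then show "(\<integral>\<^sup>+y\<in>cube j x. norm (g y) \<partial>lebesgue) \<le> 1 * (\<integral>\<^sup>+y\<in>cube j x. norm (f y) \<partial>lebesgue)"
          using \<open>\<And>x. (\<integral>\<^sup>+y\<in>cube k x. norm (g y) \<partial>lebesgue) \<le> (\<integral>\<^sup>+y\<in>cube k x. norm (f y) \<partial>lebesgue)\<close> by simp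
      qed auto
      then show ?thesis unfolding T by simp
    qed
    show "B \<in> sets lebesgue"
      unfolding B_def by (rule ex_level_pred_sets[OF PB])
    show "emeasure lebesgue B \<le> ennreal (1 / l) * (\<integral>\<^sup>+y. norm (f y) \<partial>lebesgue)"
    proof -
      have "(\<integral>\<^sup>+y\<in>B. 1 \<partial>lebesgue) \<le> ennreal (1 / l) * (\<integral>\<^sup>+y\<in>B. norm (f y) \<partial>lebesgue)"
        unfolding B_def
      proof (rule stopping_nn_integral_le[OF PB])
        fix j x assume j: "j \<le> N \<and> l < norm_avg f j x"
        have "(\<integral>\<^sup>+y\<in>cube j x. 1 \<partial>lebesgue) = ennreal (vol j)" by (simp add: emeasure_cube)
        also have "\<dots> \<le> ennreal (1 / l * (vol j * norm_avg f j x))"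
          using j l vol_pos[of j] by (intro ennreal_leI) (simp add: field_simps)
        also have "\<dots> = ennreal (1 / l) * (\<integral>\<^sup>+y\<in>cube j x. norm (f y) \<partial>lebesgue)"
          using norm_avg_nonneg[OF f] l by (subst ennreal_mult) (auto simp: norm_avg_eq[OF f])
        finally show "(\<integral>\<^sup>+y\<in>cube j x. 1 \<partial>lebesgue) \<le> ennreal (1 / l) * (\<integral>\<^sup>+y\<in>cube j x. norm (f y) \<partial>lebesgue)" .
      qed auto
      also have "\<dots> \<le> ennreal (1 / l) * (\<integral>\<^sup>+y. norm (f y) \<partial>lebesgue)"
        by (intro mult_left_mono nn_integral_mono) (auto split: split_indicator)
      finally show ?thesis
        using \<open>B \<in> sets lebesgue\<close> by simp
    qed
    show "average g (cube j x) = average f (cube j x)" if "x \<notin> B" "k \<le> j" "j \<le> N" for x j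
    proof -
      \<comment> \<open>Off \<open>B\<close> no mean exceeds l, so the default level N is the
        stopping level, and optional stopping covers every level up to it.\<close>
      have "\<tau> x = N" using that \<tau>_mem[of x] by (auto simp: B_def)
      then show ?thesis
        unfolding g_def using that by (intro average_stopped[OF f \<tau>]) auto
    qed
    show "g x = 0" if "\<And>y. y \<in> cube k x \<Longrightarrow> f y = 0" for x
      unfolding g_def stopped_def using that cube_mono[OF \<tau>_ge[of x]] by (intro average_const) auto
  qed
qed

end

section \<open>Powers of extended nonnegative numbers and the layer cake formula\<close>

lemma ennreal_powr_ennreal [simp]: "0 \<le> x \<Longrightarrow> ennreal_powr (ennreal x) p = ennreal (x powr p)"
  by (simp add: ennreal_powr_def)

lemma ennreal_powr_top [simp]: "ennreal_powr top p = top"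
  by (simp add: ennreal_powr_def)

lemma ennreal_powr_zero [simp]: "ennreal_powr 0 p = 0"
  by (simp add: ennreal_powr_def)

lemma ennreal_powr_mono:
  assumes "a \<le> b" "0 \<le> p"
  shows "ennreal_powr a p \<le> ennreal_powr b p"
proof (cases b)
  case (real s)
  then obtain r where "a = ennreal r" "0 \<le> r"
    using assms by (cases a) (auto simp: top_unique)
  then show ?thesis
    using assms real by (auto intro!: ennreal_leI powr_mono2)
qed simp

lemma ennreal_powr_mult:
  assumes "0 < p"
  shows "ennreal_powr (a * b) p = ennreal_powr a p * ennreal_powr b p"
proof (cases a; cases b)
  fix r s assume "0 \<le> r" "a = ennreal r" "0 \<le> s" "b = ennreal s"
  then show ?thesis by (simp add: powr_mult flip: ennreal_mult)
next
  fix r assume r: "0 \<le> r" "a = ennreal r" and b: "b = top"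
  show ?thesis
    using r b assms by (cases "r = 0") (auto simp: ennreal_mult_top)
next
  fix r assume r: "0 \<le> r" "b = ennreal r" and b: "a = top"
  show ?thesis
    using r b assms by (cases "r = 0") (auto simp: ennreal_top_mult)
qed (simp add: ennreal_top_mult)

lemma ennreal_powr_powr: "ennreal_powr (ennreal_powr a p) q = ennreal_powr a (p * q)"
  by (cases a) (auto simp: powr_powr)

lemma ennreal_powr_one [simp]: "ennreal_powr a 1 = a"
  by (cases a) auto

lemma ennreal_powr_add:
  assumes "0 < p"
  shows "a * ennreal_powr a p = ennreal_powr a (1 + p)"
proof (cases a)
  case (real r)
  then have "r * r powr p = r powr (1 + p)"
    by (cases "r = 0") (auto simp: powr_add)
  then show ?thesis using real by (simp flip: ennreal_mult)
qed simp

lemma borel_measurable_ennreal_powr [measurable (raw)]: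
  assumes [measurable]: "f \<in> borel_measurable M"
  shows "(\<lambda>x. ennreal_powr (f x) p) \<in> borel_measurable M"
  unfolding ennreal_powr_def by measurable

text \<open>The derivative of t powr q. It is cut off at 0 because \<open>ennreal t\<close> is 0 for
  negative t, so that the condition \<open>ennreal t < a\<close> does not confine t to the positive
  half-line.\<close>

definition powr_kernel :: "real \<Rightarrow> real \<Rightarrow> ennreal" where
  "powr_kernel q t = ennreal (q * t powr (q - 1)) * indicator {0<..} t"

lemma powr_kernel_measurable [measurable]: "powr_kernel q \<in> borel_measurable borel"
  unfolding powr_kernel_def by measurable

lemma powr_layer:
  assumes q: "0 < q"
  shows "(\<integral>\<^sup>+t. powr_kernel q t * indicator {t. ennreal t < a} t \<partial>lborel) = ennreal_powr a q"
proof -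
  have fin: "(\<integral>\<^sup>+t. powr_kernel q t * indicator {t. ennreal t < ennreal r} t \<partial>lborel) = ennreal (r powr q)"
    if r: "0 \<le> r" for r
  proof -
    have "((\<lambda>t. q * t powr (q - 1)) has_integral (q * (r powr (q - 1 + 1) / (q - 1 + 1)))) {0..r}"
      using q r by (intro has_integral_mult_right has_integral_powr_from_0) auto
    then have "(\<integral>\<^sup>+t. ennreal (q * t powr (q - 1)) * indicator {0..r} t \<partial>lborel) = ennreal (r powr q)"
      using q by (subst nn_integral_has_integral_lebesgue') auto
    moreover have "(\<integral>\<^sup>+t. powr_kernel q t * indicator {t. ennreal t < ennreal r} t \<partial>lborel)
        = (\<integral>\<^sup>+t. ennreal (q * t powr (q - 1)) * indicator {0..r} t \<partial>lborel)"
    proof (rule nn_integral_cong_AE)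
      show "AE t in lborel. powr_kernel q t * indicator {t. ennreal t < ennreal r} t
          = ennreal (q * t powr (q - 1)) * indicator {0..r} t"
        using AE_lborel_singleton[of r]
      proof eventually_elim
        case (elim t)
        show ?case
        proof (cases "0 < t")
          case True
          then show ?thesis
            using elim r by (auto simp: powr_kernel_def ennreal_less_iff split: split_indicator)
        qed (cases "t = 0"; auto simp: powr_kernel_def)
      qed
    qed
    ultimately show ?thesis by simp
  qed
  show ?thesis
  proof (cases a)
    case (real r)
    then show ?thesis using fin by simp
  next
    case top
    let ?I = "\<integral>\<^sup>+t. powr_kernel q t * indicator {t. ennreal t < a} t \<partial>lborel"
    \<comment> \<open>The finite case at height \<open>real n powr (1 / q)\<close> bounds the
      integral below by n, for every n.\<close>
    have "of_nat n \<le> ?I" for n :: nat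
    proof -
      have "of_nat n = ennreal ((real n powr (1 / q)) powr q)"
        using q by (simp add: powr_powr ennreal_of_nat_eq_real_of_nat)
      also have "\<dots> = (\<integral>\<^sup>+t. powr_kernel q t * indicator {t. ennreal t < ennreal (real n powr (1 / q))} t \<partial>lborel)"
        by (rule fin[symmetric]) simp
      also have "\<dots> \<le> ?I"
        using top by (intro nn_integral_mono) (auto split: split_indicator)
      finally show ?thesis .
    qed
    then have "?I = top"
      by (metis ennreal_Ex_less_of_nat linorder_not_less top.not_eq_extremum)
    then show ?thesis using top by simp
  qed
qed

lemma (in sigma_finite_measure) layer_cake:
  assumes F[measurable]: "F \<in> borel_measurable M" and q: "0 < q"
  shows "(\<integral>\<^sup>+x. ennreal_powr (F x) q \<partial>M)
    = (\<integral>\<^sup>+t. powr_kernel q t * emeasure M {x \<in> space M. ennreal t < F x} \<partial>lborel)"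
proof -
  interpret L: pair_sigma_finite M lborel ..
  let ?J = "indicator {z \<in> space (M \<Otimes>\<^sub>M lborel). ennreal (snd z) < F (fst z)} :: _ \<Rightarrow> ennreal"
  have "(\<integral>\<^sup>+x. ennreal_powr (F x) q \<partial>M)
    = (\<integral>\<^sup>+x. \<integral>\<^sup>+t. powr_kernel q t * ?J (x, t) \<partial>lborel \<partial>M)"
    unfolding powr_layer[OF q, symmetric]
    by (intro nn_integral_cong) (auto simp: space_pair_measure split: split_indicator)
  also have "\<dots> = (\<integral>\<^sup>+t. \<integral>\<^sup>+x. powr_kernel q t * ?J (x, t) \<partial>M \<partial>lborel)"
    by (rule L.Fubini'[symmetric]) measurable
  also have "\<dots> = (\<integral>\<^sup>+t. powr_kernel q t * emeasure M {x \<in> space M. ennreal t < F x} \<partial>lborel)"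
  proof (intro nn_integral_cong)
    fix t
    have "(\<integral>\<^sup>+x. powr_kernel q t * ?J (x, t) \<partial>M)
      = (\<integral>\<^sup>+x. powr_kernel q t * indicator {x \<in> space M. ennreal t < F x} x \<partial>M)"
      by (intro nn_integral_cong) (auto simp: space_pair_measure split: split_indicator)
    also have "\<dots> = powr_kernel q t * emeasure M {x \<in> space M. ennreal t < F x}"
      by (rule nn_integral_cmult_indicator) measurable
    finally show "(\<integral>\<^sup>+x. powr_kernel q t * ?J (x, t) \<partial>M)
      = powr_kernel q t * emeasure M {x \<in> space M. ennreal t < F x}" .
  qed
  finally show ?thesis .
qed

text \<open>The factor 2 / t is the weak-type constant at height t / 2. Absorbing it lowers the
  exponent of the kernel by one and produces the constant 2 p / (p - 1) in
  \<open>wmax_strong_type\<close>.\<close>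

lemma powr_kernel_shift:
  assumes p: "1 < p" and t: "0 < t"
  shows "powr_kernel p t * ennreal (2 / t) = ennreal (2 * p / (p - 1)) * powr_kernel (p - 1) t"
proof -
  have "t powr (p - 1) = t powr (p - 2) * t"
    using t powr_add[of t "p - 2" 1] by simp
  then have "p * t powr (p - 1) * (2 / t) = 2 * p / (p - 1) * ((p - 1) * t powr (p - 1 - 1))"
    using p t by (simp add: field_simps)
  then show ?thesis
    using p t by (simp add: powr_kernel_def flip: ennreal_mult)
qed

lemma emeasure_UN_incseq_le:
  assumes "\<And>i::nat. U i \<in> sets M" "incseq U" "\<And>i. emeasure M (U i) \<le> c"
  shows "emeasure M (\<Union>i. U i) \<le> c"
proof -
  have "(SUP i. emeasure M (U i)) = emeasure M (\<Union>i. U i)"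
    using assms(1,2) by (intro SUP_emeasure_incseq) auto
  then show ?thesis
    using assms(3) by (metis SUP_least)
qed

section \<open>Weighted dyadic maximal functions\<close>

context dyadic
begin

text \<open>Just what makes averages over cubes meaningful, with no doubling condition: the bounds
  for the maximal function below have constants independent of the measure, so they apply to a
  weight and to its conjugate weight.\<close>

definition cube_measure :: "(real^'n) measure \<Rightarrow> bool" where
  "cube_measure \<mu> \<longleftrightarrow> sets \<mu> = sets lebesgue \<and>
     (\<forall>k x. 0 < emeasure \<mu> (cube k x) \<and> emeasure \<mu> (cube k x) < \<infinity>)"

lemma cube_measure_lebesgue: "cube_measure lebesgue"
  by (simp add: cube_measure_def emeasure_cube)

lemma cube_measure_sigma_finite:
  assumes "cube_measure \<mu>"
  shows "sigma_finite_measure \<mu>"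
proof
  have [simp]: "sets \<mu> = sets lebesgue" "space \<mu> = UNIV"
    using assms sets_eq_imp_space_eq[of \<mu> lebesgue] by (auto simp: cube_measure_def)
  have "emeasure \<mu> (cube 0 x) \<noteq> top" for x
    using assms unfolding cube_measure_def by (metis less_irrefl infinity_ennreal_def)
  then show "\<exists>A. countable A \<and> A \<subseteq> sets \<mu> \<and> \<Union>A = space \<mu> \<and> (\<forall>a\<in>A. emeasure \<mu> a \<noteq> \<infinity>)"
    using assms countable_D[of 0] partition_onD1[OF partition[of 0]]
    by (intro exI[of _ "D 0"]) (auto simp: cube_measure_def D_eq_range)
qed

definition wavg :: "(real^'n) measure \<Rightarrow> (real^'n \<Rightarrow> ennreal) \<Rightarrow> int \<Rightarrow> real^'n \<Rightarrow> ennreal" where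
  "wavg \<mu> h j x = (\<integral>\<^sup>+y\<in>cube j x. h y \<partial>\<mu>) / emeasure \<mu> (cube j x)"

definition wmax :: "(real^'n) measure \<Rightarrow> (real^'n \<Rightarrow> ennreal) \<Rightarrow> real^'n \<Rightarrow> ennreal" where
  "wmax \<mu> h x = (SUP j. wavg \<mu> h j x)"

lemma wavg_cong_cube: "y \<in> cube j x \<Longrightarrow> wavg \<mu> h j y = wavg \<mu> h j x"
  by (simp add: wavg_def cube_eq)

lemma wavg_le_wmax: "wavg \<mu> h j x \<le> wmax \<mu> h x"
  unfolding wmax_def by (rule SUP_upper) simp

lemma wavg_times:
  assumes "cube_measure \<mu>"
  shows "wavg \<mu> h j x * emeasure \<mu> (cube j x) = (\<integral>\<^sup>+y\<in>cube j x. h y \<partial>\<mu>)"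
  using assms unfolding wavg_def cube_measure_def
  by (metis ennreal_divide_times ennreal_divide_self infinity_ennreal_def mult.right_neutral less_numeral_extra(3))

lemma le_wavgI:
  assumes "cube_measure \<mu>" "a * emeasure \<mu> (cube j x) \<le> (\<integral>\<^sup>+y\<in>cube j x. h y \<partial>\<mu>)"
  shows "a \<le> wavg \<mu> h j x"
proof -
  have "a * emeasure \<mu> (cube j x) / emeasure \<mu> (cube j x) \<le> wavg \<mu> h j x"
    unfolding wavg_def by (rule divide_right_mono_ennreal[OF assms(2)])
  moreover have "emeasure \<mu> (cube j x) \<noteq> 0" "emeasure \<mu> (cube j x) \<noteq> top"
    using assms(1) unfolding cube_measure_def by (metis less_irrefl, metis less_irrefl infinity_ennreal_def)
  ultimately show ?thesis
    by (simp add: ennreal_mult_divide_eq)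
qed

lemma wavg_measurable [measurable]: "wavg \<mu> h j \<in> borel_measurable lebesgue"
  by (rule level_const_measurable[of j]) (auto simp: level_const_def wavg_cong_cube)

lemma wmax_measurable [measurable]: "wmax \<mu> h \<in> borel_measurable lebesgue"
  unfolding wmax_def by measurable

text \<open>Maximal dyadic cubes are disjoint, so the constant is 1. They are only guaranteed to
  exist among levels bounded below; the bound - m on the levels is removed at the end by a monotone
  limit.\<close>

lemma wmax_weak_type:
  assumes \<mu>: "cube_measure \<mu>" and h [measurable]: "h \<in> borel_measurable lebesgue" and t: "0 < t"
  shows "emeasure \<mu> {x. ennreal t < wmax \<mu> h x} \<le> ennreal (1 / t) * (\<integral>\<^sup>+x. h x \<partial>\<mu>)"
proof -
  have s: "sets \<mu> = sets lebesgue" using \<mu> by (simp add: cube_measure_def)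
  have [simp]: "space \<mu> = UNIV" using sets_eq_imp_space_eq[OF s] by simp
  have h' [measurable]: "h \<in> borel_measurable \<mu>" using h s by (simp cong: measurable_cong_sets)
  define U where "U = (\<lambda>m::nat. {x. \<exists>j\<ge>- int m. ennreal t < wavg \<mu> h j x})"
  have P: "level_const j (\<lambda>x. ennreal t < wavg \<mu> h j x)" for j
    by (simp add: level_const_def wavg_cong_cube)
  have U: "U m \<in> sets \<mu>" for m
    unfolding U_def s by (rule ex_level_pred_sets[OF P])
  have "emeasure \<mu> (U m) \<le> ennreal (1 / t) * (\<integral>\<^sup>+x. h x \<partial>\<mu>)" for m
  proof -
    have "emeasure \<mu> (UNIV \<inter> U m) \<le> ennreal (1 / t) * emeasure (density \<mu> h) (UNIV \<inter> U m)"
      unfolding U_def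
    proof (rule stopping_emeasure_le[OF P])
      fix j x assume "ennreal t < wavg \<mu> h j x"
      then have "ennreal t * emeasure \<mu> (cube j x) \<le> wavg \<mu> h j x * emeasure \<mu> (cube j x)"
        by (intro mult_right_mono) auto
      then have "ennreal t * emeasure \<mu> (cube j x) \<le> emeasure (density \<mu> h) (cube j x)"
        using s by (simp add: wavg_times[OF \<mu>] emeasure_density)
      then have "ennreal (1 / t) * (ennreal t * emeasure \<mu> (cube j x))
          \<le> ennreal (1 / t) * emeasure (density \<mu> h) (cube j x)"
        by (rule mult_left_mono) simp
      moreover have "ennreal (1 / t) * ennreal t = 1"
        using t by (simp flip: ennreal_mult)
      ultimately show "emeasure \<mu> (UNIV \<inter> cube j x) \<le> ennreal (1 / t) * emeasure (density \<mu> h) (UNIV \<inter> cube j x)"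
        by (simp flip: mult.assoc)
    qed (auto simp: s)
    also have "\<dots> \<le> ennreal (1 / t) * emeasure (density \<mu> h) (space (density \<mu> h))"
      by (intro mult_left_mono emeasure_mono) (auto simp: s U)
    finally show ?thesis
      by (simp add: emeasure_density s)
  qed
  moreover have "{x. ennreal t < wmax \<mu> h x} = (\<Union>m. U m)"
  proof -
    have "\<exists>m. - int m \<le> j" for j by (intro exI[of _ "nat (-j)"]) auto
    then show ?thesis
      unfolding U_def wmax_def less_SUP_iff by auto blast
  qed
  moreover have "incseq U"
  proof (rule incseq_SucI, rule subsetI)
    fix m x assume "x \<in> U m"
    then obtain j where "- int m \<le> j" "ennreal t < wavg \<mu> h j x" by (auto simp: U_def)
    then show "x \<in> U (Suc m)"
      unfolding U_def by (intro CollectI exI[of _ j]) auto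
  qed
  ultimately show ?thesis
    using emeasure_UN_incseq_le[of U \<mu>] U by simp
qed

text \<open>Marcinkiewicz interpolation between the weak bound and the trivial bound for bounded
  functions, done by cutting h at height t / 2.\<close>

lemma wmax_strong_type:
  assumes \<mu>: "cube_measure \<mu>" and p: "1 < p" and h [measurable]: "h \<in> borel_measurable lebesgue"
  shows "(\<integral>\<^sup>+x. ennreal_powr (wmax \<mu> h x) p \<partial>\<mu>)
    \<le> ennreal (2 * p / (p - 1) * 2 powr (p - 1)) * (\<integral>\<^sup>+x. ennreal_powr (h x) p \<partial>\<mu>)"
proof -
  interpret sigma_finite_measure \<mu> by (rule cube_measure_sigma_finite[OF \<mu>])
  have s: "sets \<mu> = sets lebesgue" using \<mu> by (simp add: cube_measure_def)
  have [simp]: "space \<mu> = UNIV" using sets_eq_imp_space_eq[OF s] by simp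
  have [measurable]: "h \<in> borel_measurable \<mu>" "wmax \<mu> h \<in> borel_measurable \<mu>"
    using h wmax_measurable s by (simp_all cong: measurable_cong_sets)
  interpret L: pair_sigma_finite \<mu> lborel ..
  \<comment> \<open>The cut is expressed by a set in the product space, so that it is jointly
    measurable in x and t when the integrals are exchanged.\<close>
  let ?J = "indicator {z \<in> space (\<mu> \<Otimes>\<^sub>M lborel). ennreal (snd z / 2) < h (fst z)} :: _ \<Rightarrow> ennreal"
  let ?A = "\<lambda>t. {x. ennreal (t / 2) < h x}"
  have [measurable]: "?A t \<in> sets \<mu>" for t
  proof -
    have "{x \<in> space \<mu>. ennreal (t / 2) < h x} \<in> sets \<mu>" by measurable
    then show ?thesis by simp
  qed
  have weak: "emeasure \<mu> {x. ennreal t < wmax \<mu> h x} \<le> ennreal (2 / t) * (\<integral>\<^sup>+x. h x * indicator (?A t) x \<partial>\<mu>)"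
    if t: "0 < t" for t
  proof -
    let ?h = "\<lambda>x. h x * indicator (?A t) x"
    have A: "?A t \<in> sets lebesgue" using \<open>?A t \<in> sets \<mu>\<close> s by simp
    have hm: "?h \<in> borel_measurable lebesgue" using A by measurable
    then have hm': "?h \<in> borel_measurable \<mu>" using s by (simp cong: measurable_cong_sets)
    \<comment> \<open>The part of h below the cut contributes at most t / 2 to any average.\<close>
    have le: "wavg \<mu> h j x \<le> wavg \<mu> ?h j x + ennreal (t / 2)" for j x
    proof -
      have c: "cube j x \<in> sets \<mu>" by (simp add: s)
      have "(\<integral>\<^sup>+y\<in>cube j x. h y \<partial>\<mu>) \<le> (\<integral>\<^sup>+y. ?h y * indicator (cube j x) y + ennreal (t / 2) * indicator (cube j x) y \<partial>\<mu>)"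
        by (intro nn_integral_mono) (auto split: split_indicator)
      also have "\<dots> = (\<integral>\<^sup>+y\<in>cube j x. ?h y \<partial>\<mu>) + (\<integral>\<^sup>+y. ennreal (t / 2) * indicator (cube j x) y \<partial>\<mu>)"
        using c hm' by (intro nn_integral_add) auto
      also have "(\<integral>\<^sup>+y. ennreal (t / 2) * indicator (cube j x) y \<partial>\<mu>) = ennreal (t / 2) * emeasure \<mu> (cube j x)"
        using c by (rule nn_integral_cmult_indicator)
      finally have "wavg \<mu> h j x \<le> ((\<integral>\<^sup>+y\<in>cube j x. ?h y \<partial>\<mu>) + ennreal (t / 2) * emeasure \<mu> (cube j x)) / emeasure \<mu> (cube j x)"
        unfolding wavg_def by (rule divide_right_mono_ennreal)
      also have "\<dots> = wavg \<mu> ?h j x + ennreal (t / 2)"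
      proof -
        have "emeasure \<mu> (cube j x) \<noteq> 0" "emeasure \<mu> (cube j x) \<noteq> top"
          using \<mu> unfolding cube_measure_def by (metis less_irrefl, metis less_irrefl infinity_ennreal_def)
        then show ?thesis
          unfolding wavg_def by (simp add: add_divide_distrib_ennreal ennreal_mult_divide_eq)
      qed
      finally show ?thesis .
    qed
    have "ennreal (t / 2) < wmax \<mu> ?h x" if x: "ennreal t < wmax \<mu> h x" for x
    proof -
      obtain j where j: "ennreal t < wavg \<mu> h j x"
        using x unfolding wmax_def less_SUP_iff by auto
      have "\<not> wavg \<mu> ?h j x \<le> ennreal (t / 2)"
      proof
        assume "wavg \<mu> ?h j x \<le> ennreal (t / 2)"
        then have "wavg \<mu> h j x \<le> ennreal (t / 2) + ennreal (t / 2)"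
          using le[of j x] by (meson add_right_mono order_trans)
        also have "\<dots> = ennreal t" using t by (simp flip: ennreal_plus)
        finally show False using j by simp
      qed
      then show ?thesis
        using wavg_le_wmax[of \<mu> ?h j x] by (meson not_le less_le_trans)
    qed
    then have "emeasure \<mu> {x. ennreal t < wmax \<mu> h x} \<le> emeasure \<mu> {x. ennreal (t / 2) < wmax \<mu> ?h x}"
    proof (intro emeasure_mono)
      have "{x \<in> space lebesgue. ennreal (t / 2) < wmax \<mu> ?h x} \<in> sets lebesgue" by measurable
      then show "{x. ennreal (t / 2) < wmax \<mu> ?h x} \<in> sets \<mu>" by (simp add: s)
    qed auto
    also have "\<dots> \<le> ennreal (1 / (t / 2)) * (\<integral>\<^sup>+x. ?h x \<partial>\<mu>)"
      using t by (intro wmax_weak_type[OF \<mu> hm]) auto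
    finally show ?thesis by simp
  qed
  have "(\<integral>\<^sup>+x. ennreal_powr (wmax \<mu> h x) p \<partial>\<mu>)
      = (\<integral>\<^sup>+t. powr_kernel p t * emeasure \<mu> {x. ennreal t < wmax \<mu> h x} \<partial>lborel)"
    using layer_cake[of "wmax \<mu> h" p] p by simp
  also have "\<dots> \<le> (\<integral>\<^sup>+t. ennreal (2 * p / (p - 1)) * (\<integral>\<^sup>+x. powr_kernel (p - 1) t *
      (h x * ?J (x, t)) \<partial>\<mu>) \<partial>lborel)"
  proof (rule nn_integral_mono)
    fix t
    show "powr_kernel p t * emeasure \<mu> {x. ennreal t < wmax \<mu> h x} \<le> ennreal (2 * p / (p - 1)) * (\<integral>\<^sup>+x. powr_kernel (p - 1) t *
      (h x * ?J (x, t)) \<partial>\<mu>)"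
    proof (cases "0 < t")
      case True
      have "powr_kernel p t * emeasure \<mu> {x. ennreal t < wmax \<mu> h x}
          \<le> powr_kernel p t * (ennreal (2 / t) * (\<integral>\<^sup>+x. h x * indicator (?A t) x \<partial>\<mu>))"
        by (intro mult_left_mono weak True) auto
      also have "\<dots> = ennreal (2 * p / (p - 1)) * (powr_kernel (p - 1) t * (\<integral>\<^sup>+x. h x * indicator (?A t) x \<partial>\<mu>))"
        using powr_kernel_shift[OF p True] by (simp flip: mult.assoc)
      also have "powr_kernel (p - 1) t * (\<integral>\<^sup>+x. h x * indicator (?A t) x \<partial>\<mu>)
          = (\<integral>\<^sup>+x. powr_kernel (p - 1) t * (h x * indicator (?A t) x) \<partial>\<mu>)"
        by (rule nn_integral_cmult[symmetric]) measurable
      also have "\<dots> = (\<integral>\<^sup>+x. powr_kernel (p - 1) t *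
          (h x * ?J (x, t)) \<partial>\<mu>)"
        by (intro nn_integral_cong) (auto simp: space_pair_measure split: split_indicator)
      finally show ?thesis .
    qed (simp add: powr_kernel_def)
  qed
  also have "\<dots> = ennreal (2 * p / (p - 1)) * (\<integral>\<^sup>+t. (\<integral>\<^sup>+x. powr_kernel (p - 1) t *
      (h x * ?J (x, t)) \<partial>\<mu>) \<partial>lborel)"
    by (rule nn_integral_cmult) measurable
  also have "(\<integral>\<^sup>+t. (\<integral>\<^sup>+x. powr_kernel (p - 1) t *
      (h x * ?J (x, t)) \<partial>\<mu>) \<partial>lborel)
    = (\<integral>\<^sup>+x. (\<integral>\<^sup>+t. powr_kernel (p - 1) t *
      (h x * ?J (x, t)) \<partial>lborel) \<partial>\<mu>)"
    by (rule L.Fubini') measurable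
  also have "\<dots> = (\<integral>\<^sup>+x. ennreal (2 powr (p - 1)) * ennreal_powr (h x) p \<partial>\<mu>)"
  proof (rule nn_integral_cong)
    fix x
    \<comment> \<open>As a condition on t the cut reads t < 2 h(x), so the layer formula gives the
      inner integral as h (2 h)^(p - 1); this is the origin of the factor 2 powr (p - 1).\<close>
    have "ennreal (t / 2) < a \<longleftrightarrow> ennreal t < 2 * a" for t a
    proof (cases a)
      case (real r)
      have "2 * a = ennreal (2 * r)" using real by (simp add: ennreal_mult)
      then show ?thesis using real by (cases "0 \<le> t") (auto simp: ennreal_less_iff ennreal_neg)
    qed (simp add: ennreal_mult_top)
    then have "(\<integral>\<^sup>+t. powr_kernel (p - 1) t *
        (h x * ?J (x, t)) \<partial>lborel)
      = (\<integral>\<^sup>+t. h x * (powr_kernel (p - 1) t * indicator {t. ennreal t < 2 * h x} t) \<partial>lborel)"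
      by (intro nn_integral_cong) (auto simp: space_pair_measure mult.commute split: split_indicator)
    also have "\<dots> = h x * (\<integral>\<^sup>+t. powr_kernel (p - 1) t * indicator {t. ennreal t < 2 * h x} t \<partial>lborel)"
      by (rule nn_integral_cmult) measurable
    also have "\<dots> = h x * ennreal_powr (2 * h x) (p - 1)"
      using p by (subst powr_layer) auto
    also have "\<dots> = ennreal_powr 2 (p - 1) * (h x * ennreal_powr (h x) (p - 1))"
      using p by (subst ennreal_powr_mult) (auto simp: mult_ac)
    also have "h x * ennreal_powr (h x) (p - 1) = ennreal_powr (h x) p"
      using p by (subst ennreal_powr_add) auto
    also have "ennreal_powr 2 (p - 1) = ennreal (2 powr (p - 1))"
      using ennreal_powr_ennreal[of 2 "p - 1"] by simp
    finally show "(\<integral>\<^sup>+t. powr_kernel (p - 1) t *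
        (h x * ?J (x, t)) \<partial>lborel)
      = ennreal (2 powr (p - 1)) * ennreal_powr (h x) p" .
  qed
  also have "\<dots> = ennreal (2 powr (p - 1)) * (\<integral>\<^sup>+x. ennreal_powr (h x) p \<partial>\<mu>)"
    by (rule nn_integral_cmult) measurable
  also have "ennreal (2 * p / (p - 1)) * (ennreal (2 powr (p - 1)) * (\<integral>\<^sup>+x. ennreal_powr (h x) p \<partial>\<mu>))
      = ennreal (2 * p / (p - 1) * 2 powr (p - 1)) * (\<integral>\<^sup>+x. ennreal_powr (h x) p \<partial>\<mu>)"
    using p by (subst ennreal_mult) (auto simp: mult.assoc)
  finally show ?thesis .
qed

end

section \<open>Muckenhoupt weights\<close>

context dyadic
begin

lemma cube_measure_density:
  fixes v :: "real^'n \<Rightarrow> real"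
  assumes [measurable]: "v \<in> borel_measurable lebesgue"
    and pos: "AE x in lebesgue. 0 < v x"
    and int: "\<And>k x. set_integrable lebesgue (cube k x) v" and nn: "\<And>x. 0 \<le> v x"
  shows "cube_measure (density lebesgue (\<lambda>x. ennreal (v x)))"
    and "emeasure (density lebesgue (\<lambda>x. ennreal (v x))) (cube k x) = ennreal (LINT y:cube k x|lebesgue. v y)"
proof -
  have eq: "emeasure (density lebesgue (\<lambda>x. ennreal (v x))) (cube k x) = ennreal (LINT y:cube k x|lebesgue. v y)" for k x
  proof -
    have "emeasure (density lebesgue (\<lambda>x. ennreal (v x))) (cube k x) = (\<integral>\<^sup>+y. ennreal (indicator (cube k x) y *\<^sub>R v y) \<partial>lebesgue)"
      by (simp add: emeasure_density) (auto intro!: nn_integral_cong split: split_indicator)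
    also have "\<dots> = ennreal (LINT y:cube k x|lebesgue. v y)"
      unfolding set_lebesgue_integral_def
      by (rule nn_integral_eq_integral) (use int nn in \<open>auto simp: set_integrable_def\<close>)
    finally show ?thesis .
  qed
  then show "emeasure (density lebesgue (\<lambda>x. ennreal (v x))) (cube k x) = ennreal (LINT y:cube k x|lebesgue. v y)"
    by simp
  have "emeasure (density lebesgue (\<lambda>x. ennreal (v x))) (cube k x) \<noteq> 0" for k x
  proof
    assume "emeasure (density lebesgue (\<lambda>x. ennreal (v x))) (cube k x) = 0"
    then have "AE y in lebesgue. ennreal (v y) * indicator (cube k x) y = 0"
      by (simp add: emeasure_density nn_integral_0_iff_AE)
    with pos have "AE y in lebesgue. y \<notin> cube k x"
      by eventually_elim (auto split: split_indicator_asm)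
    then have "emeasure lebesgue (cube k x) = 0"
      by (subst (asm) AE_iff_measurable[of "cube k x"]) auto
    then show False
      using vol_pos[of k] by (simp add: emeasure_cube)
  qed
  then show "cube_measure (density lebesgue (\<lambda>x. ennreal (v x)))"
    unfolding cube_measure_def by (auto simp: eq zero_less_iff_neq_zero)
qed

text \<open>Lerner's argument: the unweighted maximal function is dominated by iterating the maximal functions
  of the measures \<open>\<sigma>\<close> and \<open>w\<close>, each of which is bounded on its own \<open>L\<^sup>p\<close> spaces.\<close>

lemma wmax_muckenhoupt_pointwise:
  fixes w s :: "real^'n \<Rightarrow> real" and f :: "real^'n \<Rightarrow> real"
  defines "\<mu> \<equiv> density lebesgue (\<lambda>x. ennreal (w x))" and "\<nu> \<equiv> density lebesgue (\<lambda>x. ennreal (s x))"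
  assumes p: "1 < p" and C: "0 \<le> C"
    and wm [measurable]: "w \<in> borel_measurable lebesgue" and sm [measurable]: "s \<in> borel_measurable lebesgue"
    and fm [measurable]: "f \<in> borel_measurable lebesgue"
    and wp: "AE x in lebesgue. 0 < w x" and sp: "AE x in lebesgue. 0 < s x"
    and nn: "\<And>x. 0 \<le> f x" "\<And>x. 0 \<le> w x" "\<And>x. 0 \<le> s x"
    and \<mu>: "cube_measure \<mu>" and \<nu>: "cube_measure \<nu>"
    and Ap: "\<And>k x. (measure \<mu> (cube k x) / vol k) * (measure \<nu> (cube k x) / vol k) powr (p - 1) \<le> C"
  defines "G \<equiv> \<lambda>x. ennreal_powr (wmax \<nu> (\<lambda>x. ennreal (f x / s x)) x) (p - 1) * ennreal (1 / w x)"
  shows "ennreal_powr (wmax lebesgue f x) p \<le> ennreal_powr (ennreal C * wmax \<mu> G x) (p / (p - 1))"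
proof -
  let ?M = "wmax \<nu> (\<lambda>x. ennreal (f x / s x))"
  have Gm [measurable]: "G \<in> borel_measurable lebesgue"
    unfolding G_def by measurable
  have avg: "wavg lebesgue f k x \<le> ennreal_powr (ennreal C * wmax \<mu> G x) (1 / (p - 1))" for k
  proof -
    define W where "W = measure \<mu> (cube k x)"
    define S where "S = measure \<nu> (cube k x)"
    have fin: "emeasure \<mu> (cube k x) = ennreal W" "emeasure \<nu> (cube k x) = ennreal S" "0 < W" "0 < S"
    proof -
      have *: "emeasure M (cube k x) = ennreal (measure M (cube k x)) \<and> 0 < measure M (cube k x)"
        if "cube_measure M" for M
        using that unfolding cube_measure_def
        by (metis emeasure_eq_ennreal_measure infinity_ennreal_def less_irrefl ennreal_less_zero_iff)
      then show "emeasure \<mu> (cube k x) = ennreal W" "emeasure \<nu> (cube k x) = ennreal S" "0 < W" "0 < S"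
        using \<mu> \<nu> by (auto simp: W_def S_def)
    qed
    \<comment> \<open>The mean of f / s with respect to \<open>\<nu>\<close>, so that the integral
      of f over the cube is A times the \<open>\<nu>\<close>-mass of the cube.\<close>
    define A where "A = wavg \<nu> (\<lambda>x. ennreal (f x / s x)) k x"
    have If: "(\<integral>\<^sup>+y\<in>cube k x. f y \<partial>lebesgue) = A * ennreal S"
    proof -
      have "A * ennreal S = (\<integral>\<^sup>+y\<in>cube k x. ennreal (f y / s y) \<partial>\<nu>)"
        unfolding A_def fin(2)[symmetric] by (rule wavg_times[OF \<nu>])
      also have "\<dots> = (\<integral>\<^sup>+y. ennreal (s y) * (ennreal (f y / s y) * indicator (cube k x) y) \<partial>lebesgue)"
        unfolding \<nu>_def by (rule nn_integral_density) measurable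
      also have "\<dots> = (\<integral>\<^sup>+y\<in>cube k x. f y \<partial>lebesgue)"
      proof (rule nn_integral_cong_AE)
        show "AE y in lebesgue. ennreal (s y) * (ennreal (f y / s y) * indicator (cube k x) y) = ennreal (f y) * indicator (cube k x) y"
          using sp
        proof eventually_elim
          case (elim y)
          then have "ennreal (s y) * ennreal (f y / s y) = ennreal (f y)"
            using nn by (simp flip: ennreal_mult)
          then show ?case by (simp flip: mult.assoc)
        qed
      qed
      finally show ?thesis by simp
    qed
    \<comment> \<open>Throughout the cube A is at most the maximal function of f / s. Its power p -
      1 is integrated against Lebesgue measure, written as the measure \<open>\<mu>\<close> with
      density 1 / w; this turns it into \<open>G\<close>.\<close>
    have IG: "ennreal_powr A (p - 1) * ennreal (vol k) \<le> wavg \<mu> G k x * ennreal W"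
    proof -
      have "ennreal_powr A (p - 1) * ennreal (vol k) = (\<integral>\<^sup>+y\<in>cube k x. ennreal_powr A (p - 1) \<partial>lebesgue)"
        by (simp add: nn_integral_cmult_indicator emeasure_cube)
      also have "\<dots> \<le> (\<integral>\<^sup>+y. ennreal (w y) * (G y * indicator (cube k x) y) \<partial>lebesgue)"
      proof (rule nn_integral_mono_AE)
        show "AE y in lebesgue. ennreal_powr A (p - 1) * indicator (cube k x) y \<le> ennreal (w y) * (G y * indicator (cube k x) y)"
          using wp
        proof eventually_elim
          case (elim y)
          have "ennreal (w y) * ennreal (1 / w y) = 1"
            using elim by (simp flip: ennreal_mult)
          moreover have "ennreal (w y) * G y = ennreal_powr (?M y) (p - 1) * (ennreal (w y) * ennreal (1 / w y))"
            unfolding G_def by (simp only: mult_ac)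
          ultimately have eq: "ennreal (w y) * G y = ennreal_powr (?M y) (p - 1)"
            by simp
          show ?case
          proof (cases "y \<in> cube k x")
            case True
            then have "A \<le> ?M y"
              unfolding A_def wavg_cong_cube[OF True, symmetric] by (intro wavg_le_wmax)
            then show ?thesis
              using True p by (simp add: eq ennreal_powr_mono flip: mult.assoc)
          qed simp
        qed
      qed
      also have "\<dots> = (\<integral>\<^sup>+y\<in>cube k x. G y \<partial>\<mu>)"
        unfolding \<mu>_def by (rule nn_integral_density[symmetric]) measurable
      also have "\<dots> = wavg \<mu> G k x * ennreal W"
        unfolding fin(1)[symmetric] by (rule wavg_times[OF \<mu>, symmetric])
      finally show ?thesis .
    qed
    have "ennreal_powr (wavg lebesgue f k x) (p - 1) \<le> ennreal C * wavg \<mu> G k x"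
    proof -
      have "wavg lebesgue f k x = A * ennreal (S / vol k)"
      proof -
        have "wavg lebesgue f k x = A * (ennreal S / ennreal (vol k))"
          unfolding wavg_def If emeasure_cube by (simp add: ennreal_times_divide)
        then show ?thesis using fin by (simp add: divide_ennreal)
      qed
      then have "ennreal_powr (wavg lebesgue f k x) (p - 1)
          = ennreal_powr A (p - 1) * ennreal ((S / vol k) powr (p - 1))"
        using p fin by (simp add: ennreal_powr_mult)
      also have "\<dots> \<le> ennreal_powr A (p - 1) * ennreal (C * vol k / W)"
      proof (intro mult_left_mono ennreal_leI)
        \<comment> \<open>The A_p condition is used here: it trades the power of the conjugate mass
          S for the inverse of the mass W, which the average of \<open>G\<close> then
          cancels.\<close>
        have "(W / vol k) * (S / vol k) powr (p - 1) \<le> C"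
          using Ap[of k x] by (simp add: W_def S_def)
        then show "(S / vol k) powr (p - 1) \<le> C * vol k / W"
          using fin(3) vol_pos[of k] by (simp add: field_simps del: vol_pos)
      qed simp
      also have "\<dots> = ennreal (C / W) * (ennreal_powr A (p - 1) * ennreal (vol k))"
      proof -
        have "ennreal (C * vol k / W) = ennreal (C / W) * ennreal (vol k)"
          using C fin(3) by (subst ennreal_mult[symmetric]) auto
        then show ?thesis by (simp add: mult_ac)
      qed
      also have "\<dots> \<le> ennreal (C / W) * (wavg \<mu> G k x * ennreal W)"
        by (intro mult_left_mono IG) simp
      also have "\<dots> = ennreal (C / W * W) * wavg \<mu> G k x"
        using C fin(3) by (subst ennreal_mult) (auto simp: mult_ac)
      finally show ?thesis
        using fin(3) by simp
    qed
    also have "\<dots> \<le> ennreal C * wmax \<mu> G x"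
      by (intro mult_left_mono wavg_le_wmax) simp
    finally have "ennreal_powr (ennreal_powr (wavg lebesgue f k x) (p - 1)) (1 / (p - 1))
        \<le> ennreal_powr (ennreal C * wmax \<mu> G x) (1 / (p - 1))"
      using p by (intro ennreal_powr_mono) auto
    then show ?thesis
      using p by (simp add: ennreal_powr_powr)
  qed
  have "ennreal_powr (wmax lebesgue f x) p \<le> ennreal_powr (ennreal_powr (ennreal C * wmax \<mu> G x) (1 / (p - 1))) p"
    using p avg by (intro ennreal_powr_mono) (auto simp: wmax_def intro!: SUP_least)
  then show ?thesis
    using p by (simp add: ennreal_powr_powr)
qed

section \<open>Maximal inequality and measure comparison for dyadic A_p weights\<close>

lemma cube_in_dyadic_cubes [simp]: "cube k x \<in> dyadic_cubes D"
  unfolding dyadic_cubes_def by blast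

lemma dyadic_A_pD:
  assumes w: "w \<in> dyadic_A_p D p"
  shows A_p_measurable: "w \<in> borel_measurable lebesgue"
    and A_p_nonneg: "0 \<le> w x"
    and A_p_pos: "AE x in lebesgue. 0 < w x"
    and A_p_cube_measure: "cube_measure (weighted_measure w)"
proof -
  have int: "set_integrable lebesgue (cube k x) w" for k x
    using w cube_in_dyadic_cubes[of k x] unfolding dyadic_A_p_def by blast
  show nn: "0 \<le> w x" for x
    using w by (auto simp: dyadic_A_p_def)
  show pos: "AE x in lebesgue. 0 < w x"
    using w by (auto simp: dyadic_A_p_def)
  show m: "w \<in> borel_measurable lebesgue"
  proof -
    \<comment> \<open>Integrability on compact sets makes the restrictions of w to balls measurable,
      and w is their pointwise limit.\<close>
    have B: "(\<lambda>x. indicator (ball 0 (real i)) x *\<^sub>R w x) \<in> borel_measurable lebesgue" for i :: nat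
    proof -
      have "set_integrable lebesgue (cball 0 (real i)) w"
        using w compact_cball by (auto simp: dyadic_A_p_def)
      then have "set_integrable lebesgue (ball 0 (real i)) w"
        by (rule set_integrable_subset) auto
      then show ?thesis by (simp add: set_integrable_def)
    qed
    show ?thesis
    proof (rule borel_measurable_LIMSEQ_metric[OF B])
      fix x :: "real^'n"
      obtain n :: nat where "norm x < real n" using reals_Archimedean2 by blast
      then have "indicator (ball 0 (real i)) x *\<^sub>R w x = w x" if "n \<le> i" for i
        using that by (auto simp: indicator_def)
      then have "\<forall>\<^sub>F i in sequentially. indicator (ball 0 (real i)) x *\<^sub>R w x = w x"
        unfolding eventually_sequentially by blast
      then show "(\<lambda>i. indicator (ball 0 (real i)) x *\<^sub>R w x) \<longlonglongrightarrow> w x"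
        by (rule tendsto_eventually)
    qed
  qed
  show "cube_measure (weighted_measure w)"
    unfolding weighted_measure_def using cube_measure_density(1)[OF m pos int nn] .
qed

text \<open>Muckenhoupt's theorem. After the pointwise bound, the outer maximal function is
  estimated in L^q of w and the inner one in L^p of the conjugate weight s, where q is conjugate to
  p.\<close>

lemma muckenhoupt:
  assumes w: "w \<in> dyadic_A_p D p" and p: "1 < p"
  obtains C where "0 \<le> C" "\<And>f. f \<in> borel_measurable lebesgue \<Longrightarrow> (\<And>x. 0 \<le> f x) \<Longrightarrow>
    (\<integral>\<^sup>+x. ennreal_powr (wmax lebesgue (\<lambda>x. ennreal (f x)) x) p \<partial>weighted_measure w)
      \<le> ennreal C * (\<integral>\<^sup>+x. ennreal (f x powr p) \<partial>weighted_measure w)"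
proof -
  define s where "s = (\<lambda>x. w x powr (1 - p / (p - 1)))"
  define \<nu> where "\<nu> = density lebesgue (\<lambda>x. ennreal (s x))"
  let ?\<mu> = "weighted_measure w"
  have \<mu>_def: "?\<mu> = density lebesgue (\<lambda>x. ennreal (w x))" by (simp add: weighted_measure_def)
  note wm [measurable] = A_p_measurable[OF w]
  note pos = A_p_pos[OF w] and nn = A_p_nonneg[OF w] and \<mu> = A_p_cube_measure[OF w]
  have sm [measurable]: "s \<in> borel_measurable lebesgue" unfolding s_def by measurable
  have sp: "AE x in lebesgue. 0 < s x"
    using pos by eventually_elim (simp add: s_def)
  have snn: "0 \<le> s x" for x by (simp add: s_def)
  have int: "set_integrable lebesgue (cube k x) w" "set_integrable lebesgue (cube k x) s" for k x
    using w cube_in_dyadic_cubes[of k x] unfolding s_def dyadic_A_p_def by blast+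
  have \<nu>: "cube_measure \<nu>"
    unfolding \<nu>_def using cube_measure_density(1)[OF sm sp int(2) snn] .
  obtain C where C: "\<And>Q. Q \<in> dyadic_cubes D \<Longrightarrow>
        (1 / measure lebesgue Q * (LINT x:Q|lebesgue. w x)) *
        (1 / measure lebesgue Q * (LINT x:Q|lebesgue. s x)) powr (p - 1) \<le> C"
    using w unfolding dyadic_A_p_def s_def by blast
  have nnint: "0 \<le> (LINT x:Q|lebesgue. w x)" "0 \<le> (LINT x:Q|lebesgue. s x)" for Q
    unfolding set_lebesgue_integral_def using nn snn by (auto intro!: integral_nonneg_AE)
  have meas: "measure ?\<mu> (cube k x) = (LINT y:cube k x|lebesgue. w y)" "measure \<nu> (cube k x) = (LINT y:cube k x|lebesgue. s y)" for k x
    unfolding measure_def \<mu>_def \<nu>_def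
    by (simp_all add: cube_measure_density(2)[OF wm pos int(1) nn] cube_measure_density(2)[OF sm sp int(2) snn] nnint)
  define C0 where "C0 = max C 0"
  have C0: "0 \<le> C0" by (simp add: C0_def)
  have Ap: "(measure ?\<mu> (cube k x) / vol k) * (measure \<nu> (cube k x) / vol k) powr (p - 1) \<le> C0" for k x
    using C[of "cube k x"] by (auto simp: meas measure_cube C0_def)
  define q where "q = p / (p - 1)"
  have q: "1 < q" using p by (simp add: q_def)
  \<comment> \<open>Since w^(1 - q) = s, the L^q norm of \<open>G\<close> over w becomes an L^p norm
    over s; the exponent matches because (p - 1) q = p.\<close>
  have wsq: "ennreal (w x) * ennreal_powr (ennreal (1 / w x)) q = ennreal (s x)" if "0 < w x" for x
  proof -
    have "w x * (1 / w x) powr q = s x"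
      using that unfolding s_def q_def[symmetric] by (simp add: powr_diff powr_divide)
    then show ?thesis using that by (simp flip: ennreal_mult)
  qed
  \<comment> \<open>Since s^(1 - p) = w, the L^p norm of f / s over s is the norm of f over
    w.\<close>
  have sfp: "ennreal (s x) * ennreal_powr (ennreal (y / s x)) p = ennreal (w x) * ennreal (y powr p)"
    if "0 < w x" "0 \<le> y" for x y
  proof -
    have s0: "0 < s x" using that by (simp add: s_def)
    have "s x powr (1 - p) = w x"
    proof -
      have "(1 - p / (p - 1)) * (1 - p) = 1" using p by (simp add: field_simps)
      then show ?thesis using that by (simp add: s_def powr_powr)
    qed
    then have "s x * (y / s x) powr p = w x * y powr p"
      using that s0 by (simp add: powr_divide powr_diff field_simps)
    then show ?thesis using that s0 by (simp flip: ennreal_mult)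
  qed
  \<comment> \<open>The A_p constant raised to q, times the two strong-type constants: exponent q
    for w and exponent p for s.\<close>
  define K where "K = C0 powr q * ((2 * q / (q - 1) * 2 powr (q - 1)) * (2 * p / (p - 1) * 2 powr (p - 1)))"
  show ?thesis
  proof (rule that[of K])
    show "0 \<le> K" using p q by (simp add: K_def)
    fix f :: "real^'n \<Rightarrow> real" assume fm [measurable]: "f \<in> borel_measurable lebesgue" and f: "\<And>x. 0 \<le> f x"
    let ?M = "wmax \<nu> (\<lambda>x. ennreal (f x / s x))"
    define G where "G = (\<lambda>x. ennreal_powr (?M x) (p - 1) * ennreal (1 / w x))"
    have Gm [measurable]: "G \<in> borel_measurable lebesgue" unfolding G_def by measurable
    have "(\<integral>\<^sup>+x. ennreal_powr (wmax lebesgue (\<lambda>x. ennreal (f x)) x) p \<partial>?\<mu>)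
      \<le> (\<integral>\<^sup>+x. ennreal (C0 powr q) * ennreal_powr (wmax ?\<mu> G x) q \<partial>?\<mu>)"
    proof (rule nn_integral_mono)
      fix x
      have "ennreal_powr (wmax lebesgue (\<lambda>x. ennreal (f x)) x) p \<le> ennreal_powr (ennreal C0 * wmax ?\<mu> G x) q"
        unfolding q_def G_def \<mu>_def \<nu>_def
        by (rule wmax_muckenhoupt_pointwise[OF p C0 wm sm fm pos sp f nn snn])
           (use \<mu> \<nu> Ap in \<open>simp_all add: \<mu>_def \<nu>_def\<close>)
      then show "ennreal_powr (wmax lebesgue (\<lambda>x. ennreal (f x)) x) p
          \<le> ennreal (C0 powr q) * ennreal_powr (wmax ?\<mu> G x) q"
        using q C0 by (simp add: ennreal_powr_mult)
    qed
    also have "\<dots> = ennreal (C0 powr q) * (\<integral>\<^sup>+x. ennreal_powr (wmax ?\<mu> G x) q \<partial>?\<mu>)"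
      by (rule nn_integral_cmult) (simp add: \<mu>_def)
    also have "(\<integral>\<^sup>+x. ennreal_powr (wmax ?\<mu> G x) q \<partial>?\<mu>) \<le>
        ennreal (2 * q / (q - 1) * 2 powr (q - 1)) * (\<integral>\<^sup>+x. ennreal_powr (G x) q \<partial>?\<mu>)"
      by (rule wmax_strong_type[OF \<mu> q Gm])
    also have "(\<integral>\<^sup>+x. ennreal_powr (G x) q \<partial>?\<mu>) = (\<integral>\<^sup>+x. ennreal (w x) * ennreal_powr (G x) q \<partial>lebesgue)"
      unfolding \<mu>_def by (rule nn_integral_density) measurable
    also have "\<dots> = (\<integral>\<^sup>+x. ennreal (s x) * ennreal_powr (?M x) p \<partial>lebesgue)"
    proof (rule nn_integral_cong_AE)
      show "AE x in lebesgue. ennreal (w x) * ennreal_powr (G x) q = ennreal (s x) * ennreal_powr (?M x) p"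
        using pos
      proof eventually_elim
        case (elim x)
        have "(p - 1) * q = p" using p by (simp add: q_def)
        then have "ennreal_powr (G x) q = ennreal_powr (?M x) p * ennreal_powr (ennreal (1 / w x)) q"
          unfolding G_def using q by (simp add: ennreal_powr_mult ennreal_powr_powr)
        then show ?case
          unfolding wsq[OF elim, symmetric] by (simp add: mult_ac)
      qed
    qed
    also have "\<dots> = (\<integral>\<^sup>+x. ennreal_powr (?M x) p \<partial>\<nu>)"
      unfolding \<nu>_def by (rule nn_integral_density[symmetric]) measurable
    also have "\<dots> \<le> ennreal (2 * p / (p - 1) * 2 powr (p - 1)) * (\<integral>\<^sup>+x. ennreal_powr (ennreal (f x / s x)) p \<partial>\<nu>)"
      by (rule wmax_strong_type[OF \<nu> p]) measurable
    also have "(\<integral>\<^sup>+x. ennreal_powr (ennreal (f x / s x)) p \<partial>\<nu>) = (\<integral>\<^sup>+x. ennreal (s x) * ennreal_powr (ennreal (f x / s x)) p \<partial>lebesgue)"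
      unfolding \<nu>_def by (rule nn_integral_density) measurable
    also have "\<dots> = (\<integral>\<^sup>+x. ennreal (w x) * ennreal (f x powr p) \<partial>lebesgue)"
      using pos by (intro nn_integral_cong_AE) (auto elim!: eventually_mono simp: sfp f)
    also have "\<dots> = (\<integral>\<^sup>+x. ennreal (f x powr p) \<partial>?\<mu>)"
      unfolding \<mu>_def by (rule nn_integral_density[symmetric]) measurable
    finally have *: "(\<integral>\<^sup>+x. ennreal_powr (wmax lebesgue (\<lambda>x. ennreal (f x)) x) p \<partial>?\<mu>)
      \<le> ennreal (C0 powr q) * (ennreal (2 * q / (q - 1) * 2 powr (q - 1)) *
         (ennreal (2 * p / (p - 1) * 2 powr (p - 1)) * (\<integral>\<^sup>+x. ennreal (f x powr p) \<partial>?\<mu>)))"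
      by (simp add: mult_left_mono)
    have "ennreal K = ennreal (C0 powr q) * (ennreal (2 * q / (q - 1) * 2 powr (q - 1)) * ennreal (2 * p / (p - 1) * 2 powr (p - 1)))"
    proof -
      have "0 \<le> 2 * q / (q - 1) * 2 powr (q - 1)" "0 \<le> 2 * p / (p - 1) * 2 powr (p - 1)"
        using p q by auto
      then show ?thesis unfolding K_def by (simp only: ennreal_mult mult_nonneg_nonneg powr_ge_zero)
    qed
    then show "(\<integral>\<^sup>+x. ennreal_powr (wmax lebesgue (\<lambda>x. ennreal (f x)) x) p \<partial>?\<mu>)
      \<le> ennreal K * (\<integral>\<^sup>+x. ennreal (f x powr p) \<partial>?\<mu>)"
      using * by (simp only: mult.assoc)
  qed
qed

text \<open>The \<open>A\<^sub>\<infinity>\<close> property of \<open>w\<close>, obtained by testing the maximal function on indicators.\<close>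

lemma A_p_half_subset:
  assumes w: "w \<in> dyadic_A_p D p" and p: "1 < p"
  obtains \<delta> where "0 < \<delta>" "\<delta> < 1" "\<And>k x E. E \<in> sets lebesgue \<Longrightarrow> E \<subseteq> cube k x \<Longrightarrow>
    emeasure lebesgue E \<le> ennreal (vol k / 2) \<Longrightarrow>
    emeasure (weighted_measure w) E \<le> ennreal (1 - \<delta>) * emeasure (weighted_measure w) (cube k x)"
proof -
  let ?\<mu> = "weighted_measure w"
  have \<mu>: "cube_measure ?\<mu>" by (rule A_p_cube_measure[OF w])
  have s: "sets ?\<mu> = sets lebesgue" by (simp add: weighted_measure_def)
  obtain C where C: "0 \<le> C" "\<And>f. f \<in> borel_measurable lebesgue \<Longrightarrow> (\<And>x. 0 \<le> f x) \<Longrightarrow>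
    (\<integral>\<^sup>+x. ennreal_powr (wmax lebesgue (\<lambda>x. ennreal (f x)) x) p \<partial>?\<mu>) \<le> ennreal C * (\<integral>\<^sup>+x. ennreal (f x powr p) \<partial>?\<mu>)"
    using muckenhoupt[OF w p] by blast
  \<comment> \<open>Testing on the indicator of F, the rest of the cube, gives (1/2)^p w(Q) \<le> C
    w(F), so F carries at least the fraction \<delta> of the weight. Using C + 1 in place of C
    ensures a nonzero denominator and \<delta> < 1.\<close>
  define \<delta> where "\<delta> = (1 / 2) powr p / (C + 1)"
  have \<delta>0: "0 < \<delta>" using C by (simp add: \<delta>_def)
  have "(1 / 2) powr p < (1 / 2::real) powr 0" using p by (intro powr_less_mono') auto
  then have \<delta>1: "\<delta> < 1" using C by (simp add: \<delta>_def field_simps)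
  show ?thesis
  proof (rule that[OF \<delta>0 \<delta>1])
    fix k x E assume E [measurable]: "E \<in> sets lebesgue" and sub: "E \<subseteq> cube k x" and half: "emeasure lebesgue E \<le> ennreal (vol k / 2)"
    define F where "F = cube k x - E"
    have F [measurable]: "F \<in> sets lebesgue" by (simp add: F_def)
    have EF: "E \<union> F = cube k x" "E \<inter> F = {}" using sub by (auto simp: F_def)
    have F\<mu>: "F \<in> sets ?\<mu>" "E \<in> sets ?\<mu>" using E F s by auto
    let ?f = "\<lambda>y. indicator F y :: real"
    let ?W = "wmax lebesgue (\<lambda>x. ennreal (?f x))"
    \<comment> \<open>F fills at least half of the cube, so the maximal function of its indicator is
      at least 1/2 on the whole cube, including E.\<close>
    have avg: "ennreal (1 / 2) \<le> wavg lebesgue (\<lambda>x. ennreal (?f x)) k x"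
    proof (rule le_wavgI[OF cube_measure_lebesgue])
      have "ennreal (vol k) = emeasure lebesgue E + emeasure lebesgue F"
        unfolding emeasure_cube[of k x, symmetric] EF(1)[symmetric]
        by (rule plus_emeasure[symmetric, OF E F EF(2)])
      also have "\<dots> \<le> ennreal (vol k / 2) + emeasure lebesgue F"
        by (intro add_right_mono half)
      finally have le: "ennreal (vol k / 2) + ennreal (vol k / 2) \<le> ennreal (vol k / 2) + emeasure lebesgue F"
        by (simp flip: ennreal_plus)
      have "ennreal (1 / 2) * emeasure lebesgue (cube k x) = ennreal (vol k / 2)"
        unfolding emeasure_cube by (subst ennreal_mult[symmetric]) auto
      also have "\<dots> \<le> emeasure lebesgue F"
        using le by (subst (asm) ennreal_add_left_cancel_le) auto
      also have "\<dots> = (\<integral>\<^sup>+y. indicator F y \<partial>lebesgue)" by simp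
      also have "\<dots> = (\<integral>\<^sup>+y\<in>cube k x. ennreal (?f y) \<partial>lebesgue)"
        by (intro nn_integral_cong) (auto simp: F_def split: split_indicator)
      finally show "ennreal (1 / 2) * emeasure lebesgue (cube k x) \<le> (\<integral>\<^sup>+y\<in>cube k x. ennreal (?f y) \<partial>lebesgue)" .
    qed
    have "ennreal ((1 / 2) powr p) * emeasure ?\<mu> (cube k x) = (\<integral>\<^sup>+y. ennreal ((1 / 2) powr p) * indicator (cube k x) y \<partial>?\<mu>)"
      using s by (intro nn_integral_cmult_indicator[symmetric]) simp
    also have "\<dots> \<le> (\<integral>\<^sup>+y. ennreal_powr (?W y) p \<partial>?\<mu>)"
    proof (rule nn_integral_mono)
      fix y
      have "ennreal ((1 / 2) powr p) \<le> ennreal_powr (?W y) p" if y: "y \<in> cube k x"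
      proof -
        have "ennreal (1 / 2) \<le> ?W y"
          using avg wavg_cong_cube[OF y] wavg_le_wmax by (metis order_trans)
        then have "ennreal_powr (ennreal (1 / 2)) p \<le> ennreal_powr (?W y) p"
          using p by (intro ennreal_powr_mono) auto
        then show ?thesis by (subst (asm) ennreal_powr_ennreal) auto
      qed
      then show "ennreal ((1 / 2) powr p) * indicator (cube k x) y \<le> ennreal_powr (?W y) p"
        by (auto split: split_indicator)
    qed
    also have "\<dots> \<le> ennreal C * (\<integral>\<^sup>+y. ennreal (?f y powr p) \<partial>?\<mu>)"
      by (rule C(2)) auto
    also have "(\<integral>\<^sup>+y. ennreal (?f y powr p) \<partial>?\<mu>) = (\<integral>\<^sup>+y. indicator F y \<partial>?\<mu>)"
      by (intro nn_integral_cong) (auto split: split_indicator)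
    also have "\<dots> = emeasure ?\<mu> F" using F\<mu> by simp
    finally have le: "ennreal ((1 / 2) powr p) * emeasure ?\<mu> (cube k x) \<le> ennreal C * emeasure ?\<mu> F" .
    define W where "W = measure ?\<mu> (cube k x)"
    have W: "emeasure ?\<mu> (cube k x) = ennreal W" "0 \<le> W"
      using \<mu> unfolding cube_measure_def W_def
      by (metis emeasure_eq_ennreal_measure infinity_ennreal_def less_irrefl, simp)
    have add: "emeasure ?\<mu> E + emeasure ?\<mu> F = ennreal W"
      using EF F\<mu> W(1) by (simp add: plus_emeasure)
    obtain e where e: "emeasure ?\<mu> E = ennreal e" "0 \<le> e"
      using add by (cases "emeasure ?\<mu> E") (auto simp: ennreal_top_neq_one)
    obtain g where g: "emeasure ?\<mu> F = ennreal g" "0 \<le> g"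
      using add by (cases "emeasure ?\<mu> F") auto
    have "e + g = W"
      using add e g W by (simp flip: ennreal_plus)
    moreover have "(1 / 2) powr p * W \<le> C * g"
      using le g W C by (simp flip: ennreal_mult)
    then have "\<delta> * W \<le> g"
    proof -
      have "(1 / 2) powr p * W \<le> (C + 1) * g"
        using \<open>(1 / 2) powr p * W \<le> C * g\<close> g by (simp add: distrib_right)
      then show ?thesis
        using C by (simp add: \<delta>_def field_simps)
    qed
    ultimately have "e \<le> (1 - \<delta>) * W" by (simp add: algebra_simps)
    then show "emeasure ?\<mu> E \<le> ennreal (1 - \<delta>) * emeasure ?\<mu> (cube k x)"
      using e W \<delta>1 by (simp flip: ennreal_mult)
  qed
qed

end

section \<open>The Rademacher maximal function\<close>

lemma ennreal_powr_SUP_le: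
  assumes p: "0 < p" and le: "\<And>i. ennreal_powr (F i) p \<le> c"
  shows "ennreal_powr (SUP i. F i) p \<le> c"
proof -
  have "F i \<le> ennreal_powr c (1 / p)" for i
    using ennreal_powr_mono[OF le, of "1 / p" i] p by (simp add: ennreal_powr_powr)
  then have "ennreal_powr (SUP i. F i) p \<le> ennreal_powr (ennreal_powr c (1 / p)) p"
    using p by (intro ennreal_powr_mono SUP_least) auto
  then show ?thesis
    using p by (simp add: ennreal_powr_powr)
qed

lemma emeasure_chebyshev:
  fixes G :: "'a \<Rightarrow> ennreal"
  assumes A: "A \<in> sets M" and le: "\<And>x. x \<in> A \<Longrightarrow> ennreal c \<le> G x" and c: "0 \<le> c" and p: "0 < p"
  shows "ennreal (c powr p) * emeasure M A \<le> (\<integral>\<^sup>+x. ennreal_powr (G x) p \<partial>M)"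
proof -
  have "ennreal (c powr p) * emeasure M A = (\<integral>\<^sup>+x. ennreal (c powr p) * indicator A x \<partial>M)"
    using A by (simp add: nn_integral_cmult_indicator)
  also have "\<dots> \<le> (\<integral>\<^sup>+x. ennreal_powr (G x) p \<partial>M)"
  proof (rule nn_integral_mono)
    fix x
    show "ennreal (c powr p) * indicator A x \<le> ennreal_powr (G x) p"
      using ennreal_powr_mono[OF le, of x p] p c by (auto split: split_indicator)
  qed
  finally show ?thesis .
qed

locale rademacher = dyadic D + scaling smul
  for D :: "int \<Rightarrow> (real^'n) set set"
    and smul :: "'k::{real_normed_field,real_inner} \<Rightarrow> 'x::banach \<Rightarrow> 'x"
begin

text \<open>A truncation to levels k, ..., m depends on x through \<open>cube m x\<close> only,
  hence is measurable. The empty range m = k - 1 is allowed and gives 0; it occurs for stopping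
  cubes of the coarsest level.\<close>

definition Rm :: "(real^'n \<Rightarrow> 'x) \<Rightarrow> int \<Rightarrow> int \<Rightarrow> real^'n \<Rightarrow> ennreal" where
  "Rm f k m x = R_bound smul ((\<lambda>j. average f (cube j x)) ` {k..m})"

lemma level_const_Rm: "level_const m (Rm f k m)"
  unfolding level_const_def
proof (intro allI impI)
  fix x y assume "y \<in> cube m x"
  then have "(\<lambda>j. average f (cube j y)) ` {k..m} = (\<lambda>j. average f (cube j x)) ` {k..m}"
    by (intro image_cong) (auto simp: cube_eq_le)
  then show "Rm f k m y = Rm f k m x"
    by (simp add: Rm_def)
qed

lemma Rm_measurable [measurable]: "Rm f k m \<in> borel_measurable lebesgue"
  by (rule level_const_measurable[OF level_const_Rm]) auto

lemma Rm_sets [measurable]: "{x. ennreal t < Rm f k m x} \<in> sets lebesgue"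
proof -
  have "{x \<in> space lebesgue. ennreal t < Rm f k m x} \<in> sets lebesgue" by measurable
  then show ?thesis by simp
qed

lemma Rm_cong:
  assumes "\<And>j. k \<le> j \<Longrightarrow> j \<le> m \<Longrightarrow> average f (cube j x) = average g (cube j x)"
  shows "Rm f k m x = Rm g k m x"
proof -
  have "(\<lambda>j. average f (cube j x)) ` {k..m} = (\<lambda>j. average g (cube j x)) ` {k..m}"
    using assms by (intro image_cong) auto
  then show ?thesis by (simp add: Rm_def)
qed

lemma Rm_mono: "k' \<le> k \<Longrightarrow> m \<le> m' \<Longrightarrow> Rm f k m x \<le> Rm f k' m' x"
  unfolding Rm_def by (intro R_bound_mono image_mono) auto

lemma Rm_le_sum:
  "Rm f k m x \<le> (\<Sum>j\<in>{k..m}. ennreal (norm (average f (cube j x))))"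
  unfolding Rm_def by (rule R_bound_finite) simp

lemma Rm_split:
  assumes "k \<le> m" "m \<le> N"
  shows "Rm f k N x \<le> Rm f k (m - 1) x + Rm f m N x"
proof -
  have "{k..N} = {k..m - 1} \<union> {m..N}" using assms by auto
  then show ?thesis
    unfolding Rm_def using R_bound_Un by (metis image_Un)
qed

lemma rademacher_maximal_eq:
  "rademacher_maximal smul D f x = R_bound smul (range (\<lambda>j. average f (cube j x)))"
proof -
  have "{average f Q | Q. Q \<in> dyadic_cubes D \<and> x \<in> Q} = range (\<lambda>j. average f (cube j x))"
  proof (intro equalityI subsetI)
    fix a assume "a \<in> {average f Q | Q. Q \<in> dyadic_cubes D \<and> x \<in> Q}"
    then obtain Q k where "a = average f Q" "Q \<in> D k" "x \<in> Q"
      by (auto simp: dyadic_cubes_def)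
    then show "a \<in> range (\<lambda>j. average f (cube j x))"
      using cube_eqI[of Q k x] by auto
  next
    fix a assume "a \<in> range (\<lambda>j. average f (cube j x))"
    then obtain j where "a = average f (cube j x)" by auto
    then show "a \<in> {average f Q | Q. Q \<in> dyadic_cubes D \<and> x \<in> Q}"
      by (intro CollectI exI[of _ "cube j x"]) simp
  qed
  then show ?thesis by (simp add: rademacher_maximal_def)
qed

lemma Rm_le_maximal: "Rm f k m x \<le> rademacher_maximal smul D f x"
  unfolding Rm_def rademacher_maximal_eq by (rule R_bound_mono) auto

lemma Rm_incseq: "incseq (\<lambda>i. Rm f (- int i) (int i) x)"
  by (intro incseq_SucI Rm_mono) auto

text \<open>Reduces measurability and all bounds to truncations, by monotone limits.\<close>

lemma rademacher_maximal_SUP: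
  "rademacher_maximal smul D f x = (SUP i. Rm f (- int i) (int i) x)"
proof -
  have "j \<in> {- int (nat \<bar>j\<bar>)..int (nat \<bar>j\<bar>)}" for j by auto
  then have "range (\<lambda>j. average f (cube j x)) = (\<Union>i. (\<lambda>j. average f (cube j x)) ` {- int i..int i})"
    by blast
  moreover have "incseq (\<lambda>i. (\<lambda>j. average f (cube j x)) ` {- int i..int i})"
    by (intro incseq_SucI image_mono) auto
  ultimately show ?thesis
    unfolding rademacher_maximal_eq Rm_def by (simp add: R_bound_Union_incseq)
qed

lemma rademacher_maximal_measurable [measurable]:
  "rademacher_maximal smul D f \<in> borel_measurable lebesgue"
  unfolding rademacher_maximal_SUP[abs_def] by measurable

lemma rademacher_maximal_sets: "{x. ennreal t < rademacher_maximal smul D f x} \<in> sets lebesgue"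
proof -
  have "{x \<in> space lebesgue. ennreal t < rademacher_maximal smul D f x} \<in> sets lebesgue" by measurable
  then show ?thesis by simp
qed

lemma emeasure_rademacher_maximal_le:
  assumes "\<And>i. emeasure lebesgue {x. ennreal t < Rm f (- int i) (int i) x} \<le> c"
  shows "emeasure lebesgue {x. ennreal t < rademacher_maximal smul D f x} \<le> c"
proof -
  have inc: "incseq (\<lambda>i. {x. ennreal t < Rm f (- int i) (int i) x})"
    using Rm_incseq[of f] unfolding incseq_def by (auto intro: less_le_trans)
  have eq: "{x. ennreal t < rademacher_maximal smul D f x} = (\<Union>i. {x. ennreal t < Rm f (- int i) (int i) x})"
    by (auto simp: rademacher_maximal_SUP less_SUP_iff)
  show ?thesis
    unfolding eq by (rule emeasure_UN_incseq_le[OF Rm_sets inc assms])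
qed

section \<open>The local estimate on a cube\<close>

lemma loc_int_L1:
  assumes "f \<in> Lp lebesgue 1"
  shows "loc_int f"
  unfolding loc_int_def
proof (intro conjI allI)
  show "strongly_measurable lebesgue f" using assms by (simp add: Lp_def)
  fix k x
  have "(\<integral>\<^sup>+y\<in>cube k x. ennreal (norm (f y)) \<partial>lebesgue) \<le> (\<integral>\<^sup>+y. ennreal (norm (f y)) \<partial>lebesgue)"
    by (intro nn_integral_mono) (auto split: split_indicator)
  also have "\<dots> < \<infinity>" using assms by (simp add: Lp_def)
  finally show "(\<integral>\<^sup>+y\<in>cube k x. ennreal (norm (f y)) \<partial>lebesgue) < \<infinity>" .
qed

lemma nn_integral_cube_bound:
  fixes u :: "real^'n \<Rightarrow> real"
  assumes "\<And>y. y \<in> cube k x \<Longrightarrow> u y \<le> b" "\<And>y. y \<notin> cube k x \<Longrightarrow> u y = 0" "0 \<le> b"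
  shows "(\<integral>\<^sup>+y. ennreal (u y) \<partial>lebesgue) \<le> ennreal (b * vol k)"
proof -
  have "(\<integral>\<^sup>+y. ennreal (u y) \<partial>lebesgue) \<le> (\<integral>\<^sup>+y. ennreal b * indicator (cube k x) y \<partial>lebesgue)"
    using assms by (intro nn_integral_mono) (auto split: split_indicator intro!: ennreal_leI)
  also have "\<dots> = ennreal (b * vol k)"
    using assms(3) by (simp add: nn_integral_cmult_indicator emeasure_cube ennreal_mult)
  finally show ?thesis .
qed

lemma norm_avg_bounded:
  fixes f :: "real^'n \<Rightarrow> 'x"
  assumes f: "loc_int f" and le: "\<And>y. y \<in> cube k x \<Longrightarrow> norm (f y) \<le> t" and t: "0 \<le> t"
  shows "norm_avg f k x \<le> t"
proof -
  have "ennreal (vol k * norm_avg f k x) \<le> (\<integral>\<^sup>+y. ennreal (norm (f y) * indicator (cube k x) y) \<partial>lebesgue)"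
    unfolding norm_avg_eq[OF f] by (intro nn_integral_mono) (auto split: split_indicator)
  also have "\<dots> \<le> ennreal (t * vol k)"
    using le t by (intro nn_integral_cube_bound[of k x]) auto
  finally have "vol k * norm_avg f k x \<le> t * vol k"
    using t by (subst (asm) ennreal_le_iff) auto
  then show ?thesis
    using vol_pos[of k] by (simp add: mult.commute[of _ "vol k"] del: vol_pos)
qed

text \<open>The local estimate for bounded functions supported in the cube and constant on cubes of
  level N. The exceptional set is held to a quarter, which leaves a quarter for the Calderon-Zygmund
  exceptional set.\<close>

definition bounded_test :: "real \<Rightarrow> bool" where
  "bounded_test K \<longleftrightarrow> 0 < K \<and> (\<forall>t>0. \<forall>k N x0. \<forall>f::real^'n \<Rightarrow> 'x. k \<le> N \<longrightarrow> level_const N f \<longrightarrow>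
     (\<forall>y. norm (f y) \<le> t) \<longrightarrow> (\<forall>y. y \<notin> cube k x0 \<longrightarrow> f y = 0) \<longrightarrow>
     emeasure lebesgue (cube k x0 \<inter> {x. ennreal (K * t) < Rm f k N x}) \<le> ennreal (vol k / 4))"

text \<open>The local estimate itself; one half is the threshold at which
  \<open>A_p_half_subset\<close> applies.\<close>

definition local_weak :: "real \<Rightarrow> bool" where
  "local_weak K \<longleftrightarrow> 0 < K \<and> (\<forall>k N x0. \<forall>f::real^'n \<Rightarrow> 'x. k \<le> N \<longrightarrow> loc_int f \<longrightarrow>
     emeasure lebesgue (cube k x0 \<inter> {x. ennreal (K * norm_avg f k x0) < Rm f k N x}) \<le> ennreal (vol k / 2))"

text \<open>Cancels the positive factor a when m is not yet known to be finite.\<close>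

lemma emeasure_le_real:
  assumes le: "ennreal a * m \<le> ennreal (b * c)" and a: "0 < a" "b \<le> a * d" "0 \<le> c" "0 \<le> d"
  shows "m \<le> ennreal (d * c)"
proof (cases m)
  case (real r)
  have "ennreal (a * r) = ennreal a * m"
    using a real by (simp add: ennreal_mult)
  also note le
  also have "ennreal (b * c) \<le> ennreal (a * d * c)"
    by (intro ennreal_leI mult_right_mono a)
  finally have "a * r \<le> a * (d * c)"
    using a by (subst (asm) ennreal_le_iff) (auto simp: mult.assoc)
  then show ?thesis using a real by (simp add: ennreal_leI)
next
  case top
  then show ?thesis
    using le a(1) by (simp add: ennreal_mult_top top_unique)
qed

text \<open>The cancellation of an atom: integrating over a larger cube adds nothing.\<close>

lemma average_zero_superset:
  fixes f :: "real^'n \<Rightarrow> 'x"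
  assumes f: "loc_int f" and sub: "cube k x0 \<subseteq> cube j x"
    and supp: "\<And>y. y \<notin> cube k x0 \<Longrightarrow> f y = 0" and zero: "average f (cube k x0) = 0"
  shows "average f (cube j x) = 0"
proof (rule average_eqI)
  have "(\<lambda>y. indicator (cube j x) y *\<^sub>R f y) = (\<lambda>y. indicator (cube k x0) y *\<^sub>R f y)"
    using sub supp by (intro ext) (auto simp: indicator_def)
  then show "has_strong_integral lebesgue (\<lambda>y. indicator (cube j x) y *\<^sub>R f y) (vol j *\<^sub>R 0)"
    using loc_int_has_integral[OF f, of k x0] zero by simp
qed

text \<open>Subtracting the mean on the cube turns a bounded function into a multiple of an atom.\<close>

lemma bounded_test_if_H1:
  assumes weak: "rademacher_weak_type smul D (H1 D) (H1_norm D)"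
  shows "\<exists>K. bounded_test K"
proof -
  obtain C where C: "0 \<le> C" "\<And>f t. f \<in> H1 D \<Longrightarrow> 0 < t \<Longrightarrow>
      emeasure lebesgue {x. rademacher_maximal smul D f x > ennreal t} \<le> ennreal (C / t) * H1_norm D f"
    using weak unfolding rademacher_weak_type_def by blast
  \<comment> \<open>Of the threshold K t, one t pays for the mean that was subtracted. The remaining
    (8 C + 1) t makes the weak bound 2 C / (8 C + 1) \<le> 1/4, and the extra 1 keeps the height
    positive when C = 0.\<close>
  define K where "K = 8 * C + 2"
  have "bounded_test K"
    unfolding bounded_test_def
  proof (intro conjI allI impI)
    show "0 < K" using C by (simp add: K_def)
    fix t :: real and k N :: int and x0 and f :: "real^'n \<Rightarrow> 'x"
    assume t: "0 < t" and kN: "k \<le> N" and f: "level_const N f" "\<forall>y. norm (f y) \<le> t" "\<forall>y. y \<notin> cube k x0 \<longrightarrow> f y = 0"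
    let ?Q = "cube k x0"
    define c where "c = average f ?Q"
    define h where "h = (\<lambda>y. indicator ?Q y *\<^sub>R c)"
    define g where "g = (\<lambda>y. f y - h y)"
    have fi: "loc_int f" by (rule level_const_loc_int[OF f(1)])
    have avf: "norm (average f (cube j x)) \<le> t" for j x
      using norm_average_le[OF fi, of j x] norm_avg_bounded[OF fi, of j x t] f t by simp
    have hl: "level_const k h"
      unfolding level_const_def h_def
    proof (intro allI impI)
      fix x y assume y: "y \<in> cube k x"
      have "y \<in> ?Q \<longleftrightarrow> x \<in> ?Q"
        using cube_eq[OF y] cube_eq[of _ k x0] mem_cube by metis
      then show "indicator ?Q y *\<^sub>R c = indicator ?Q x *\<^sub>R c" by (simp add: indicator_def)
    qed
    then have hi: "loc_int h" by (rule level_const_loc_int)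
    have "level_const N g"
      using f(1) level_const_mono[OF hl kN] unfolding level_const_def g_def by metis
    then have gi: "loc_int g" and gs: "strongly_measurable lebesgue g"
      by (auto intro: level_const_loc_int level_const_strongly_measurable)
    have av: "average g (cube j x) = average f (cube j x) - c" if "x \<in> ?Q" "k \<le> j" for j x
    proof -
      have "cube j x \<subseteq> ?Q"
        using cube_mono[OF that(2), of x] cube_eq[OF that(1)] by simp
      then have "average h (cube j x) = c"
        by (intro average_const) (auto simp: h_def)
      then show ?thesis
        unfolding g_def by (simp add: average_diff[OF fi hi])
    qed
    have g0: "g y = 0" if "y \<notin> ?Q" for y
      using that f(3) by (simp add: g_def h_def)
    \<comment> \<open>A cube disjoint from \<open>?Q\<close> sees nothing, a cube containing it sees
      mean zero, and a smaller one sees a difference of two averages of norm at most t. Hence the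
      maximal function of g has no tail outside \<open>?Q\<close>.\<close>
    have avg_bd: "norm (average g (cube j x)) \<le> 2 * t * indicator ?Q x" for j x
    proof (cases "cube j x \<inter> ?Q = {}")
      case True
      then have "average g (cube j x) = 0"
        by (intro average_const g0) auto
      then show ?thesis using t by simp
    next
      case False
      then obtain z where z: "z \<in> cube j x" "z \<in> ?Q" by blast
      show ?thesis
      proof (cases "j \<le> k")
        case True
        have "?Q \<subseteq> cube j x"
          using cube_mono[OF True, of z] cube_eq[OF z(1)] cube_eq[OF z(2)] by simp
        moreover have "average g ?Q = 0"
          using av[of x0 k] by (simp add: c_def)
        ultimately have "average g (cube j x) = 0"
          using average_zero_superset[OF gi, of k x0 j x] g0 by blast
        then show ?thesis using t by simp
      next
        case False
        then have "x \<in> ?Q"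
          using cube_mono[of k j x] cube_eq[of z k x] cube_eq[OF z(2)] z(1) mem_cube[of x k] by auto
        then show ?thesis
          using av[of x j] False avf[of j x] avf[of k x0] norm_triangle_ineq4[of "average f (cube j x)" c]
          by (simp add: c_def)
      qed
    qed
    have dm: "dyadic_maximal D g x \<le> ennreal (2 * t * indicator ?Q x)" for x
      unfolding dyadic_maximal_def
    proof (rule SUP_least)
      fix Q assume "Q \<in> {Q \<in> dyadic_cubes D. x \<in> Q}"
      then obtain j where "Q = cube j x"
        using cube_eqI by (auto simp: dyadic_cubes_def)
      then show "ennreal (norm (average g Q)) \<le> ennreal (2 * t * indicator ?Q x)"
        using avg_bd by (auto intro: ennreal_leI)
    qed
    have H1n: "H1_norm D g \<le> ennreal (2 * t * vol k)"
    proof -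
      have "H1_norm D g \<le> (\<integral>\<^sup>+x. ennreal (2 * t * indicator ?Q x) \<partial>lebesgue)"
        unfolding H1_norm_def by (intro nn_integral_mono dm)
      also have "\<dots> \<le> ennreal (2 * t * vol k)"
        using t by (intro nn_integral_cube_bound[of k x0]) auto
      finally show ?thesis .
    qed
    have gH: "g \<in> H1 D"
    proof -
      have "norm (g y) \<le> 2 * t" for y
        using f(2)[rule_format, of y] avf[of k x0] norm_triangle_ineq4[of "f y" "h y"] t
        by (auto simp: g_def h_def c_def indicator_def split: if_splits)
      then have "(\<integral>\<^sup>+y. ennreal (norm (g y)) \<partial>lebesgue) \<le> ennreal (2 * t * vol k)"
        using t g0 by (intro nn_integral_cube_bound[of k x0]) auto
      then show ?thesis
        unfolding H1_def Lp_def using H1n gs by (auto intro: le_less_trans)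
    qed
    let ?S = "?Q \<inter> {x. ennreal (K * t) < Rm f k N x}"
    have "?S \<subseteq> {x. ennreal ((8 * C + 1) * t) < rademacher_maximal smul D g x}"
    proof safe
      fix x assume x: "x \<in> ?Q" "ennreal (K * t) < Rm f k N x"
      have "Rm f k N x \<le> Rm g k N x + ennreal (norm c)"
        unfolding Rm_def using av[OF x(1)] by (intro R_bound_translate) (auto simp: image_image)
      also have "\<dots> \<le> rademacher_maximal smul D g x + ennreal t"
        using avf[of k x0] by (intro add_mono Rm_le_maximal ennreal_leI) (simp add: c_def)
      finally have le: "Rm f k N x \<le> rademacher_maximal smul D g x + ennreal t" .
      show "ennreal ((8 * C + 1) * t) < rademacher_maximal smul D g x"
      proof (rule ccontr)
        assume "\<not> ?thesis"
        then have "Rm f k N x \<le> ennreal ((8 * C + 1) * t) + ennreal t"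
          using le by (meson add_right_mono not_le order_trans)
        also have "\<dots> = ennreal (K * t)"
          using C t by (simp add: K_def algebra_simps flip: ennreal_plus)
        finally show False using x(2) by simp
      qed
    qed
    then have "emeasure lebesgue ?S \<le> emeasure lebesgue {x. ennreal ((8 * C + 1) * t) < rademacher_maximal smul D g x}"
      by (intro emeasure_mono rademacher_maximal_sets)
    also have "\<dots> \<le> ennreal (C / ((8 * C + 1) * t)) * H1_norm D g"
      using C t by (intro C(2) gH) auto
    also have "\<dots> \<le> ennreal (C / ((8 * C + 1) * t)) * ennreal (2 * t * vol k)"
      by (intro mult_left_mono H1n) simp
    also have "\<dots> = ennreal (C / ((8 * C + 1) * t) * (2 * t * vol k))"
      using C t by (intro ennreal_mult[symmetric]) auto
    also have "\<dots> \<le> ennreal (vol k / 4)"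
    proof (rule ennreal_leI)
      have "C / (s * t) * (2 * t * vol k) = 2 * C / s * vol k" if "0 < s" for s
        using t that by (simp add: field_simps)
      from this[of "8 * C + 1"]
      have "C / ((8 * C + 1) * t) * (2 * t * vol k) = 2 * C / (8 * C + 1) * vol k"
        using C by simp
      also have "\<dots> \<le> 1 / 4 * vol k"
        using C by (intro mult_right_mono) (auto simp: field_simps)
      finally show "C / ((8 * C + 1) * t) * (2 * t * vol k) \<le> vol k / 4" by simp
    qed
    finally show "emeasure lebesgue ?S \<le> ennreal (vol k / 4)" .
  qed
  then show ?thesis by blast
qed

text \<open>Calderon-Zygmund at four times the mean a: the exceptional set fills at most a quarter
  of the cube, and the good function is bounded by 2^n times 4 a, which explains the
  constant.\<close>

lemma local_weak_if_bounded_test: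
  assumes K: "bounded_test K"
  shows "local_weak (K * 2 ^ CARD('n) * 4)"
  unfolding local_weak_def
proof (intro conjI allI impI)
  show "0 < K * 2 ^ CARD('n) * 4" using K by (simp add: bounded_test_def)
  fix k N :: int and x0 and f :: "real^'n \<Rightarrow> 'x"
  assume kN: "k \<le> N" and f: "loc_int f"
  let ?Q = "cube k x0"
  define a where "a = norm_avg f k x0"
  let ?S = "?Q \<inter> {x. ennreal (K * 2 ^ CARD('n) * 4 * norm_avg f k x0) < Rm f k N x}"
  have a0: "0 \<le> a" unfolding a_def by (rule norm_avg_nonneg[OF f])
  show "emeasure lebesgue ?S \<le> ennreal (vol k / 2)"
  \<comment> \<open>The decomposition needs a positive height; for a = 0 all averages over subcubes
    vanish.\<close>
  proof (cases "a = 0")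
    case True
    have "Rm f k N x = 0" if x: "x \<in> ?Q" for x
    proof -
      have "average f (cube j x) = 0" if "j \<in> {k..N}" for j
      proof -
        have "cube j x \<subseteq> ?Q"
          using that cube_mono[of k j x] cube_eq[OF x] by auto
        then have "ennreal (vol j * norm_avg f j x) \<le> ennreal (vol k * norm_avg f k x0)"
          unfolding norm_avg_eq[OF f] by (intro nn_integral_mono) (auto split: split_indicator)
        then have "vol j * norm_avg f j x \<le> 0"
          using True by (simp add: a_def ennreal_eq_0_iff)
        then have "norm_avg f j x \<le> 0"
          using vol_pos[of j] by (simp add: mult_le_0_iff)
        then have "norm (average f (cube j x)) \<le> 0"
          using norm_average_le[OF f, of j x] by linarith
        then show ?thesis by simp
      qed
      then have "Rm f k N x \<le> (\<Sum>j\<in>{k..N}. 0)"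
        by (intro order_trans[OF Rm_le_sum] sum_mono) simp
      then show ?thesis by simp
    qed
    then have "?S = {}" by auto
    then show ?thesis by (metis emeasure_empty zero_le)
  next
    case False
    then have a: "0 < a" using a0 by simp
    \<comment> \<open>Localising f to the cube makes its total integral equal to vol k times a, and
      makes the good function vanish off the cube, as \<open>bounded_test\<close> requires.\<close>
    define u where "u = (\<lambda>y. indicator ?Q y *\<^sub>R f y)"
    have ui: "loc_int u"
      unfolding loc_int_def
    proof (intro conjI allI)
      show "strongly_measurable lebesgue u"
        unfolding u_def using f by (intro strongly_measurable_indicator_scaleR) (auto simp: loc_int_def)
      fix j x
      have "(\<integral>\<^sup>+y\<in>cube j x. ennreal (norm (u y)) \<partial>lebesgue) \<le> (\<integral>\<^sup>+y\<in>cube j x. ennreal (norm (f y)) \<partial>lebesgue)"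
        by (intro nn_integral_mono) (auto simp: u_def split: split_indicator)
      also have "\<dots> < \<infinity>" using f by (auto simp: loc_int_def)
      finally show "(\<integral>\<^sup>+y\<in>cube j x. ennreal (norm (u y)) \<partial>lebesgue) < \<infinity>" .
    qed
    have intu: "(\<integral>\<^sup>+y. ennreal (norm (u y)) \<partial>lebesgue) = ennreal (vol k * a)"
      unfolding a_def norm_avg_eq[OF f] by (intro nn_integral_cong) (auto simp: u_def split: split_indicator)
    have cz: "norm_avg u k x \<le> 4 * a" for x
    proof -
      have "ennreal (vol k * norm_avg u k x) \<le> ennreal (vol k * a)"
        unfolding norm_avg_eq[OF ui] intu[symmetric] by (intro nn_integral_mono) (auto split: split_indicator)
      then have "vol k * norm_avg u k x \<le> vol k * a"
        using a by (subst (asm) ennreal_le_iff) auto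
      then have "norm_avg u k x \<le> a" by simp
      then show ?thesis using a by simp
    qed
    obtain g B where g: "level_const N g" "\<And>y. norm (g y) \<le> 2 ^ CARD('n) * (4 * a)"
      and B: "B \<in> sets lebesgue" "emeasure lebesgue B \<le> ennreal (1 / (4 * a)) * (\<integral>\<^sup>+y. norm (u y) \<partial>lebesgue)"
      and av: "\<And>x j. x \<notin> B \<Longrightarrow> k \<le> j \<Longrightarrow> j \<le> N \<Longrightarrow> average g (cube j x) = average u (cube j x)"
      and g0: "\<And>x. (\<And>y. y \<in> cube k x \<Longrightarrow> u y = 0) \<Longrightarrow> g x = 0"
      using calderon_zygmund[OF ui kN _ cz] a by (metis mult_pos_pos zero_less_numeral)
    have supp: "g y = 0" if "y \<notin> ?Q" for y
    proof (rule g0)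
      fix z assume z: "z \<in> cube k y"
      have "z \<notin> ?Q"
        using that cube_eq[OF z] cube_eq[of z k x0] mem_cube[of y k] by auto
      then show "u z = 0" by (simp add: u_def)
    qed
    define t where "t = 2 ^ CARD('n) * (4 * a)"
    have t: "0 < t" using a by (simp add: t_def)
    let ?T = "?Q \<inter> {x. ennreal (K * t) < Rm g k N x}"
    have T: "emeasure lebesgue ?T \<le> ennreal (vol k / 4)"
      using K t kN g supp unfolding bounded_test_def t_def by blast
    have "?S \<subseteq> B \<union> ?T"
    proof
      fix x assume x: "x \<in> ?S"
      show "x \<in> B \<union> ?T"
      proof (cases "x \<in> B")
        case False
        have eq: "Rm f k N x = Rm g k N x"
        proof (rule Rm_cong)
          fix j assume j: "k \<le> j" "j \<le> N"
          have "cube j x \<subseteq> ?Q" using cube_mono[OF j(1), of x] cube_eq[of x k x0] x by auto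
          then have "average u (cube j x) = average f (cube j x)"
            by (intro average_cong) (auto simp: u_def)
          then show "average f (cube j x) = average g (cube j x)"
            using av[OF False j] by simp
        qed
        have Kt: "K * t = K * 2 ^ CARD('n) * 4 * norm_avg f k x0"
          by (simp add: t_def a_def)
        show ?thesis
          using x by (simp only: Int_iff Un_iff mem_Collect_eq eq Kt) simp
      qed simp
    qed
    then have "emeasure lebesgue ?S \<le> emeasure lebesgue (B \<union> ?T)"
      using B by (intro emeasure_mono) auto
    also have "\<dots> \<le> emeasure lebesgue B + emeasure lebesgue ?T"
      using B by (intro emeasure_subadditive) auto
    also have "\<dots> \<le> ennreal (1 / (4 * a)) * ennreal (vol k * a) + ennreal (vol k / 4)"
      using B(2) T unfolding intu by (intro add_mono)
    also have "ennreal (1 / (4 * a)) * ennreal (vol k * a) = ennreal (vol k / 4)"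
      using a by (subst ennreal_mult[symmetric]) auto
    also have "ennreal (vol k / 4) + ennreal (vol k / 4) = ennreal (vol k / 2)"
      by (subst ennreal_plus[symmetric]) auto
    finally show ?thesis .
  qed
qed

end

context rademacher
begin

section \<open>Weighted estimates by a good-lambda inequality\<close>

lemma wavg_norm:
  assumes f: "loc_int f"
  shows "wavg lebesgue (\<lambda>y. ennreal (norm (f y))) j x = ennreal (norm_avg f j x)"
  unfolding wavg_def norm_avg_eq[OF f, symmetric] emeasure_cube
  using norm_avg_nonneg[OF f, of j x] by (simp add: divide_ennreal)

lemma good_lambda:
  fixes f :: "real^'n \<Rightarrow> 'x"
  assumes K: "local_weak K" "0 < K" and kN: "k \<le> N" and f: "loc_int f"
    and \<mu>: "cube_measure \<mu>" and \<delta>: "0 < \<delta>" "\<delta> < 1" "\<And>k x E. E \<in> sets lebesgue \<Longrightarrow> E \<subseteq> cube k x \<Longrightarrow>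
      emeasure lebesgue E \<le> ennreal (vol k / 2) \<Longrightarrow> emeasure \<mu> E \<le> ennreal (1 - \<delta>) * emeasure \<mu> (cube k x)"
    and a: "1 < a" and l: "0 < l"
  shows "emeasure \<mu> {x. ennreal (a * l) < Rm f k N x} \<le> ennreal (1 - \<delta>) * emeasure \<mu> {x. ennreal l < Rm f k N x}
    + emeasure \<mu> {x. ennreal ((a - 1) * l / K) < wmax lebesgue (\<lambda>y. ennreal (norm (f y))) x}"
proof -
  have s: "sets \<mu> = sets lebesgue" using \<mu> by (simp add: cube_measure_def)
  let ?M = "wmax lebesgue (\<lambda>y. ennreal (norm (f y)))"
  \<comment> \<open>On a stopping cube with a point outside \<open>V\<close> the mean of the norm is
    at most ?b. So K times it is at most (a - 1) l, which is what the levels from m on must exceed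
    once the ancestors have used up l.\<close>
  let ?b = "(a - 1) * l / K"
  define V where "V = {x. ennreal ?b < ?M x}"
  define A where "A = {x. ennreal (a * l) < Rm f k N x} - V"
  define P where "P = (\<lambda>m x. m \<le> N \<and> ennreal l < Rm f k m x)"
  have V: "V \<in> sets lebesgue"
  proof -
    have "{x \<in> space lebesgue. ennreal ?b < ?M x} \<in> sets lebesgue" by measurable
    then show ?thesis by (simp add: V_def)
  qed
  then have A: "A \<in> sets lebesgue" by (simp add: A_def Rm_sets)
  have P: "level_const m (P m)" for m
    using level_const_Rm[of m f k] unfolding level_const_def P_def by metis
  \<comment> \<open>\<open>Rm f k m\<close> grows with m, so some truncation up to level N exceeds l
    exactly when the last one does.\<close>
  have U: "{x. \<exists>m\<ge>k. P m x} = {x. ennreal l < Rm f k N x}"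
    using kN Rm_mono[of k k _ N f] unfolding P_def by (auto intro: less_le_trans)
  have l_al: "ennreal l \<le> ennreal (a * l)"
    using a l by (intro ennreal_leI) simp
  have "emeasure \<mu> (A \<inter> {x. \<exists>m\<ge>k. P m x}) \<le> ennreal (1 - \<delta>) * emeasure \<mu> (UNIV \<inter> {x. \<exists>m\<ge>k. P m x})"
  proof (rule stopping_emeasure_le[OF P s s A])
    fix m x assume m: "k \<le> m" "P m x" and min: "\<And>i. k \<le> i \<Longrightarrow> i < m \<Longrightarrow> \<not> P i x"
    let ?Q = "cube m x"
    let ?E = "?Q \<inter> {y. ennreal (K * norm_avg f m x) < Rm f m N y}"
    have mN: "m \<le> N" using m by (simp add: P_def)
    have "emeasure \<mu> (A \<inter> ?Q) \<le> ennreal (1 - \<delta>) * emeasure \<mu> ?Q"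
    proof (cases "A \<inter> ?Q = {}")
      case True
      then show ?thesis by (metis emeasure_empty zero_le)
    next
      case False
      then obtain z where z: "z \<in> A" "z \<in> ?Q" by blast
      have "ennreal (norm_avg f m x) = ennreal (norm_avg f m z)"
        using norm_avg_cube[OF z(2) order_refl, of f] by simp
      also have "\<dots> \<le> ?M z"
        unfolding wavg_norm[OF f, symmetric] by (rule wavg_le_wmax)
      also have "\<dots> \<le> ennreal ?b" using z(1) by (simp add: A_def V_def not_less)
      finally have "norm_avg f m x \<le> ?b"
        using a l K by (subst (asm) ennreal_le_iff) auto
      then have Kb: "K * norm_avg f m x \<le> (a - 1) * l"
        using K by (simp add: field_simps)
      have "A \<inter> ?Q \<subseteq> ?E"
      proof
        fix y assume y: "y \<in> A \<inter> ?Q"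
        have "Rm f k (m - 1) y \<le> ennreal l"
        \<comment> \<open>A stopping cube of the coarsest level has no ancestor in the range, and
          the R-bound of the empty set is 0.\<close>
        proof (cases "m = k")
          case True
          then show ?thesis by (simp add: Rm_def R_bound_empty)
        next
          case False
          then have "\<not> P (m - 1) x" using m by (intro min) auto
          moreover have "y \<in> cube (m - 1) x"
            using y cube_mono[of "m - 1" m x] by auto
          then have "P (m - 1) y = P (m - 1) x"
            by (rule level_constD[OF P])
          ultimately show ?thesis using mN by (simp add: P_def)
        qed
        then have "Rm f k N y \<le> ennreal l + Rm f m N y"
          using Rm_split[OF m(1) mN, of f y] by (meson add_right_mono order_trans)
        moreover have "ennreal (a * l) < Rm f k N y" using y by (simp add: A_def)
        moreover have "ennreal (a * l) = ennreal l + ennreal ((a - 1) * l)"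
          using a l by (subst ennreal_plus[symmetric]) (auto simp: algebra_simps)
        ultimately have "ennreal ((a - 1) * l) < Rm f m N y"
          by (metis add_left_mono less_le_trans not_le)
        then have "ennreal (K * norm_avg f m x) < Rm f m N y"
          using Kb by (meson ennreal_leI le_less_trans)
        then show "y \<in> ?E" using y by simp
      qed
      then have "emeasure \<mu> (A \<inter> ?Q) \<le> emeasure \<mu> ?E"
        using s by (intro emeasure_mono) auto
      also have "\<dots> \<le> ennreal (1 - \<delta>) * emeasure \<mu> ?Q"
        using K(1) mN f unfolding local_weak_def by (intro \<delta>(3)) auto
      finally show ?thesis .
    qed
    then show "emeasure \<mu> (A \<inter> ?Q) \<le> ennreal (1 - \<delta>) * emeasure \<mu> (UNIV \<inter> ?Q)" by simp
  qed simp
  moreover have "A \<inter> {x. \<exists>m\<ge>k. P m x} = A"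
    unfolding U A_def using l_al by (auto intro: le_less_trans)
  ultimately have Ale: "emeasure \<mu> A \<le> ennreal (1 - \<delta>) * emeasure \<mu> {x. ennreal l < Rm f k N x}"
    unfolding U by simp
  have "emeasure \<mu> {x. ennreal (a * l) < Rm f k N x} \<le> emeasure \<mu> (A \<union> V)"
    using s A V by (intro emeasure_mono) (auto simp: A_def)
  also have "\<dots> \<le> emeasure \<mu> A + emeasure \<mu> V"
    using s A V by (intro emeasure_subadditive) auto
  finally show ?thesis
    using Ale unfolding V_def by (meson add_right_mono order_trans)
qed

text \<open>Finiteness of I permits subtracting (1 - d) I, which leaves (d / 2) I on the
  left.\<close>

lemma absorb_le:
  fixes I J :: ennreal
  assumes le: "ennreal (1 - d / 2) * I \<le> ennreal (1 - d) * I + ennreal c * J" and fin: "I < top"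
    and d: "0 < d" "d < 1" and c: "0 < c"
  shows "I \<le> ennreal (2 * c / d) * J"
proof (cases J)
  case top
  then have "ennreal (2 * c / d) * J = top"
    using c d by (simp add: ennreal_mult_top)
  then show ?thesis by simp
next
  case (real j)
  obtain r where r: "I = ennreal r" "0 \<le> r" using fin by (cases I) auto
  have "ennreal ((1 - d / 2) * r) \<le> ennreal ((1 - d) * r + c * j)"
    using le d r c real by (simp add: ennreal_mult)
  then have "(1 - d / 2) * r \<le> (1 - d) * r + c * j"
    using d r c real by (subst (asm) ennreal_le_iff) auto
  then have "r \<le> 2 * c / d * j"
    using d by (simp add: field_simps)
  then show ?thesis
    using r real c d by (simp add: ennreal_leI flip: ennreal_mult)
qed

text \<open>The good-lambda inequality integrated over all heights. The constant is free of k and N,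
  so the truncation can later be removed by monotone convergence.\<close>

lemma Rm_strong_bound:
  fixes f :: "real^'n \<Rightarrow> 'x"
  assumes K: "local_weak K" "0 < K" and kN: "k \<le> N" and f: "loc_int f" and p: "1 < p"
    and \<mu>: "cube_measure \<mu>" and \<delta>: "0 < \<delta>" "\<delta> < 1" "\<And>k x E. E \<in> sets lebesgue \<Longrightarrow> E \<subseteq> cube k x \<Longrightarrow>
      emeasure lebesgue E \<le> ennreal (vol k / 2) \<Longrightarrow> emeasure \<mu> E \<le> ennreal (1 - \<delta>) * emeasure \<mu> (cube k x)"
    and fin: "(\<integral>\<^sup>+x. ennreal_powr (wmax lebesgue (\<lambda>y. ennreal (norm (f y))) x) p \<partial>\<mu>) < top"
  shows "(\<integral>\<^sup>+x. ennreal_powr (Rm f k N x) p \<partial>\<mu>)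
    \<le> ennreal (2 * (K / ((1 - \<delta> / 2) powr (- 1 / p) - 1)) powr p / \<delta>) *
      (\<integral>\<^sup>+x. ennreal_powr (wmax lebesgue (\<lambda>y. ennreal (norm (f y))) x) p \<partial>\<mu>)"
proof -
  interpret sigma_finite_measure \<mu> by (rule cube_measure_sigma_finite[OF \<mu>])
  have s: "sets \<mu> = sets lebesgue" using \<mu> by (simp add: cube_measure_def)
  have [simp]: "space \<mu> = UNIV" using sets_eq_imp_space_eq[OF s] by simp
  let ?M = "wmax lebesgue (\<lambda>y. ennreal (norm (f y)))"
  let ?F = "Rm f k N"
  \<comment> \<open>Chosen so that a^(-p) = 1 - \<delta> / 2. Integrating the left-hand side of the
    good-lambda inequality produces this factor, and it exceeds the factor 1 - \<delta> on the
    right.\<close>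
  define a where "a = (1 - \<delta> / 2) powr (- 1 / p)"
  have ap: "(1 / a) powr p = 1 - \<delta> / 2"
    using p \<delta> by (simp add: a_def powr_minus powr_divide powr_powr field_simps)
  have a: "1 < a"
  proof (rule ccontr)
    assume "\<not> 1 < a"
    moreover have "0 < a" using \<delta> by (simp add: a_def)
    ultimately have "1 powr p \<le> (1 / a) powr p" using p by (intro powr_mono2) auto
    then show False using ap \<delta> by simp
  qed
  define c where "c = K / (a - 1)"
  have c: "0 < c" using K a by (simp add: c_def)
  have [measurable]: "?F \<in> borel_measurable \<mu>" "?M \<in> borel_measurable \<mu>"
    using Rm_measurable wmax_measurable s by (simp_all cong: measurable_cong_sets)
  define I where "I = (\<integral>\<^sup>+x. ennreal_powr (?F x) p \<partial>\<mu>)"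
  define J where "J = (\<integral>\<^sup>+x. ennreal_powr (?M x) p \<partial>\<mu>)"
  have scale: "(\<integral>\<^sup>+x. ennreal_powr (ennreal r * G x) p \<partial>\<mu>) = ennreal (r powr p) * (\<integral>\<^sup>+x. ennreal_powr (G x) p \<partial>\<mu>)"
    if [measurable]: "G \<in> borel_measurable \<mu>" and r: "0 < r" for r G
    using p r by (subst nn_integral_cmult[symmetric]) (auto simp: ennreal_powr_mult)
  have less: "ennreal t < ennreal r * v \<longleftrightarrow> ennreal (t / r) < v" if "0 < r" "0 < t" for t r v
  proof (cases v)
    case (real u)
    then show ?thesis
      using that by (simp add: ennreal_less_iff field_simps flip: ennreal_mult)
  qed (use that in \<open>simp add: ennreal_mult_top\<close>)
  \<comment> \<open>The truncated function is at most the number of levels times the maximal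
    function of the norm. This bound depends on k and N but serves only to allow absorption.\<close>
  have finI: "I < top"
  proof -
    let ?n = "real (card {k..N})"
    have n: "0 < ?n" using kN by simp
    have "?F x \<le> ennreal ?n * ?M x" for x
    proof -
      have "?F x \<le> (\<Sum>j\<in>{k..N}. ennreal (norm (average f (cube j x))))" by (rule Rm_le_sum)
      also have "\<dots> \<le> (\<Sum>j\<in>{k..N}. ?M x)"
      proof (rule sum_mono)
        fix j
        have "ennreal (norm (average f (cube j x))) \<le> wavg lebesgue (\<lambda>y. ennreal (norm (f y))) j x"
          unfolding wavg_norm[OF f] by (intro ennreal_leI norm_average_le f)
        then show "ennreal (norm (average f (cube j x))) \<le> ?M x"
          using wavg_le_wmax by (rule order_trans)
      qed
      also have "\<dots> = ennreal ?n * ?M x"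
        by (simp only: sum_constant ennreal_of_nat_eq_real_of_nat)
      finally show ?thesis .
    qed
    then have "I \<le> (\<integral>\<^sup>+x. ennreal_powr (ennreal ?n * ?M x) p \<partial>\<mu>)"
      unfolding I_def using p by (intro nn_integral_mono ennreal_powr_mono) auto
    also have "\<dots> = ennreal (?n powr p) * J"
      unfolding J_def by (rule scale) (use n in auto)
    also have "\<dots> < top"
      using fin unfolding J_def by (simp add: ennreal_mult_less_top)
    finally show ?thesis .
  qed
  have "ennreal (1 - \<delta> / 2) * I = (\<integral>\<^sup>+x. ennreal_powr (ennreal (1 / a) * ?F x) p \<partial>\<mu>)"
    unfolding I_def using a by (subst scale) (auto simp: ap)
  also have "\<dots> = (\<integral>\<^sup>+t. powr_kernel p t * emeasure \<mu> {x. ennreal t < ennreal (1 / a) * ?F x} \<partial>lborel)"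
    using layer_cake[of "\<lambda>x. ennreal (1 / a) * ?F x" p] p by simp
  also have "\<dots> \<le> (\<integral>\<^sup>+t. ennreal (1 - \<delta>) * (powr_kernel p t * emeasure \<mu> {x. ennreal t < ?F x})
      + powr_kernel p t * emeasure \<mu> {x. ennreal t < ennreal c * ?M x} \<partial>lborel)"
  proof (rule nn_integral_mono)
    fix t
    show "powr_kernel p t * emeasure \<mu> {x. ennreal t < ennreal (1 / a) * ?F x}
      \<le> ennreal (1 - \<delta>) * (powr_kernel p t * emeasure \<mu> {x. ennreal t < ?F x})
      + powr_kernel p t * emeasure \<mu> {x. ennreal t < ennreal c * ?M x}"
    proof (cases "0 < t")
      case True
      have 1: "{x. ennreal t < ennreal (1 / a) * ?F x} = {x. ennreal (a * t) < ?F x}"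
        using True a by (subst less) (auto simp: mult.commute)
      have 2: "{x. ennreal t < ennreal c * ?M x} = {x. ennreal ((a - 1) * t / K) < ?M x}"
        using True c by (subst less) (auto simp: c_def mult.commute)
      have "powr_kernel p t * emeasure \<mu> {x. ennreal (a * t) < ?F x}
        \<le> powr_kernel p t * (ennreal (1 - \<delta>) * emeasure \<mu> {x. ennreal t < ?F x}
          + emeasure \<mu> {x. ennreal ((a - 1) * t / K) < ?M x})"
        by (intro mult_left_mono good_lambda[OF K kN f \<mu> \<delta> a True]) auto
      then show ?thesis
        unfolding 1 2 by (simp add: distrib_left mult_ac)
    qed (simp add: powr_kernel_def)
  qed
  also have "\<dots> = ennreal (1 - \<delta>) * (\<integral>\<^sup>+t. powr_kernel p t * emeasure \<mu> {x. ennreal t < ?F x} \<partial>lborel)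
      + (\<integral>\<^sup>+t. powr_kernel p t * emeasure \<mu> {x. ennreal t < ennreal c * ?M x} \<partial>lborel)"
  proof -
    have m: "(\<lambda>t. emeasure \<mu> {x. ennreal t < ennreal r * G x}) \<in> borel_measurable borel"
      if [measurable]: "G \<in> borel_measurable \<mu>" for r and G :: "real^'n \<Rightarrow> ennreal"
    proof -
      have "{z \<in> space (borel \<Otimes>\<^sub>M \<mu>). ennreal (fst z) < ennreal r * G (snd z)} \<in> sets (borel \<Otimes>\<^sub>M \<mu>)"
        by measurable
      from measurable_emeasure_Pair[OF this] show ?thesis
        by (simp add: space_pair_measure vimage_def)
    qed
    from m[of ?F 1] have [measurable]: "(\<lambda>t. emeasure \<mu> {x. ennreal t < ?F x}) \<in> borel_measurable borel" by simp
    from m[of ?M c] have [measurable]: "(\<lambda>t. emeasure \<mu> {x. ennreal t < ennreal c * ?M x}) \<in> borel_measurable borel" by simp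
    show ?thesis
      by (subst nn_integral_add) (auto simp: nn_integral_cmult)
  qed
  also have "(\<integral>\<^sup>+t. powr_kernel p t * emeasure \<mu> {x. ennreal t < ?F x} \<partial>lborel) = I"
    unfolding I_def using layer_cake[of ?F p] p by simp
  also have "(\<integral>\<^sup>+t. powr_kernel p t * emeasure \<mu> {x. ennreal t < ennreal c * ?M x} \<partial>lborel)
      = (\<integral>\<^sup>+x. ennreal_powr (ennreal c * ?M x) p \<partial>\<mu>)"
    using layer_cake[of "\<lambda>x. ennreal c * ?M x" p] p by simp
  also have "\<dots> = ennreal (c powr p) * J"
    unfolding J_def using c by (intro scale) auto
  finally have "I \<le> ennreal (2 * c powr p / \<delta>) * J"
    using finI \<delta> c by (intro absorb_le) auto
  then show ?thesis
    unfolding I_def J_def c_def a_def .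
qed

text \<open>Averages are taken with respect to Lebesgue measure. Null sets of the weighted measure
  are Lebesgue null because w is positive almost everywhere.\<close>

lemma Lp_weighted_strongly_measurable:
  fixes f :: "real^'n \<Rightarrow> 'x"
  assumes w: "w \<in> dyadic_A_p D p" and f: "f \<in> Lp (weighted_measure w) q"
  shows "strongly_measurable lebesgue f"
proof -
  have [measurable]: "w \<in> borel_measurable lebesgue" by (rule A_p_measurable[OF w])
  obtain s where s: "\<And>i::nat. simple_function (weighted_measure w) (s i)"
    and AE: "AE x in weighted_measure w. (\<lambda>i. s i x) \<longlonglongrightarrow> f x"
    using f unfolding Lp_def strongly_measurable_def by blast
  have "AE x in lebesgue. 0 < ennreal (w x) \<longrightarrow> (\<lambda>i. s i x) \<longlonglongrightarrow> f x"
    using AE unfolding weighted_measure_def by (subst (asm) AE_density) auto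
  with A_p_pos[OF w] have "AE x in lebesgue. (\<lambda>i. s i x) \<longlonglongrightarrow> f x"
    by eventually_elim simp
  moreover have "simple_function lebesgue (s i)" for i
    using s[of i] unfolding simple_function_def weighted_measure_def by simp
  ultimately show ?thesis
    unfolding strongly_measurable_def by blast
qed

lemma strong_type_if_local_weak:
  assumes K: "local_weak K" and p: "1 < p" and w: "w \<in> dyadic_A_p D p"
  shows "rademacher_strong_type smul D (weighted_measure w) p"
proof -
  let ?\<mu> = "weighted_measure w"
  have \<mu>: "cube_measure ?\<mu>" by (rule A_p_cube_measure[OF w])
  have s: "sets ?\<mu> = sets lebesgue" by (simp add: weighted_measure_def)
  have K0: "0 < K" using K by (simp add: local_weak_def)
  obtain C1 where C1: "0 \<le> C1" "\<And>f. f \<in> borel_measurable lebesgue \<Longrightarrow> (\<And>x. 0 \<le> f x) \<Longrightarrow>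
    (\<integral>\<^sup>+x. ennreal_powr (wmax lebesgue (\<lambda>x. ennreal (f x)) x) p \<partial>?\<mu>)
      \<le> ennreal C1 * (\<integral>\<^sup>+x. ennreal (f x powr p) \<partial>?\<mu>)"
    using muckenhoupt[OF w p] by blast
  obtain \<delta> where \<delta>: "0 < \<delta>" "\<delta> < 1" "\<And>k x E. E \<in> sets lebesgue \<Longrightarrow> E \<subseteq> cube k x \<Longrightarrow>
    emeasure lebesgue E \<le> ennreal (vol k / 2) \<Longrightarrow> emeasure ?\<mu> E \<le> ennreal (1 - \<delta>) * emeasure ?\<mu> (cube k x)"
    using A_p_half_subset[OF w p] by blast
  define C2 where "C2 = 2 * (K / ((1 - \<delta> / 2) powr (- 1 / p) - 1)) powr p / \<delta>"
  have C2: "0 \<le> C2" using \<delta> by (simp add: C2_def)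
  have "(\<integral>\<^sup>+x. ennreal_powr (rademacher_maximal smul D f x) p \<partial>?\<mu>)
      \<le> ennreal (C2 * C1) * (\<integral>\<^sup>+x. ennreal (norm (f x) powr p) \<partial>?\<mu>)"
    if fL: "f \<in> Lp ?\<mu> p" for f
  proof -
    let ?M = "wmax lebesgue (\<lambda>y. ennreal (norm (f y)))"
    have fs: "strongly_measurable lebesgue f"
      by (rule Lp_weighted_strongly_measurable[OF w fL])
    have fm [measurable]: "(\<lambda>y. norm (f y)) \<in> borel_measurable lebesgue"
      by (rule borel_measurable_norm_strong[OF fs])
    have MJ: "(\<integral>\<^sup>+x. ennreal_powr (?M x) p \<partial>?\<mu>) \<le> ennreal C1 * (\<integral>\<^sup>+x. ennreal (norm (f x) powr p) \<partial>?\<mu>)"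
      by (rule C1(2)[OF fm]) simp
    also have "\<dots> < top"
      using fL by (simp add: Lp_def ennreal_mult_less_top)
    finally have fin: "(\<integral>\<^sup>+x. ennreal_powr (?M x) p \<partial>?\<mu>) < top" .
    \<comment> \<open>Local integrability comes from the weighted maximal inequality: an infinite
      mean over one cube would make the maximal function infinite on that cube, which has positive
      weight.\<close>
    have f: "loc_int f"
      unfolding loc_int_def
    proof (intro conjI allI fs)
      fix k x
      let ?v = "wavg lebesgue (\<lambda>y. ennreal (norm (f y))) k x"
      have "?v \<noteq> top"
      proof
        assume v: "?v = top"
        have M: "?M y = top" if "y \<in> cube k x" for y
          using wavg_le_wmax[of lebesgue "\<lambda>y. ennreal (norm (f y))" k y] v wavg_cong_cube[OF that, of lebesgue]
          by (simp add: top_unique)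
        have "top * emeasure ?\<mu> (cube k x) = (\<integral>\<^sup>+y. top * indicator (cube k x) y \<partial>?\<mu>)"
          using s by (intro nn_integral_cmult_indicator[symmetric]) simp
        also have "\<dots> \<le> (\<integral>\<^sup>+x. ennreal_powr (?M x) p \<partial>?\<mu>)"
          by (intro nn_integral_mono) (auto simp: M split: split_indicator)
        finally have "top * emeasure ?\<mu> (cube k x) < top"
          using fin by (rule le_less_trans)
        then have "emeasure ?\<mu> (cube k x) = 0"
          by (simp add: ennreal_top_mult split: if_splits)
        moreover have "0 < emeasure ?\<mu> (cube k x)" using \<mu> unfolding cube_measure_def by blast
        ultimately show False by simp
      qed
      then have "?v * emeasure lebesgue (cube k x) < top"
        by (simp add: emeasure_cube ennreal_mult_less_top less_top)
      then show "(\<integral>\<^sup>+y\<in>cube k x. ennreal (norm (f y)) \<partial>lebesgue) < \<infinity>"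
        unfolding wavg_times[OF cube_measure_lebesgue] by simp
    qed
    let ?F = "\<lambda>i x. ennreal_powr (Rm f (- int i) (int i) x) p"
    have F: "(\<integral>\<^sup>+x. ?F i x \<partial>?\<mu>) \<le> ennreal (C2 * C1) * (\<integral>\<^sup>+x. ennreal (norm (f x) powr p) \<partial>?\<mu>)" for i
    proof -
      have "(\<integral>\<^sup>+x. ?F i x \<partial>?\<mu>) \<le> ennreal C2 * (\<integral>\<^sup>+x. ennreal_powr (?M x) p \<partial>?\<mu>)"
        unfolding C2_def by (rule Rm_strong_bound[OF K K0 _ f p \<mu> \<delta> fin]) auto
      also have "\<dots> \<le> ennreal C2 * (ennreal C1 * (\<integral>\<^sup>+x. ennreal (norm (f x) powr p) \<partial>?\<mu>))"
        by (intro mult_left_mono MJ) simp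
      finally show ?thesis
        using C1(1) C2 by (simp add: ennreal_mult mult.assoc)
    qed
    have "(\<integral>\<^sup>+x. ennreal_powr (rademacher_maximal smul D f x) p \<partial>?\<mu>) \<le> (\<integral>\<^sup>+x. (SUP i. ?F i x) \<partial>?\<mu>)"
      unfolding rademacher_maximal_SUP using p
      by (intro nn_integral_mono ennreal_powr_SUP_le) (auto intro: SUP_upper)
    also have "\<dots> = (SUP i. \<integral>\<^sup>+x. ?F i x \<partial>?\<mu>)"
    proof (rule nn_integral_monotone_convergence_SUP)
      show "incseq ?F"
        using p by (intro incseq_SucI le_funI ennreal_powr_mono Rm_mono) auto
      have "Rm f (- int i) (int i) \<in> borel_measurable ?\<mu>" for i
        using Rm_measurable s by (simp cong: measurable_cong_sets)
      then show "?F i \<in> borel_measurable ?\<mu>" for i by measurable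
    qed
    also have "\<dots> \<le> ennreal (C2 * C1) * (\<integral>\<^sup>+x. ennreal (norm (f x) powr p) \<partial>?\<mu>)"
      by (rule SUP_least) (rule F)
    finally show ?thesis .
  qed
  then show ?thesis
    unfolding rademacher_strong_type_def using C1(1) C2 by (intro exI[of _ "C2 * C1"]) auto
qed

section \<open>The unweighted estimates\<close>

lemma one_in_A_p:
  assumes p: "1 < p"
  shows "(\<lambda>_. 1) \<in> dyadic_A_p D p"
proof -
  have cube: "set_integrable lebesgue (cube k x) (\<lambda>_. 1::real)" for k x
    unfolding set_integrable_def using vol_pos[of k] by (simp add: emeasure_cube)
  have int: "set_integrable lebesgue Q (\<lambda>_. 1::real) \<and> (LINT x:Q|lebesgue. (1::real)) / measure lebesgue Q = 1"
    if Q: "Q \<in> dyadic_cubes D" for Q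
  proof -
    obtain k x where "Q = cube k x"
      using Q D_eq_range by (auto simp: dyadic_cubes_def)
    then show ?thesis
      using cube by (simp add: set_lebesgue_integral_def measure_cube)
  qed
  have K: "set_integrable lebesgue K (\<lambda>_. 1::real)" if "compact K" for K :: "(real^'n) set"
  proof -
    have K: "K \<in> lmeasurable" using that by (rule lmeasurable_compact)
    have "integrable lebesgue (indicator K :: _ \<Rightarrow> real)"
      using fmeasurableD[OF K] fmeasurableD2[OF K] by (intro integrable_real_indicator) (auto simp: less_top)
    then show ?thesis
      unfolding set_integrable_def by simp
  qed
  show ?thesis
    unfolding dyadic_A_p_def using int K by (auto intro!: exI[of _ 1])
qed

text \<open>The strong bound is applied to the good function at height t, which lies in L^p because
  it is both bounded and integrable.\<close>

lemma weak_type_if_strong_type: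
  assumes p: "1 < p" and strong: "rademacher_strong_type smul D lebesgue p"
  shows "rademacher_weak_type smul D (Lp lebesgue 1) L1_norm"
proof -
  obtain C where C: "0 \<le> C" "\<And>f. f \<in> Lp lebesgue p \<Longrightarrow>
      (\<integral>\<^sup>+x. ennreal_powr (rademacher_maximal smul D f x) p \<partial>lebesgue)
          \<le> ennreal C * (\<integral>\<^sup>+x. ennreal (norm (f x) powr p) \<partial>lebesgue)"
    using strong unfolding rademacher_strong_type_def by blast
  define H where "H = (2::real) ^ CARD('n)"
  have H: "0 < H" by (simp add: H_def)
  \<comment> \<open>The 1 accounts for the exceptional set of the decomposition, the other term for
    Chebyshev's inequality applied to the good function.\<close>
  define K where "K = 1 + C * H powr (p - 1)"
  have "emeasure lebesgue {x. ennreal t < rademacher_maximal smul D f x} \<le> ennreal (K / t) * L1_norm f"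
    if fL: "f \<in> Lp lebesgue 1" and t: "0 < t" for f and t :: real
  proof (rule emeasure_rademacher_maximal_le)
    fix i0 :: nat
    have f: "loc_int f" by (rule loc_int_L1[OF fL])
    have "L1_norm f < top" using fL by (simp add: Lp_def L1_norm_def)
    then obtain v where v: "L1_norm f = ennreal v" "0 \<le> v" by (cases "L1_norm f") auto
    \<comment> \<open>The decomposition needs means at most t at its coarsest level. This holds once
      cubes of level - i have volume at least v / t; widening the range of levels from i0 to i only
      increases the truncated function.\<close>
    define i where "i = max i0 (nat \<lceil>v / t\<rceil>)"
    have small: "norm_avg f (- int i) x \<le> t" for x
    proof -
      have "ennreal (vol (- int i) * norm_avg f (- int i) x) \<le> ennreal v"
        unfolding norm_avg_eq[OF f] v(1)[symmetric] L1_norm_def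
        by (intro nn_integral_mono) (auto split: split_indicator)
      then have le: "vol (- int i) * norm_avg f (- int i) x \<le> v"
        using v by (subst (asm) ennreal_le_iff) auto
      have "v / t \<le> real i" unfolding i_def by linarith
      also have "\<dots> \<le> 2 ^ i" using of_nat_less_two_power[of i, where ?'a=real] by simp
      also have "\<dots> \<le> vol (- int i)"
        unfolding vol_def by (simp add: self_le_power)
      finally have "v \<le> vol (- int i) * t" using t by (simp add: field_simps)
      with le have "vol (- int i) * norm_avg f (- int i) x \<le> vol (- int i) * t" by linarith
      then show ?thesis by simp
    qed
    obtain g B where g: "level_const (int i) g" "\<And>y. norm (g y) \<le> H * t"
      and gi: "(\<integral>\<^sup>+y. norm (g y) \<partial>lebesgue) \<le> (\<integral>\<^sup>+y. norm (f y) \<partial>lebesgue)"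
      and B: "B \<in> sets lebesgue" "emeasure lebesgue B \<le> ennreal (1 / t) * (\<integral>\<^sup>+y. norm (f y) \<partial>lebesgue)"
      and av: "\<And>x j. x \<notin> B \<Longrightarrow> - int i \<le> j \<Longrightarrow> j \<le> int i \<Longrightarrow> average g (cube j x) = average f (cube j x)"
    proof -
      have le: "- int i \<le> int i" by simp
      show ?thesis
        by (rule calderon_zygmund[OF f le t small]) (erule that[unfolded H_def]; assumption)
    qed
    let ?S = "{x. ennreal t < Rm g (- int i) (int i) x}"
    have gp: "(\<integral>\<^sup>+y. ennreal (norm (g y) powr p) \<partial>lebesgue) \<le> ennreal ((H * t) powr (p - 1) * v)"
    proof -
      have gm [measurable]: "(\<lambda>y. norm (g y)) \<in> borel_measurable lebesgue"
        by (rule loc_int_measurable[OF level_const_loc_int[OF g(1)]])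
      \<comment> \<open>Interpolation between the supremum bound H t and the L^1 norm of g, which is
        at most that of f.\<close>
      have "norm (g y) powr p \<le> (H * t) powr (p - 1) * norm (g y)" for y
      proof (cases "norm (g y) = 0")
        case False
        then have "norm (g y) powr p = norm (g y) powr (p - 1) * norm (g y)"
          using powr_add[of "norm (g y)" "p - 1" 1] by simp
        then show ?thesis
          using g(2)[of y] p by (auto intro!: mult_right_mono powr_mono2)
      qed simp
      then have "(\<integral>\<^sup>+y. ennreal (norm (g y) powr p) \<partial>lebesgue) \<le> (\<integral>\<^sup>+y. ennreal ((H * t) powr (p - 1)) * ennreal (norm (g y)) \<partial>lebesgue)"
        by (intro nn_integral_mono) (auto simp: ennreal_leI simp flip: ennreal_mult)
      also have "\<dots> = ennreal ((H * t) powr (p - 1)) * (\<integral>\<^sup>+y. norm (g y) \<partial>lebesgue)"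
        by (rule nn_integral_cmult) measurable
      also have "\<dots> \<le> ennreal ((H * t) powr (p - 1)) * ennreal v"
        using gi v by (intro mult_left_mono) (auto simp: L1_norm_def)
      finally show ?thesis using v by (simp add: ennreal_mult)
    qed
    have gL: "g \<in> Lp lebesgue p"
      unfolding Lp_def using gp level_const_strongly_measurable[OF g(1)] by (auto intro: le_less_trans)
    have "ennreal (t powr p) * emeasure lebesgue ?S \<le> (\<integral>\<^sup>+x. ennreal_powr (rademacher_maximal smul D g x) p \<partial>lebesgue)"
      using t p by (intro emeasure_chebyshev Rm_sets) (auto intro!: less_imp_le less_le_trans[OF _ Rm_le_maximal])
    also have "\<dots> \<le> ennreal C * ennreal ((H * t) powr (p - 1) * v)"
      by (intro order_trans[OF C(2)[OF gL]] mult_left_mono gp) auto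
    also have "\<dots> = ennreal (C * (H * t) powr (p - 1) * v)"
      using C(1) v by (subst ennreal_mult[symmetric]) (auto simp: mult.assoc)
    finally have S: "emeasure lebesgue ?S \<le> ennreal (C * H powr (p - 1) / t * v)"
    proof (rule emeasure_le_real)
      show "C * (H * t) powr (p - 1) \<le> t powr p * (C * H powr (p - 1) / t)"
        using t H powr_add[of t "p - 1" 1] by (simp add: powr_mult field_simps)
    qed (use t v C(1) in auto)
    have "{x. ennreal t < Rm f (- int i0) (int i0) x} \<subseteq> {x. ennreal t < Rm f (- int i) (int i) x}"
      using Rm_mono[of "- int i" "- int i0" "int i0" "int i" f] by (auto simp: i_def intro: less_le_trans)
    also have "\<dots> \<subseteq> B \<union> ?S"
      using Rm_cong[of "- int i" "int i" f _ g] av by auto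
    finally have "emeasure lebesgue {x. ennreal t < Rm f (- int i0) (int i0) x} \<le> emeasure lebesgue (B \<union> ?S)"
      using B Rm_sets by (intro emeasure_mono) auto
    also have "\<dots> \<le> emeasure lebesgue B + emeasure lebesgue ?S"
      using B Rm_sets by (intro emeasure_subadditive) auto
    also have "\<dots> \<le> ennreal (1 / t * v) + ennreal (C * H powr (p - 1) / t * v)"
    proof (intro add_mono S)
      have "ennreal (1 / t * v) = ennreal (1 / t) * L1_norm f"
        using v t by (subst ennreal_mult) auto
      then show "emeasure lebesgue B \<le> ennreal (1 / t * v)"
        using B(2) by (simp only: L1_norm_def)
    qed
    also have "\<dots> = ennreal (K / t * v)"
    proof -
      have "1 / t * v + C * H powr (p - 1) / t * v = K / t * v"
        unfolding K_def by (simp add: add_divide_distrib distrib_right)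
      moreover have "0 \<le> 1 / t * v" "0 \<le> C * H powr (p - 1) / t * v"
        using t v C by simp_all
      ultimately show ?thesis
        by (metis ennreal_plus)
    qed
    also have "\<dots> = ennreal (K / t) * L1_norm f"
      using t v C by (subst ennreal_mult) (auto simp: K_def)
    finally show "emeasure lebesgue {x. ennreal t < Rm f (- int i0) (int i0) x} \<le> ennreal (K / t) * L1_norm f" .
  qed
  moreover have "0 \<le> K" using C by (simp add: K_def)
  ultimately show ?thesis
    unfolding rademacher_weak_type_def by (intro exI[of _ K]) auto
qed

text \<open>Conditional expectations onto a fixed level are dominated by the dyadic maximal function, so that
  no differentiation theorem is needed to compare the \<open>L\<^sup>1\<close> and \<open>H\<^sup>1\<close> norms.\<close>

lemma H1_weak_type_if_weak_type:
  assumes weak: "rademacher_weak_type smul D (Lp lebesgue 1) L1_norm"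
  shows "rademacher_weak_type smul D (H1 D) (H1_norm D)"
proof -
  obtain C where C: "0 \<le> C" "\<And>f t. f \<in> Lp lebesgue 1 \<Longrightarrow> 0 < t \<Longrightarrow>
      emeasure lebesgue {x. rademacher_maximal smul D f x > ennreal t} \<le> ennreal (C / t) * L1_norm f"
    using weak unfolding rademacher_weak_type_def by blast
  have "emeasure lebesgue {x. ennreal t < rademacher_maximal smul D f x} \<le> ennreal (C / t) * H1_norm D f"
    if fH: "f \<in> H1 D" and t: "0 < t" for f and t :: real
  proof (rule emeasure_rademacher_maximal_le)
    fix i :: nat
    have f: "loc_int f" using fH by (intro loc_int_L1) (simp add: H1_def)
    define g where "g = stopped f (\<lambda>_. int i)"
    have gl: "level_const (int i) g"
      unfolding g_def by (rule level_const_stopped[OF stopping_const])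
    \<comment> \<open>The value of g at x is itself an average of f over a cube containing
      x.\<close>
    have "norm (g x) \<le> dyadic_maximal D f x" for x
      unfolding g_def stopped_def dyadic_maximal_def by (rule SUP_upper2[of "cube (int i) x"]) auto
    then have le: "L1_norm g \<le> H1_norm D f"
      unfolding L1_norm_def H1_norm_def by (intro nn_integral_mono) auto
    have gL: "g \<in> Lp lebesgue 1"
      using le fH level_const_strongly_measurable[OF gl]
      by (auto simp: Lp_def H1_def L1_norm_def intro: le_less_trans)
    have "Rm f (- int i) (int i) x = Rm g (- int i) (int i) x" for x
      unfolding g_def by (intro Rm_cong average_stopped[OF f stopping_const, symmetric])
    then have "{x. ennreal t < Rm f (- int i) (int i) x} \<subseteq> {x. ennreal t < rademacher_maximal smul D g x}"
      using Rm_le_maximal by (auto intro: less_le_trans)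
    then have "emeasure lebesgue {x. ennreal t < Rm f (- int i) (int i) x} \<le> emeasure lebesgue {x. ennreal t < rademacher_maximal smul D g x}"
      by (intro emeasure_mono rademacher_maximal_sets)
    also have "\<dots> \<le> ennreal (C / t) * L1_norm g"
      by (rule C(2)[OF gL t])
    also have "\<dots> \<le> ennreal (C / t) * H1_norm D f"
      by (intro mult_left_mono le) simp
    finally show "emeasure lebesgue {x. ennreal t < Rm f (- int i) (int i) x} \<le> ennreal (C / t) * H1_norm D f" .
  qed
  then show ?thesis
    unfolding rademacher_weak_type_def using C(1) by (intro exI[of _ C]) auto
qed

end

theorem theorem1:
  fixes smul :: "'k::{real_normed_field,real_inner} \<Rightarrow> 'x::banach \<Rightarrow> 'x"
    and D :: "int \<Rightarrow> (real^'n) set set"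
  assumes "banach_scaling smul"
    and "dyadic_system D"
  shows
    "((\<forall>p>1. \<forall>w\<in>dyadic_A_p D p. rademacher_strong_type smul D (weighted_measure w) p)
        \<longleftrightarrow> (\<exists>p>1. rademacher_strong_type smul D lebesgue p)) \<and>
     ((\<exists>p>1. rademacher_strong_type smul D lebesgue p)
        \<longleftrightarrow> rademacher_weak_type smul D (Lp lebesgue 1) L1_norm) \<and>
     (rademacher_weak_type smul D (Lp lebesgue 1) L1_norm
        \<longleftrightarrow> rademacher_weak_type smul D (H1 D) (H1_norm D))"
proof -
  interpret rademacher D smul
    by unfold_locales (use assms in auto)
  let ?i = "\<forall>p>1. \<forall>w\<in>dyadic_A_p D p. rademacher_strong_type smul D (weighted_measure w) p"
  let ?ii = "\<exists>p>1. rademacher_strong_type smul D lebesgue p"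
  let ?iii = "rademacher_weak_type smul D (Lp lebesgue 1) L1_norm"
  let ?iv = "rademacher_weak_type smul D (H1 D) (H1_norm D)"
  have "?ii" if ?i
  proof (intro exI conjI)
    have "rademacher_strong_type smul D (weighted_measure (\<lambda>_. 1)) 2"
      using that one_in_A_p[of 2] by simp
    then show "rademacher_strong_type smul D lebesgue 2"
      by (simp add: weighted_measure_def density_1)
  qed simp
  moreover have "?iii" if ?ii
    using that weak_type_if_strong_type by blast
  moreover have "?iv" if ?iii
    using that by (rule H1_weak_type_if_weak_type)
  moreover have "?i" if ?iv
    using bounded_test_if_H1[OF that] local_weak_if_bounded_test strong_type_if_local_weak by blast
  ultimately show ?thesis by blast
qed

end
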